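(* Let $N\ge1$, let $E=\bigcup_{j=1}^{2N-1}(\pi\mathbb{Z}/t_j)$ and, for $k^*\in E$, let $n(k^* )=\#\{j: 1\le j\le 2N-1,\ t_jk^*\in\pi\mathbb{Z}\}$. Let $k^*\in E$. For $\delta\in\mathbb{C}\setminus\{0\}$ sufficiently small (respectively, $|\delta|$ sufficiently large) there exist exactly $n(k^* )$ (counting multiplicities) non-trivial resonant frequencies $\omega=kv$ of the scattering problem $(\mathrm{SP}_\delta)$ near $k^*v$ (that is, in any fixed sufficiently small neighbourhood of $k^*v$, once $|\delta|$ is small, resp. large, enough), and they satisfy $C_1(\sigma)<\operatorname{Im}k<C_2(\sigma)$, where $\sigma=\delta/r$ and $C_1(\sigma)<C_2(\sigma)$ are any real constants such that all zeros $k$ of $f(\cdot;\sigma)$ lie in the strip $C_1(\sigma)<\operatorname{Im}k<C_2(\sigma)$ (such constants exist for $\sigma\neq\pm1$). In particular, near each $k^*v$, each such resonance $\omega(\delta)$ is an analytic function of $\delta^{s}$ (respectively, of $\delta^{-s}$) for a certain rational $s\ge\frac1{n(k^* )}$.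
   Context: Setting. $x_1^-<x_1^+<x_2^-<x_2^+<\dots<x_N^-<x_N^+$ are real numbers, $D=\bigcup_{j=1}^N(x_j^-,x_j^+)$, $\ell_j=x_j^+-x_j^-$, $s_j=x_{j+1}^--x_j^+$. The constants $v,v_b>0$ are fixed and $r=v/v_b>0$. For $\omega\in\mathbb{C}$ put $k=\omega/v$ and $k_b=\omega/v_b=rk$. $w|_\pm(x)=\lim_{s\to0^+}w(x\pm s)$. The scattering problem $(\mathrm{SP}_\delta)$ at frequency $\omega$ is: $u''+k^2u=0$ on $\mathbb{R}\setminus \overline{D}$; $u''+k_b^2u=0$ on $D$; for all $1\le j\le N$: $u|_+(x_j^\pm)=u|_-(x_j^\pm)$, $u'|_+(x_j^-)=\delta\,u'|_-(x_j^-)$, $u'|_-(x_j^+)=\delta\,u'|_+(x_j^+)$; and $-u'-iku=0$ on $(-\infty,x_1^-)$, $u'-iku=0$ on $(x_N^+,\infty)$. $\omega$ is a resonant frequency if this problem has a non-trivial solution $u$; it is non-trivial if $\omega\ne0$. $\boldsymbol t=(t_1,\dots,t_{2N-1})=(r\ell_1,s_1,r\ell_2,s_2,\dots,r\ell_{N-1},s_{N-1},r\ell_N)\in\mathbb{R}_{>0}^{2N-1}$. With $\sigma=\delta/r$, the non-trivial resonant frequencies $\omega=kv$ are exactly those for which $k$ is a zero of $$f(k;\sigma)=\sum_{\boldsymbol\alpha\in\{-1,1\}^{2N-1}}(-1)^{\sum_{j=1}^{2N}j\,\epsilon_{\alpha_j,\alpha_{j-1}}}\left(\frac{1-\sigma}{1+\sigma}\right)^{\sum_{j=1}^{2N}\epsilon_{\alpha_j,\alpha_{j-1}}}e^{i\langle\boldsymbol\alpha,\boldsymbol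 t\rangle k},$$ with $\alpha_0=\alpha_{2N}=-1$, $\epsilon_{a,b}=1$ if $a\neq b$ and $0$ if $a=b$, and the multiplicity of a resonance $\omega=kv$ is the multiplicity of $k$ as a zero of $f(\cdot;\sigma)$. "$\omega(\delta)$ is an analytic function of $\delta^s$" means $\omega(\delta)=h(\delta^s)$ for a function $h$ analytic near $0$ and a branch of $\delta^s$ (Puiseux expansion); similarly for $\delta^{-s}$ as $\delta\to\infty$. The exponent $s$ may depend on the branch. *)

theory Defs
  imports "HOL-Complex_Analysis.Complex_Analysis"
begin

(* Resonators: the intervals (xm j, xp j) for 1 <= j <= N. Values of xm, xp outside {1..N}
   are irrelevant. *)

definition resonators :: "nat \<Rightarrow> (nat \<Rightarrow> real) \<Rightarrow> (nat \<Rightarrow> real) \<Rightarrow> real set" where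
  "resonators N xm xp = (\<Union>j\<in>{1..N}. {xm j<..<xp j})"

abbreviation dx :: "(real \<Rightarrow> complex) \<Rightarrow> real \<Rightarrow> complex" where
  "dx u \<equiv> (\<lambda>x. vector_derivative u (at x))"

definition helmholtz_on :: "real set \<Rightarrow> complex \<Rightarrow> (real \<Rightarrow> complex) \<Rightarrow> bool" where
  "helmholtz_on S \<kappa> u \<longleftrightarrow>
     (\<forall>x\<in>S. u differentiable (at x) \<and> dx u differentiable (at x) \<and>
            dx (dx u) x + \<kappa>\<^sup>2 * u x = 0)"

(* The scattering problem (SP_\<delta>) at frequency \<omega>. The one-sided traces are limits; the values
   of u at the interface points themselves play no role. *)

definition scattering_solution ::
  "nat \<Rightarrow> (nat \<Rightarrow> real) \<Rightarrow> (nat \<Rightarrow> real) \<Rightarrow> real \<Rightarrow> real \<Rightarrow> complex \<Rightarrow> complex \<Rightarrow>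
   (real \<Rightarrow> complex) \<Rightarrow> bool" where
  "scattering_solution N xm xp v vb \<delta> \<omega> u \<longleftrightarrow>
     (let k = \<omega> / of_real v; kb = \<omega> / of_real vb; D = resonators N xm xp in
       helmholtz_on (- closure D) k u \<and>
       helmholtz_on D kb u \<and>
       (\<forall>j\<in>{1..N}. \<forall>x\<in>{xm j, xp j}.
          \<exists>c. (u \<longlongrightarrow> c) (at_right x) \<and> (u \<longlongrightarrow> c) (at_left x)) \<and>
       (\<forall>j\<in>{1..N}. \<exists>a b. (dx u \<longlongrightarrow> a) (at_right (xm j)) \<and> (dx u \<longlongrightarrow> b) (at_left (xm j)) \<and>
          a = \<delta> * b) \<and>
       (\<forall>j\<in>{1..N}. \<exists>a b. (dx u \<longlongrightarrow> a) (at_right (xp j)) \<and> (dx u \<longlongrightarrow> b) (at_left (xp j)) \<and>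
          b = \<delta> * a) \<and>
       (\<forall>x<xm 1. - dx u x - \<i> * k * u x = 0) \<and>
       (\<forall>x>xp N. dx u x - \<i> * k * u x = 0))"

(* A solution counts as non-zero only if it is non-zero somewhere off the interface points, where
   its values are constrained by the problem. *)

definition resonant_frequency ::
  "nat \<Rightarrow> (nat \<Rightarrow> real) \<Rightarrow> (nat \<Rightarrow> real) \<Rightarrow> real \<Rightarrow> real \<Rightarrow> complex \<Rightarrow> complex \<Rightarrow> bool" where
  "resonant_frequency N xm xp v vb \<delta> \<omega> \<longleftrightarrow>
     (\<exists>u. scattering_solution N xm xp v vb \<delta> \<omega> u \<and>
          (\<exists>x \<in> resonators N xm xp \<union> - closure (resonators N xm xp). u x \<noteq> 0))"

definition nontrivial_resonances ::
  "nat \<Rightarrow> (nat \<Rightarrow> real) \<Rightarrow> (nat \<Rightarrow> real) \<Rightarrow> real \<Rightarrow> real \<Rightarrow> complex \<Rightarrow> complex set" where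
  "nontrivial_resonances N xm xp v vb \<delta> =
     {\<omega>. \<omega> \<noteq> 0 \<and> resonant_frequency N xm xp v vb \<delta> \<omega>}"

(* t_{2m-1} = r * l_m and t_{2m} = s_m; only the indices 1..2N-1 are used. *)

definition tvec :: "(nat \<Rightarrow> real) \<Rightarrow> (nat \<Rightarrow> real) \<Rightarrow> real \<Rightarrow> nat \<Rightarrow> real" where
  "tvec xm xp r j =
     (if odd j then r * (xp (Suc j div 2) - xm (Suc j div 2))
      else xm (Suc (j div 2)) - xp (j div 2))"

(* The convention \<alpha>_0 = \<alpha>_{2N} = -1. *)

definition extend_signs :: "nat \<Rightarrow> (nat \<Rightarrow> int) \<Rightarrow> nat \<Rightarrow> int" where
  "extend_signs N \<alpha> j = (if j \<in> {1..2*N-1} then \<alpha> j else -1)"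

definition sign_change :: "nat \<Rightarrow> (nat \<Rightarrow> int) \<Rightarrow> nat \<Rightarrow> nat" where
  "sign_change N \<alpha> j = (if extend_signs N \<alpha> j \<noteq> extend_signs N \<alpha> (j - 1) then 1 else 0)"

definition res_fun :: "nat \<Rightarrow> (nat \<Rightarrow> real) \<Rightarrow> complex \<Rightarrow> complex \<Rightarrow> complex" where
  "res_fun N t \<sigma> k =
     (\<Sum>\<alpha> \<in> {1..2*N-1} \<rightarrow>\<^sub>E {-1, 1}.
        (-1) ^ (\<Sum>j=1..2*N. j * sign_change N \<alpha> j)
        * ((1 - \<sigma>) / (1 + \<sigma>)) ^ (\<Sum>j=1..2*N. sign_change N \<alpha> j)
        * exp (\<i> * of_real (\<Sum>j=1..2*N-1. of_int (\<alpha> j) * t j) * k))"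

definition resonance_multiplicity ::
  "nat \<Rightarrow> (nat \<Rightarrow> real) \<Rightarrow> (nat \<Rightarrow> real) \<Rightarrow> real \<Rightarrow> real \<Rightarrow> complex \<Rightarrow> complex \<Rightarrow> nat" where
  "resonance_multiplicity N xm xp v vb \<delta> \<omega> =
     nat (zorder (res_fun N (tvec xm xp (v / vb)) (\<delta> / of_real (v / vb))) (\<omega> / of_real v))"

definition zeros_in_strip :: "nat \<Rightarrow> (nat \<Rightarrow> real) \<Rightarrow> complex \<Rightarrow> real \<Rightarrow> real \<Rightarrow> bool" where
  "zeros_in_strip N t \<sigma> C1 C2 \<longleftrightarrow>
     C1 < C2 \<and> (\<forall>k. res_fun N t \<sigma> k = 0 \<longrightarrow> C1 < Im k \<and> Im k < C2)"

definition limit_set :: "nat \<Rightarrow> (nat \<Rightarrow> real) \<Rightarrow> real set" where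
  "limit_set N t = (\<Union>j\<in>{1..2*N-1}. {pi * of_int m / t j | m :: int. True})"

definition limit_count :: "nat \<Rightarrow> (nat \<Rightarrow> real) \<Rightarrow> real \<Rightarrow> nat" where
  "limit_count N t k = card {j \<in> {1..2*N-1}. \<exists>m::int. t j * k = pi * of_int m}"

(* The resonances lying in W are, counted with multiplicity, the n numbers h i (z^(s i)), i < n.
   A branch of z^s is exp (s * L) for a branch L of log z; the list is required to be the right
   one for every value L of the logarithm, hence along every branch. For z = \<delta> this describes
   resonances analytic in a power of \<delta>, for z = 1/\<delta> in a power of 1/\<delta>. *)

definition branches_at ::
  "nat \<Rightarrow> (nat \<Rightarrow> complex \<Rightarrow> complex) \<Rightarrow> (nat \<Rightarrow> real) \<Rightarrow> complex \<Rightarrow>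
   complex set \<Rightarrow> (complex \<Rightarrow> nat) \<Rightarrow> bool" where
  "branches_at n h s z W mu \<longleftrightarrow>
     (\<forall>L. exp L = z \<longrightarrow>
        (\<forall>i<n. h i (exp (of_real (s i) * L)) \<in> W) \<and>
        (\<forall>\<omega>\<in>W. mu \<omega> = card {i. i < n \<and> h i (exp (of_real (s i) * L)) = \<omega>}))"

end

theory Submission
  imports Defs
begin

text \<open>
  Write \<open>\<rho> = (1 - \<sigma>) / (1 + \<sigma>)\<close>. Off the interfaces a solution of the scattering problem is a pair of
  plane waves in each of the \<open>2N + 1\<close> chambers cut out by the interfaces, so the problem is a finite
  linear transfer problem, and summing the transfer products over all paths of signs gives \<open>f(k; \<sigma>)\<close>.
  The recursion \<open>amp\<close> is the common form of both sides: \<open>res_fun_eq_amp\<close> identifies it with the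
  exponential sum, \<open>joints_iff\<close> with the amplitudes of a solution, and together they give
  \<open>resonant_frequency_iff_zero\<close>: for \<open>\<sigma>\<close> other than \<open>0\<close> and \<open>-1\<close>, a frequency \<open>\<omega> \<noteq> 0\<close> is resonant iff \<open>f(\<omega> / v; \<sigma>) = 0\<close>.
  Three more facts are read off from the recursion. The function \<open>f\<close> is even in \<open>\<rho>\<close>, hence \<open>f(k; \<sigma>) = f(k; 1 / \<sigma>)\<close>
  (\<open>res_fun_inverse\<close>) and large \<open>\<delta>\<close> is the same problem as small \<open>\<delta>\<close>. For \<open>\<sigma> \<noteq> 0\<close> its value at \<open>k = 0\<close> is
  \<open>(1 - \<rho>\<^sup>2)^N \<noteq> 0\<close>, so every zero is a non-trivial resonance. At \<open>\<sigma> = 0\<close> all interface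
  matrices have rank one and \<open>f(k; 0) = - \<Prod>\<^sub>j 2 \<i> sin (t\<^sub>j k)\<close> (\<open>res_fun_0\<close>), which vanishes at \<open>k\<^sup>*\<close> to order exactly
  \<open>n(k\<^sup>*)\<close>.

  What remains is a statement on zeros of a holomorphic function depending holomorphically on a
  parameter: if \<open>G(\<cdot>, 0)\<close> vanishes at \<open>k\<^sub>0\<close> to order \<open>n\<close>, then for small \<open>z \<noteq> 0\<close> there are \<open>n\<close> zeros near
  \<open>k\<^sub>0\<close>, and they are convergent Puiseux series in \<open>z\<close> (\<open>puiseux_zeros\<close>). By the argument principle the
  weighted sums of \<open>g\<close> over the zeros in a disc are holomorphic in \<open>z\<close> for every entire \<open>g\<close>
  (\<open>psum_holomorphic\<close>); with \<open>g = 1\<close> the number of zeros with multiplicity is constant. A discriminant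
  built from such sums is holomorphic as well, so the number \<open>m\<close> of distinct zeros is constant on a
  punctured disc around \<open>0\<close> (\<open>card_zeros_generic\<close>). Over this punctured disc the zeros form a covering
  space (\<open>zeros_covering_space\<close>). Lifting \<open>exp\<close> from a left half-plane yields \<open>m\<close> holomorphic functions
  \<open>\<kappa>\<^sub>w(L)\<close> that list the zeros at the parameter \<open>e\<^sup>L\<close>. Among the translates of such a function by
  \<open>0, 2 \<pi> \<i>, \<dots>, 2 \<pi> \<i> m\<close> two agree, so it has a period \<open>2 \<pi> \<i> p\<close> with \<open>p \<le> m \<le> n\<close>. It is therefore a
  function of \<open>e\<^sup>L\<^sup>/\<^sup>p\<close>, bounded near \<open>0\<close>, hence analytic there: this is the exponent \<open>s = 1 / p \<ge> 1 / n\<close>.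
\<close>

section \<open>Zeros of a holomorphic family and sums over them\<close>

lemma finite_zeros_cball:
  assumes f: "f holomorphic_on UNIV" and nz: "f w \<noteq> (0::complex)"
  shows "finite {z \<in> cball c R. f z = 0}"
proof (cases "f constant_on UNIV")
  case True
  then have "{z \<in> cball c R. f z = 0} = {}" using nz by (force simp: constant_on_def)
  then show ?thesis by (simp only: finite.emptyI)
next
  case False
  then show ?thesis
    by (intro holomorphic_compact_finite_zeros[OF f]) auto
qed

lemma eventually_nonzero_at:
  assumes f: "f holomorphic_on UNIV" and nz: "f w \<noteq> (0::complex)"
  shows "\<forall>\<^sub>F z in at c. f z \<noteq> 0"
  using non_zero_neighbour_alt[OF f, of c w] nz by auto

lemma zorder_pos_of_zero:
  assumes f: "f holomorphic_on UNIV" and nz: "f w \<noteq> (0::complex)" and z: "f z = 0"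
  shows "zorder f z > 0"
proof -
  have "\<exists>\<^sub>F x in at z. f x \<noteq> 0"
    using eventually_nonzero_at[OF f nz, of z] by (intro eventually_frequently) auto
  then show ?thesis using zorder_pos_iff[OF f open_UNIV, of z] z by auto
qed

text \<open>
  The argument principle on a slightly larger disc: the zeros outside the circle have winding number
  \<open>0\<close> and those inside have winding number \<open>1\<close>.
\<close>

lemma sum_over_zeros_eq_contour_integral:
  assumes f: "f holomorphic_on UNIV" and g: "g holomorphic_on UNIV" and R: "R > 0"
    and nz: "\<And>k. k \<in> sphere c R \<Longrightarrow> f k \<noteq> (0::complex)"
  shows "contour_integral (circlepath c R) (\<lambda>x. deriv f x * g x / f x)
           = 2 * pi * \<i> * (\<Sum>z\<in>{z \<in> ball c R. f z = 0}. of_int (zorder f z) * g z)"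
proof -
  define S where "S = ball c (R + 1)"
  have nzw: "f (c + of_real R) \<noteq> 0" using nz[of "c + of_real R"] R by (simp add: dist_norm)
  have fin: "finite {w\<in>S. f w = 0 \<or> w \<in> {}}"
    by (rule finite_subset[OF _ finite_zeros_cball[OF f nzw, of c "R+1"]]) (auto simp: S_def)
  have "contour_integral (circlepath c R) (\<lambda>x. deriv f x * g x / f x) = 2 * pi * \<i> *
          (\<Sum>p\<in>{w\<in>S. f w = 0 \<or> w \<in> {}}. winding_number (circlepath c R) p * g p * zorder f p)"
  proof (rule argument_principle)
    show "\<forall>z. z \<notin> S \<longrightarrow> winding_number (circlepath c R) z = 0"
      using R by (auto simp: S_def intro!: winding_number_zero_outside[where s = "cball c R"])
    show "path_image (circlepath c R) \<subseteq> S - {w\<in>S. f w = 0 \<or> w \<in> {}}"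
      using nz R by (auto simp: S_def)
  qed (use f g fin in \<open>auto simp: S_def intro: holomorphic_on_subset\<close>)
  also have "(\<Sum>p\<in>{w\<in>S. f w = 0 \<or> w \<in> {}}. winding_number (circlepath c R) p * g p * zorder f p)
     = (\<Sum>p\<in>{z \<in> ball c R. f z = 0}. winding_number (circlepath c R) p * g p * zorder f p)"
  proof (rule sum.mono_neutral_right[OF fin])
    show "\<forall>i\<in>{w \<in> S. f w = 0 \<or> w \<in> {}} - {z \<in> ball c R. f z = 0}.
       winding_number (circlepath c R) i * g i * of_int (zorder f i) = 0"
    proof
      fix i assume i: "i \<in> {w \<in> S. f w = 0 \<or> w \<in> {}} - {z \<in> ball c R. f z = 0}"
      then have "i \<notin> cball c R" using nz[of i] by (auto simp: order_le_less)
      then have "winding_number (circlepath c R) i = 0"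
        using R by (intro winding_number_zero_outside[where s = "cball c R"]) auto
      then show "winding_number (circlepath c R) i * g i * of_int (zorder f i) = 0" by simp
    qed
  qed (auto simp: S_def)
  also have "\<dots> = (\<Sum>z\<in>{z \<in> ball c R. f z = 0}. of_int (zorder f z) * g z)"
    by (intro sum.cong refl) (auto simp: winding_number_circlepath dist_norm norm_minus_commute)
  finally show ?thesis .
qed

text \<open>
  A finite sum of products \<open>a\<^sub>i(z) b\<^sub>i(k)\<close> makes all partial derivatives explicit and jointly continuous,
  which is what differentiation under the integral sign asks for. The zeros are taken in \<open>k\<close>, and \<open>z\<close>
  is the parameter.
\<close>

locale holomorphic_family =
  fixes I :: "'i set" and a :: "'i \<Rightarrow> complex \<Rightarrow> complex" and b :: "'i \<Rightarrow> complex \<Rightarrow> complex"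
    and \<Omega> :: "complex set"
  assumes finite_I: "finite I" and open_\<Omega>: "open \<Omega>"
    and a_hol: "\<And>i. i \<in> I \<Longrightarrow> a i holomorphic_on \<Omega>"
    and b_hol: "\<And>i. i \<in> I \<Longrightarrow> b i holomorphic_on UNIV"
begin

definition G :: "complex \<Rightarrow> complex \<Rightarrow> complex" where
  "G z k = (\<Sum>i\<in>I. a i z * b i k)"

definition zeros :: "complex \<Rightarrow> complex set \<Rightarrow> complex set" where
  "zeros z B = {k \<in> B. G z k = 0}"

lemma G_hol: "G z holomorphic_on UNIV"
  unfolding G_def[abs_def] by (intro holomorphic_intros b_hol)

lemma deriv_G: "deriv (G z) k = (\<Sum>i\<in>I. a i z * deriv (b i) k)"
  unfolding G_def[abs_def]
  by (rule DERIV_imp_deriv)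
     (auto intro!: derivative_eq_intros holomorphic_derivI[OF b_hol] simp: mult.commute)

lemma G_param_deriv:
  assumes "z \<in> \<Omega>"
  shows "((\<lambda>z. G z k) has_field_derivative (\<Sum>i\<in>I. deriv (a i) z * b i k)) (at z within T)"
    "((\<lambda>z. deriv (G z) k) has_field_derivative (\<Sum>i\<in>I. deriv (a i) z * deriv (b i) k)) (at z within T)"
proof -
  have D: "(a i has_field_derivative deriv (a i) z) (at z within T)" if "i \<in> I" for i
    using holomorphic_derivI[OF a_hol[OF that] open_\<Omega> assms] by (rule DERIV_subset) auto
  show "((\<lambda>z. G z k) has_field_derivative (\<Sum>i\<in>I. deriv (a i) z * b i k)) (at z within T)"
    unfolding G_def by (auto intro!: derivative_eq_intros D)
  show "((\<lambda>z. deriv (G z) k) has_field_derivative (\<Sum>i\<in>I. deriv (a i) z * deriv (b i) k)) (at z within T)"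
    unfolding deriv_G by (auto intro!: derivative_eq_intros D)
qed

lemma family_cont:
  assumes "continuous_on A f" "f ` A \<subseteq> \<Omega>" "continuous_on A g"
  shows "continuous_on A (\<lambda>x. G (f x) (g x))"
    "continuous_on A (\<lambda>x. deriv (G (f x)) (g x))"
    "continuous_on A (\<lambda>x. \<Sum>i\<in>I. deriv (a i) (f x) * b i (g x))"
    "continuous_on A (\<lambda>x. \<Sum>i\<in>I. deriv (a i) (f x) * deriv (b i) (g x))"
proof -
  have 1: "continuous_on A (\<lambda>x. a i (f x))" "continuous_on A (\<lambda>x. deriv (a i) (f x))"
    "continuous_on A (\<lambda>x. b i (g x))" "continuous_on A (\<lambda>x. deriv (b i) (g x))" if "i \<in> I" for i
    using continuous_on_compose2[OF holomorphic_on_imp_continuous_on[OF a_hol[OF that]] assms(1,2)]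
      continuous_on_compose2[OF holomorphic_on_imp_continuous_on[OF holomorphic_deriv[OF a_hol[OF that] open_\<Omega>]] assms(1,2)]
      continuous_on_compose2[OF holomorphic_on_imp_continuous_on[OF b_hol[OF that]] assms(3)]
      continuous_on_compose2[OF holomorphic_on_imp_continuous_on[OF holomorphic_deriv[OF b_hol[OF that] open_UNIV]] assms(3)]
    by auto
  show "continuous_on A (\<lambda>x. G (f x) (g x))"
    "continuous_on A (\<lambda>x. deriv (G (f x)) (g x))"
    "continuous_on A (\<lambda>x. \<Sum>i\<in>I. deriv (a i) (f x) * b i (g x))"
    "continuous_on A (\<lambda>x. \<Sum>i\<in>I. deriv (a i) (f x) * deriv (b i) (g x))"
    unfolding G_def deriv_G by (intro continuous_intros 1; assumption)+
qed

text \<open>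
  By compactness \<open>\<bar>G z\<^sub>0\<bar>\<close> has a positive minimum on \<open>K\<close>, and the family is continuous in \<open>z\<close>
  uniformly on \<open>K\<close>.
\<close>

lemma nonvanishing_stable:
  assumes "z0 \<in> \<Omega>" "compact K" "\<And>k. k \<in> K \<Longrightarrow> G z0 k \<noteq> 0"
  obtains e where "e > 0" "ball z0 e \<subseteq> \<Omega>" "\<And>z k. z \<in> ball z0 e \<Longrightarrow> k \<in> K \<Longrightarrow> G z k \<noteq> 0"
proof (cases "K = {}")
  case True
  obtain e where "e > 0" "ball z0 e \<subseteq> \<Omega>" using open_\<Omega> assms(1) by (meson openE)
  then show ?thesis using True that by blast
next
  case False
  have "continuous_on K (\<lambda>k. norm (G z0 k))"
    using holomorphic_on_imp_continuous_on[OF G_hol] by (intro continuous_intros) (blast intro: continuous_on_subset)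
  then obtain k0 where k0: "k0 \<in> K" "\<And>k. k \<in> K \<Longrightarrow> norm (G z0 k0) \<le> norm (G z0 k)"
    using continuous_attains_inf[OF assms(2) False] by blast
  define m where "m = norm (G z0 k0)"
  have m: "m > 0" using assms(3) k0 by (simp add: m_def)
  have "continuous_on (\<Omega> \<times> K) (\<lambda>x. G (fst x) (snd x))"
    by (intro family_cont continuous_intros) auto
  from continuous_on_prod_compactE[OF this assms(2,1), of "m/2"] m
  obtain X where X: "z0 \<in> X" "open X"
      "\<forall>x\<in>X \<inter> \<Omega>. \<forall>t\<in>K. dist (G (fst (x, t)) (snd (x, t))) (G (fst (z0, t)) (snd (z0, t))) \<le> m / 2"
    by auto
  have "open (X \<inter> \<Omega>)" "z0 \<in> X \<inter> \<Omega>" using X open_\<Omega> assms by auto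
  then obtain e where e: "e > 0" "ball z0 e \<subseteq> X \<inter> \<Omega>" by (meson openE)
  show ?thesis
  proof
    fix z k assume "z \<in> ball z0 e" "k \<in> K"
    then have "dist (G z k) (G z0 k) \<le> m / 2" "m \<le> norm (G z0 k)"
      using X e(2) k0 unfolding m_def fst_conv snd_conv by blast+
    then show "G z k \<noteq> 0" using m by (auto simp: dist_norm)
  qed (use e in auto)
qed

text \<open>
  With \<open>g k = k ^ j\<close> these are the power sums of the zeros, counted with multiplicity.
\<close>

definition psum :: "complex \<Rightarrow> real \<Rightarrow> (complex \<Rightarrow> complex) \<Rightarrow> complex \<Rightarrow> complex" where
  "psum c R g z = (\<Sum>k\<in>zeros z (ball c R). of_int (zorder (G z) k) * g k)"

text \<open>
  The argument principle writes the sum as an integral over a fixed circle, whose integrand is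
  holomorphic in the parameter as long as no zero meets the circle.
\<close>

lemma psum_holomorphic:
  assumes T: "convex T" "T \<subseteq> \<Omega>" and R: "R > 0" and g: "g holomorphic_on UNIV"
    and nz: "\<And>z k. z \<in> T \<Longrightarrow> k \<in> sphere c R \<Longrightarrow> G z k \<noteq> 0"
  shows "psum c R g holomorphic_on T"
proof -
  define \<gamma> where "\<gamma> = circlepath c R"
  define w where "w x = vector_derivative \<gamma> (at x)" for x
  have w: "w x = 2 * pi * \<i> * R * exp (2 * of_real pi * \<i> * x)" for x
    unfolding w_def \<gamma>_def by (rule vector_derivative_circlepath)
  have \<gamma>: "\<gamma> x \<in> sphere c R" if "x \<in> {0..1}" for x
    using that R path_image_circlepath[of c R] unfolding path_image_def \<gamma>_def by auto
  have c\<gamma>: "continuous_on A (\<lambda>x. \<gamma> (f x))" if "continuous_on A f" for A :: "(complex \<times> real) set" and f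
    unfolding \<gamma>_def circlepath by (intro continuous_intros that)
  have c\<gamma>': "continuous_on A \<gamma>" for A 
    unfolding \<gamma>_def circlepath by (intro continuous_intros)
  have gc: "continuous_on A (\<lambda>x. g (f x))" if "continuous_on A f" for A :: "'x::topological_space set" and f
    using continuous_on_compose2[OF holomorphic_on_imp_continuous_on[OF g] that] by auto
  define F where "F z x = deriv (G z) (\<gamma> x) * g (\<gamma> x) / G z (\<gamma> x) * w x" for z x
  define F' where "F' z x = ((\<Sum>i\<in>I. deriv (a i) z * deriv (b i) (\<gamma> x)) * G z (\<gamma> x) -
        deriv (G z) (\<gamma> x) * (\<Sum>i\<in>I. deriv (a i) z * b i (\<gamma> x))) / (G z (\<gamma> x))^2 * g (\<gamma> x) * w x" for z x
  have eq: "psum c R g z = integral (cbox 0 1) (F z) / (2 * pi * \<i>)" if "z \<in> T" for z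
  proof -
    have "contour_integral \<gamma> (\<lambda>x. deriv (G z) x * g x / G z x) = 2 * pi * \<i> * psum c R g z"
      unfolding psum_def zeros_def \<gamma>_def
      by (rule sum_over_zeros_eq_contour_integral[OF G_hol g R nz[OF that]])
    then have "integral {0..1} (F z) = 2 * pi * \<i> * psum c R g z"
      unfolding contour_integral_integral F_def w_def by simp
    then show ?thesis by (simp del: of_real_mult)
  qed
  have "((\<lambda>z. integral (cbox 0 1) (F z)) has_field_derivative integral (cbox 0 1) (F' z0)) (at z0 within T)"
    if "z0 \<in> T" for z0
  proof (rule leibniz_rule_field_derivative[OF _ _ _ that T(1)])
    fix z and x::real assume z: "z \<in> T" "x \<in> cbox 0 1"
    then have nz0: "G z (\<gamma> x) \<noteq> 0" using nz \<gamma> by auto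
    have zO: "z \<in> \<Omega>" using z T by auto
    show "((\<lambda>z. F z x) has_field_derivative F' z x) (at z within T)"
      unfolding F_def F'_def
      by (rule DERIV_cong[OF DERIV_cmult_right[OF DERIV_divide[OF DERIV_cmult_right[OF
            G_param_deriv(2)[OF zO]] G_param_deriv(1)[OF zO] nz0]]])
         (use nz0 in \<open>simp add: divide_simps power2_eq_square left_diff_distrib\<close>)
  next
    fix z assume z: "z \<in> T"
    have "continuous_on {0..1} (F z)"
      unfolding F_def w using z T nz \<gamma> by (intro continuous_intros family_cont gc c\<gamma>') auto
    then show "F z integrable_on cbox 0 1"
      unfolding cbox_interval by (rule integrable_continuous_real)
  next
    show "continuous_on (T \<times> cbox 0 1) (\<lambda>(z, x). F' z x)"
      unfolding F'_def w split_def using T nz \<gamma>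
      by (intro continuous_intros family_cont gc c\<gamma>) auto
  qed
  then have "(\<lambda>z. integral (cbox 0 1) (F z) / (2 * pi * \<i>)) holomorphic_on T"
    by (intro holomorphic_on_divide holomorphic_on_const)
       (auto simp: holomorphic_on_def field_differentiable_def)
  then show ?thesis using holomorphic_cong[OF refl eq, of T] by simp
qed

end

section \<open>The number of distinct zeros\<close>

lemma sum_PiE_insert:
  fixes f :: "('a \<Rightarrow> 'b) \<Rightarrow> 'c::comm_monoid_add"
  assumes "x \<notin> A"
  shows "(\<Sum>g\<in>Pi\<^sub>E (insert x A) B. f g) = (\<Sum>y\<in>B x. \<Sum>g\<in>Pi\<^sub>E A B. f (g(x := y)))"
proof -
  have "(\<Sum>g\<in>Pi\<^sub>E (insert x A) B. f g) = (\<Sum>(y, g)\<in>B x \<times> Pi\<^sub>E A B. f (g(x := y)))"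
    unfolding PiE_insert_eq
    by (subst sum.reindex[OF inj_combinator[OF assms]]) (simp add: case_prod_unfold)
  then show ?thesis by (simp add: sum.cartesian_product)
qed

lemma prod_sum_eq_sum_PiE:
  fixes h :: "'a \<Rightarrow> 'b \<Rightarrow> 'c::comm_semiring_1"
  assumes "finite A"
  shows "(\<Prod>a\<in>A. \<Sum>k\<in>B a. h a k) = (\<Sum>f\<in>Pi\<^sub>E A B. \<Prod>a\<in>A. h a (f a))"
  using assms
proof (induction A rule: finite_induct)
  case (insert x A)
  have "(\<Prod>a\<in>A. h a (if a = x then y else g a)) = (\<Prod>a\<in>A. h a (g a))" for y g
    using insert by (intro prod.cong) auto
  then show ?case using insert
    by (simp add: sum_PiE_insert sum_product)
qed simp

text \<open>
  The polynomials in \<open>x 0, \<dots>, x (m - 1)\<close>. Every one is a sum of monomials, and the sum of a monomial over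
  all \<open>m\<close>-tuples of zeros factors into power sums.
\<close>

inductive tuple_poly :: "nat \<Rightarrow> ((nat \<Rightarrow> complex) \<Rightarrow> complex) \<Rightarrow> bool" for m where
  monomial: "tuple_poly m (\<lambda>x. c * (\<Prod>a<m. x a ^ e a))"
| add: "tuple_poly m p \<Longrightarrow> tuple_poly m q \<Longrightarrow> tuple_poly m (\<lambda>x. p x + q x)"

lemma tuple_poly_const: "tuple_poly m (\<lambda>x. c)"
  using monomial[of m c "\<lambda>_. 0"] by simp

lemma tuple_poly_coord:
  assumes "a < m"
  shows "tuple_poly m (\<lambda>x. c * x a)"
proof -
  have "(\<Prod>b<m. x b ^ (if b = a then 1 else 0)) = x a" for x :: "nat \<Rightarrow> complex"
    using assms prod.delta[of "{..<m}" a x] by (simp add: if_distrib cong: if_cong)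
  then show ?thesis using monomial[of m c "\<lambda>b. if b = a then 1 else 0"] by simp
qed

lemma tuple_poly_mult:
  assumes "tuple_poly m p" "tuple_poly m q"
  shows "tuple_poly m (\<lambda>x. p x * q x)"
  using assms(1)
proof induction
  case (monomial c e)
  show ?case using assms(2)
  proof induction
    case (monomial c' e')
    have "(\<lambda>x. c * (\<Prod>a<m. x a ^ e a) * (c' * (\<Prod>a<m. x a ^ e' a))) =
          (\<lambda>x. (c * c') * (\<Prod>a<m. x a ^ (e a + e' a)))"
      by (simp add: power_add prod.distrib mult_ac)
    then show ?case by (metis tuple_poly.monomial)
  qed (simp add: distrib_left tuple_poly.add)
qed (simp add: distrib_right tuple_poly.add)

lemma tuple_poly_prod:
  assumes "\<And>i. i \<in> A \<Longrightarrow> tuple_poly m (p i)"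
  shows "tuple_poly m (\<lambda>x. \<Prod>i\<in>A. p i x)"
  using assms
  by (induction A rule: infinite_finite_induct) (auto intro: tuple_poly_const tuple_poly_mult)

text \<open>
  The product runs over ordered pairs, so it is the usual discriminant up to sign. In this
  form its invariance under permutations needs no sign bookkeeping.
\<close>

definition discriminant :: "nat \<Rightarrow> (nat \<Rightarrow> complex) \<Rightarrow> complex" where
  "discriminant m x = (\<Prod>a<m. \<Prod>b\<in>{..<m} - {a}. x a - x b)"

lemma tuple_poly_discriminant: "tuple_poly m (discriminant m)"
proof -
  have "tuple_poly m (\<lambda>x. x a - x b)" if "a < m" "b < m" for a b
    using add[OF tuple_poly_coord[OF that(1), of 1] tuple_poly_coord[OF that(2), of "-1"]] by simp
  then show ?thesis unfolding discriminant_def[abs_def] by (intro tuple_poly_prod) auto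
qed

lemma discriminant_eq_0: "\<not> inj_on x {..<m} \<Longrightarrow> discriminant m x = 0"
  unfolding discriminant_def inj_on_def by force

lemma discriminant_bij:
  assumes "bij_betw x {..<m} Z"
  shows "discriminant m x = (\<Prod>k\<in>Z. \<Prod>l\<in>Z - {k}. k - l)"
proof -
  have "bij_betw x ({..<m} - {a}) (Z - {x a})" if "a < m" for a
    using bij_betw_DiffI[OF assms, of "{a}" "{x a}"] bij_betw_apply[OF assms, of a] that by simp
  then have "(\<Prod>b\<in>{..<m} - {a}. x a - x b) = (\<Prod>l\<in>Z - {x a}. x a - l)" if "a < m" for a
    using that by (intro prod.reindex_bij_betw) auto
  then have "discriminant m x = (\<Prod>a<m. \<Prod>l\<in>Z - {x a}. x a - l)"
    unfolding discriminant_def by simp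
  then show ?thesis using prod.reindex_bij_betw[OF assms] by simp
qed

text \<open>
  Only injective tuples contribute. There are none if \<open>Z\<close> has fewer than \<open>m\<close> elements; if it has
  exactly \<open>m\<close>, each of them enumerates \<open>Z\<close>, and they all contribute the same non-zero amount. So the sum detects
  whether \<open>Z\<close> has \<open>m\<close> distinct points.
\<close>

lemma tuple_discriminant_sum:
  fixes w :: "complex \<Rightarrow> complex"
  assumes "finite Z" "\<And>k. k \<in> Z \<Longrightarrow> w k \<noteq> 0"
  shows "card Z < m \<Longrightarrow> (\<Sum>f\<in>{..<m} \<rightarrow>\<^sub>E Z. (\<Prod>a<m. w (f a)) * discriminant m f) = 0"
    and "card Z = m \<Longrightarrow> (\<Sum>f\<in>{..<m} \<rightarrow>\<^sub>E Z. (\<Prod>a<m. w (f a)) * discriminant m f) \<noteq> 0"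
proof -
  assume "card Z < m"
  have "\<not> inj_on f {..<m}" if "f \<in> {..<m} \<rightarrow>\<^sub>E Z" for f
    using \<open>card Z < m\<close> card_inj_on_le[of f "{..<m}" Z] that assms(1) by auto
  then show "(\<Sum>f\<in>{..<m} \<rightarrow>\<^sub>E Z. (\<Prod>a<m. w (f a)) * discriminant m f) = 0"
    by (intro sum.neutral) (auto simp: discriminant_eq_0)
next
  assume m: "card Z = m"
  define F where "F = {f \<in> {..<m} \<rightarrow>\<^sub>E Z. bij_betw f {..<m} Z}"
  define P where "P = (\<Prod>k\<in>Z. w k) * (\<Prod>k\<in>Z. \<Prod>l\<in>Z - {k}. k - l)"
  have fin: "finite ({..<m} \<rightarrow>\<^sub>E Z)" using assms(1) by (simp add: finite_PiE)
  have bij: "bij_betw f {..<m} Z" if "f \<in> {..<m} \<rightarrow>\<^sub>E Z" "inj_on f {..<m}" for f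
    using that m assms(1) by (intro bij_betw_imageI card_subset_eq) (auto simp: card_image)
  have "(\<Sum>f\<in>{..<m} \<rightarrow>\<^sub>E Z. (\<Prod>a<m. w (f a)) * discriminant m f)
      = (\<Sum>f\<in>F. (\<Prod>a<m. w (f a)) * discriminant m f)"
  proof (rule sum.mono_neutral_right[OF fin])
    show "F \<subseteq> {..<m} \<rightarrow>\<^sub>E Z" unfolding F_def by blast
    show "\<forall>f\<in>({..<m} \<rightarrow>\<^sub>E Z) - F. (\<Prod>a<m. w (f a)) * discriminant m f = 0"
    proof
      fix f assume "f \<in> ({..<m} \<rightarrow>\<^sub>E Z) - F"
      then have "\<not> inj_on f {..<m}" using bij[of f] unfolding F_def by blast
      then show "(\<Prod>a<m. w (f a)) * discriminant m f = 0" by (simp add: discriminant_eq_0)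
    qed
  qed
  also have "\<dots> = (\<Sum>f\<in>F. P)"
  proof (rule sum.cong[OF refl])
    fix f assume "f \<in> F"
    then have f: "bij_betw f {..<m} Z" by (simp add: F_def)
    show "(\<Prod>a<m. w (f a)) * discriminant m f = P"
      unfolding P_def discriminant_bij[OF f] prod.reindex_bij_betw[OF f] ..
  qed
  also have "\<dots> = of_nat (card F) * P" by simp
  finally have eq: "(\<Sum>f\<in>{..<m} \<rightarrow>\<^sub>E Z. (\<Prod>a<m. w (f a)) * discriminant m f) = of_nat (card F) * P" .
  obtain f0 where f0: "bij_betw f0 {..<m} Z"
    using ex_bij_betw_nat_finite[OF assms(1)] m by (auto simp: lessThan_atLeast0)
  then have "restrict f0 {..<m} \<in> F"
    by (auto simp: F_def bij_betw_def inj_on_def)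
  moreover have "finite F" using fin by (simp add: F_def)
  ultimately have "card F \<noteq> 0" by auto
  moreover have "P \<noteq> 0" using assms by (auto simp: P_def)
  ultimately show "(\<Sum>f\<in>{..<m} \<rightarrow>\<^sub>E Z. (\<Prod>a<m. w (f a)) * discriminant m f) \<noteq> 0"
    unfolding eq by simp
qed

context holomorphic_family begin

lemma zeros_finite:
  assumes "R > 0" "\<And>k. k \<in> sphere c R \<Longrightarrow> G z k \<noteq> 0"
  shows "finite (zeros z (ball c R))"
proof -
  have "G z (c + of_real R) \<noteq> 0" using assms by (simp add: dist_norm)
  from finite_zeros_cball[OF G_hol this, of c R] show ?thesis
    by (rule finite_subset[rotated]) (auto simp: zeros_def)
qed

lemma zorder_zeros_pos:
  assumes "R > 0" "\<And>k. k \<in> sphere c R \<Longrightarrow> G z k \<noteq> 0" "k \<in> zeros z B"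
  shows "zorder (G z) k > 0"
proof -
  have "G z (c + of_real R) \<noteq> 0" using assms by (simp add: dist_norm)
  from zorder_pos_of_zero[OF G_hol this] assms(3) show ?thesis by (simp add: zeros_def)
qed

definition count :: "complex \<Rightarrow> real \<Rightarrow> complex \<Rightarrow> int" where
  "count c R z = (\<Sum>k\<in>zeros z (ball c R). zorder (G z) k)"

text \<open>
  An integer-valued continuous function on a connected set is constant.
\<close>

lemma count_constant:
  assumes T: "convex T" "T \<subseteq> \<Omega>" and R: "R > 0"
    and nz: "\<And>z k. z \<in> T \<Longrightarrow> k \<in> sphere c R \<Longrightarrow> G z k \<noteq> 0"
    and "z1 \<in> T" "z2 \<in> T"
  shows "count c R z1 = count c R z2"
proof -
  have eq: "psum c R (\<lambda>_. 1) z = of_int (count c R z)" for z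
    by (simp add: psum_def count_def)
  have "continuous_on T (psum c R (\<lambda>_. 1))"
    by (intro holomorphic_on_imp_continuous_on psum_holomorphic T R nz) auto
  then have "psum c R (\<lambda>_. 1) constant_on T"
  proof (rule continuous_discrete_range_constant[OF convex_connected[OF T(1)]])
    fix x assume "x \<in> T"
    show "\<exists>e>0. \<forall>y. y \<in> T \<and> psum c R (\<lambda>_. 1) y \<noteq> psum c R (\<lambda>_. 1) x
              \<longrightarrow> e \<le> cmod (psum c R (\<lambda>_. 1) y - psum c R (\<lambda>_. 1) x)"
    proof (intro exI[of _ 1] conjI allI impI; (elim conjE)?)
      fix y assume "psum c R (\<lambda>_. 1) y \<noteq> psum c R (\<lambda>_. 1) x"
      then have "\<bar>count c R y - count c R x\<bar> \<ge> 1" by (auto simp: eq)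
      then have "real_of_int \<bar>count c R y - count c R x\<bar> \<ge> 1" by linarith
      then show "1 \<le> cmod (psum c R (\<lambda>_. 1) y - psum c R (\<lambda>_. 1) x)"
        unfolding eq of_int_diff[symmetric] norm_of_int by simp
    qed simp
  qed
  then have "psum c R (\<lambda>_. 1) z1 = psum c R (\<lambda>_. 1) z2"
    using assms(5,6) by (auto simp: constant_on_def)
  then show ?thesis unfolding eq of_int_eq_iff .
qed

lemma card_zeros_le_count:
  assumes "R > 0" "\<And>k. k \<in> sphere c R \<Longrightarrow> G z k \<noteq> 0"
  shows "int (card (zeros z (ball c R))) \<le> count c R z"
proof -
  have "int (card (zeros z (ball c R))) = (\<Sum>k\<in>zeros z (ball c R). 1)" by simp
  also have "\<dots> \<le> count c R z"
    unfolding count_def using zorder_zeros_pos[where c = c and B = "ball c R", OF assms]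
    by (intro sum_mono) force
  finally show ?thesis .
qed

lemma tuple_sum_holomorphic:
  assumes T: "convex T" "T \<subseteq> \<Omega>" and R: "R > 0"
    and nz: "\<And>z k. z \<in> T \<Longrightarrow> k \<in> sphere c R \<Longrightarrow> G z k \<noteq> 0"
    and q: "tuple_poly m q"
  shows "(\<lambda>z. \<Sum>f\<in>{..<m} \<rightarrow>\<^sub>E zeros z (ball c R).
            (\<Prod>a<m. of_int (zorder (G z) (f a))) * q f) holomorphic_on T"
  using q
proof induction
  case (monomial d e)
  have "(\<Sum>f\<in>{..<m} \<rightarrow>\<^sub>E zeros z (ball c R).
            (\<Prod>a<m. of_int (zorder (G z) (f a))) * (d * (\<Prod>a<m. f a ^ e a)))
      = d * (\<Prod>a<m. psum c R (\<lambda>k. k ^ e a) z)" for z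
    unfolding psum_def
    by (subst prod_sum_eq_sum_PiE) (auto simp: sum_distrib_left prod.distrib mult_ac)
  then show ?case
    using T R nz by (auto intro!: holomorphic_intros psum_holomorphic)
next
  case (add p q)
  then show ?case
    by (simp add: distrib_left sum.distrib holomorphic_on_add)
qed

text \<open>
  Let \<open>m\<close> be the largest number of distinct zeros that occurs on the disc. The discriminant sum of
  size \<open>m\<close> is holomorphic in the parameter and not identically \<open>0\<close>, so it has no zero in a
  punctured neighbourhood of \<open>z\<^sub>0\<close>; there the number of distinct zeros is \<open>m\<close>.
\<close>

lemma card_zeros_generic:
  assumes e: "e > 0" "ball z0 e \<subseteq> \<Omega>" and R: "R > 0"
    and nz: "\<And>z k. z \<in> ball z0 e \<Longrightarrow> k \<in> sphere c R \<Longrightarrow> G z k \<noteq> 0"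
  obtains d m where "d > 0" "d \<le> e"
    "\<And>z. z \<in> ball z0 d - {z0} \<Longrightarrow> card (zeros z (ball c R)) = m"
proof -
  let ?Z = "\<lambda>z. zeros z (ball c R)"
  define N where "N = nat (count c R z0)"
  have fin: "finite (?Z z)" if "z \<in> ball z0 e" for z
    using zeros_finite[where c = c, OF R nz[OF that]] by auto
  have le: "card (?Z z) \<le> N" if "z \<in> ball z0 e" for z
  proof -
    have "count c R z = count c R z0"
      using count_constant[OF convex_ball e(2) R nz that] e(1) by simp
    then show ?thesis using card_zeros_le_count[where c = c, OF R nz[OF that]] by (simp add: N_def)
  qed
  define m where "m = Max ((\<lambda>z. card (?Z z)) ` ball z0 e)"
  have finC: "finite ((\<lambda>z. card (?Z z)) ` ball z0 e)"
    by (rule finite_subset[of _ "{..N}"]) (use le in auto)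
  have "m \<in> (\<lambda>z. card (?Z z)) ` ball z0 e"
    unfolding m_def using finC e(1) by (intro Max_in) auto
  then obtain z1 where z1: "z1 \<in> ball z0 e" "card (?Z z1) = m" by blast
  have lem: "card (?Z z) \<le> m" if "z \<in> ball z0 e" for z
    unfolding m_def using finC that by (intro Max_ge) auto
  define D where "D z = (\<Sum>f\<in>{..<m} \<rightarrow>\<^sub>E ?Z z.
            (\<Prod>a<m. of_int (zorder (G z) (f a))) * discriminant m f)" for z
  have "D holomorphic_on ball z0 e"
    unfolding D_def[abs_def]
    by (rule tuple_sum_holomorphic[OF convex_ball e(2) R nz tuple_poly_discriminant])
  have w: "(of_int (zorder (G z) k) :: complex) \<noteq> 0" if "z \<in> ball z0 e" "k \<in> ?Z z" for z k
    using zorder_zeros_pos[where c = c, OF R nz[OF that(1)] that(2)] by simp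
  have "D z1 \<noteq> 0"
    unfolding D_def
    using tuple_discriminant_sum(2)[where Z = "?Z z1" and w = "\<lambda>k. of_int (zorder (G z1) k)", OF fin w] z1
    by blast
  then have "\<forall>\<^sub>F z in at z0. D z \<noteq> 0 \<and> z \<in> ball z0 e"
    using non_zero_neighbour_alt[OF \<open>D holomorphic_on _\<close> open_ball convex_connected[OF convex_ball]]
      z1 e by auto
  moreover have "card (?Z z) = m" if "D z \<noteq> 0" "z \<in> ball z0 e" for z
    using that lem[of z]
      tuple_discriminant_sum(1)[where Z = "?Z z" and w = "\<lambda>k. of_int (zorder (G z) k)", OF fin w]
    unfolding D_def order_le_less by blast
  ultimately have "\<forall>\<^sub>F z in at z0. card (?Z z) = m"
    by (auto elim: eventually_mono)
  then obtain d where d: "d > 0" "\<And>z. z \<noteq> z0 \<Longrightarrow> dist z z0 < d \<Longrightarrow> card (?Z z) = m"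
    unfolding eventually_at by auto
  show ?thesis
    by (rule that[of "min d e" m]) (use d e in \<open>auto simp: dist_commute\<close>)
qed

end

section \<open>Zeros as a covering space\<close>

lemma finite_separating_radius:
  fixes Z :: "complex set"
  assumes "finite Z" "Z \<subseteq> B" "open B"
  obtains r where "r > 0" "\<And>w. w \<in> Z \<Longrightarrow> cball w r \<subseteq> B"
    "\<And>w w'. w \<in> Z \<Longrightarrow> w' \<in> Z \<Longrightarrow> w \<noteq> w' \<Longrightarrow> 2 * r < dist w w'"
proof -
  have "\<forall>\<^sub>F r in at_right 0. cball w r \<subseteq> B" if w: "w \<in> Z" for w
  proof -
    obtain e where "e > 0" "cball w e \<subseteq> B" using w assms open_contains_cball by blast
    then show ?thesis
      unfolding eventually_at_right_field by (intro exI[of _ e]) (auto intro: less_imp_le order_trans)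
  qed
  then have 1: "\<forall>\<^sub>F r in at_right 0. \<forall>w\<in>Z. cball w r \<subseteq> B"
    using assms(1) by (simp add: eventually_ball_finite)
  have "\<forall>\<^sub>F r in at_right 0. w \<noteq> w' \<longrightarrow> 2 * r < dist w w'" for w w' :: complex
  proof (cases "w = w'")
    case False
    then show ?thesis
      unfolding eventually_at_right_field by (intro exI[of _ "dist w w' / 2"]) auto
  qed simp
  then have 2: "\<forall>\<^sub>F r in at_right 0. \<forall>w\<in>Z. \<forall>w'\<in>Z. w \<noteq> w' \<longrightarrow> 2 * r < dist w w'"
    using assms(1) by (simp add: eventually_ball_finite)
  have "\<forall>\<^sub>F r in at_right (0::real). r > 0" by (simp add: eventually_at_right_less)
  from eventually_happens'[OF _ eventually_conj[OF this eventually_conj[OF 1 2]]] that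
  show ?thesis by auto
qed

context holomorphic_family begin

lemma zeros_subset: "V \<subseteq> B \<Longrightarrow> zeros z V = zeros z B \<inter> V"
  by (auto simp: zeros_def)

text \<open>
  Here \<open>\<phi> w\<close> follows the zero \<open>w\<close> of \<open>G z\<^sub>0\<close> to nearby parameters, with the same multiplicity, inside the
  isolating neighbourhood \<open>V w\<close>.
\<close>

definition sections_near ::
  "complex set \<Rightarrow> complex set \<Rightarrow> complex \<Rightarrow> real \<Rightarrow> (complex \<Rightarrow> complex \<Rightarrow> complex) \<Rightarrow>
   (complex \<Rightarrow> complex set) \<Rightarrow> bool" where
  "sections_near P B z0 e \<phi> V \<longleftrightarrow>
     e > 0 \<and> ball z0 e \<subseteq> P \<and>
     (\<forall>w\<in>zeros z0 B. open (V w) \<and> w \<in> V w \<and> \<phi> w holomorphic_on ball z0 e) \<and>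
     (\<forall>w\<in>zeros z0 B. \<forall>w'\<in>zeros z0 B. w \<noteq> w' \<longrightarrow> V w \<inter> V w' = {}) \<and>
     (\<forall>w\<in>zeros z0 B. \<forall>z\<in>ball z0 e. zeros z B \<inter> V w = {\<phi> w z} \<and>
        zorder (G z) (\<phi> w z) = zorder (G z0) w) \<and>
     (\<forall>z\<in>ball z0 e. zeros z B \<subseteq> (\<Union>w\<in>zeros z0 B. V w))"

text \<open>
  Isolate the zeros of \<open>G z\<^sub>0\<close> by small disjoint discs. Each disc keeps its total multiplicity for nearby
  parameters, so it contains at least one zero; since there are as many zeros as discs, it contains
  exactly one. That zero is the first power sum over the disc divided by the multiplicity, which
  is holomorphic.
\<close>

lemma local_sections:
  assumes P: "open P" "P \<subseteq> \<Omega>" and R: "R > 0"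
    and nz: "\<And>z k. z \<in> P \<Longrightarrow> k \<in> sphere c R \<Longrightarrow> G z k \<noteq> 0"
    and card: "\<And>z. z \<in> P \<Longrightarrow> card (zeros z (ball c R)) = m"
    and z0: "z0 \<in> P"
  obtains e \<phi> V where "sections_near P (ball c R) z0 e \<phi> V"
proof -
  let ?Z = "\<lambda>z. zeros z (ball c R)"
  have fin: "finite (?Z z)" if "z \<in> P" for z
    using zeros_finite[where c = c, OF R nz[OF that]] by auto
  have Zsub: "?Z z0 \<subseteq> ball c R" by (auto simp: zeros_def)
  obtain r where r: "r > 0" "\<And>w. w \<in> ?Z z0 \<Longrightarrow> cball w r \<subseteq> ball c R"
    "\<And>w w'. w \<in> ?Z z0 \<Longrightarrow> w' \<in> ?Z z0 \<Longrightarrow> w \<noteq> w' \<Longrightarrow> 2 * r < dist w w'"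
    using finite_separating_radius[OF fin[OF z0] Zsub open_ball] by metis
  define K where "K = (\<Union>w\<in>?Z z0. sphere w r)"
  have cK: "compact K" unfolding K_def using fin[OF z0] by (intro compact_UN) auto
  have nzK: "G z0 k \<noteq> 0" if "k \<in> K" for k
  proof
    assume k0: "G z0 k = 0"
    from that obtain w where w: "w \<in> ?Z z0" "dist w k = r" by (auto simp: K_def)
    then have "k \<in> ball c R" using r(2)[of w] by auto
    then have "k \<in> ?Z z0" using k0 by (simp add: zeros_def)
    then show False using r(3)[OF w(1), of k] w r(1) by auto
  qed
  have "z0 \<in> \<Omega>" using P z0 by blast
  from nonvanishing_stable[OF this cK nzK]
  obtain e1 where e1: "e1 > 0" "ball z0 e1 \<subseteq> \<Omega>" "\<And>z k. z \<in> ball z0 e1 \<Longrightarrow> k \<in> K \<Longrightarrow> G z k \<noteq> 0" by metis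
  obtain e2 where e2: "e2 > 0" "ball z0 e2 \<subseteq> P" using P z0 by (meson openE)
  define e where "e = min e1 e2"
  have e: "e > 0" "ball z0 e \<subseteq> P" "ball z0 e \<subseteq> \<Omega>" using e1 e2 P by (auto simp: e_def)
  have nzw: "G z k \<noteq> 0" if "w \<in> ?Z z0" "z \<in> ball z0 e" "k \<in> sphere w r" for w z k
    using that e1(3)[of z k] by (auto simp: K_def e_def)
  have V: "zeros z (ball w r) = ?Z z \<inter> ball w r" if "w \<in> ?Z z0" for z w
    using r(2)[OF that] ball_subset_cball by (intro zeros_subset) blast
  have V0: "zeros z0 (ball w r) = {w}" if w: "w \<in> ?Z z0" for w
    using V[OF w] r(3)[OF w] r(1) w by (force simp: dist_commute)
  have cnt: "count w r z = zorder (G z0) w" if w: "w \<in> ?Z z0" and z: "z \<in> ball z0 e" for w z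
  proof -
    have "count w r z = count w r z0"
      using count_constant[where c = w, OF convex_ball e(3) r(1) nzw[OF w] z] e(1) by simp
    also have "\<dots> = zorder (G z0) w" unfolding count_def V0[OF w] by simp
    finally show ?thesis .
  qed
  have pos: "zorder (G z0) w > 0" if "w \<in> ?Z z0" for w
    using zorder_zeros_pos[where c = c, OF R nz[OF z0] that] by simp
  have ne: "zeros z (ball w r) \<noteq> {}" if w: "w \<in> ?Z z0" and z: "z \<in> ball z0 e" for w z
    using cnt[OF w z] pos[OF w] by (auto simp: count_def)
  define \<phi> where "\<phi> w z = (SOME k. k \<in> zeros z (ball w r))" for w z
  have \<phi>: "\<phi> w z \<in> zeros z (ball w r)" if "w \<in> ?Z z0" "z \<in> ball z0 e" for w z
    unfolding \<phi>_def using ne[OF that] by (simp add: some_in_eq)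
  have disj: "ball w r \<inter> ball w' r = {}" if "w \<in> ?Z z0" "w' \<in> ?Z z0" "w \<noteq> w'" for w w'
    using r(3)[OF that] by (intro disjoint_ballI) simp
  have img: "(\<lambda>w. \<phi> w z) ` ?Z z0 = ?Z z" if z: "z \<in> ball z0 e" for z
  proof (rule card_subset_eq[OF fin])
    show "z \<in> P" using z e by auto
    show "(\<lambda>w. \<phi> w z) ` ?Z z0 \<subseteq> ?Z z" using \<phi> V z by blast
    have "inj_on (\<lambda>w. \<phi> w z) (?Z z0)"
    proof (rule inj_onI, rule ccontr)
      fix w w' assume "w \<in> ?Z z0" "w' \<in> ?Z z0" "\<phi> w z = \<phi> w' z" "w \<noteq> w'"
      then show False using \<phi>[of w z] \<phi>[of w' z] z disj[of w w'] by (auto simp: zeros_def)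
    qed
    then show "card ((\<lambda>w. \<phi> w z) ` ?Z z0) = card (?Z z)"
      using card z0 z e by (simp add: card_image subset_iff)
  qed
  have single: "?Z z \<inter> ball w r = {\<phi> w z}" if w: "w \<in> ?Z z0" and z: "z \<in> ball z0 e" for w z
  proof -
    have "k = \<phi> w z" if k: "k \<in> ?Z z" "k \<in> ball w r" for k
    proof -
      from k img[OF z] obtain w' where w': "w' \<in> ?Z z0" "k = \<phi> w' z" by blast
      have "k \<in> ball w' r" using \<phi>[OF w'(1) z] w'(2) by (simp add: zeros_def)
      then have "w' = w" using disj[OF w'(1) w] k by blast
      then show ?thesis using w' by simp
    qed
    then show ?thesis using \<phi>[OF w z] V[OF w] by blast
  qed
  have ord: "zorder (G z) (\<phi> w z) = zorder (G z0) w" if w: "w \<in> ?Z z0" and z: "z \<in> ball z0 e" for w z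
    using cnt[OF w z] unfolding count_def V[OF w] single[OF w z] by simp
  have hol: "\<phi> w holomorphic_on ball z0 e" if w: "w \<in> ?Z z0" for w
  proof -
    have "psum w r (\<lambda>k. k) holomorphic_on ball z0 e"
      using psum_holomorphic[where c = w, OF convex_ball e(3) r(1) _ nzw[OF w]] by simp
    then have "(\<lambda>z. psum w r (\<lambda>k. k) z / of_int (zorder (G z0) w)) holomorphic_on ball z0 e"
      using pos[OF w] by (intro holomorphic_intros) auto
    moreover have "psum w r (\<lambda>k. k) z / of_int (zorder (G z0) w) = \<phi> w z" if "z \<in> ball z0 e" for z
      using pos[OF w] ord[OF w that] unfolding psum_def V[OF w] single[OF w that] by simp
    ultimately show ?thesis by (rule holomorphic_transform)
  qed
  have cover: "?Z z \<subseteq> (\<Union>w\<in>?Z z0. ball w r)" if z: "z \<in> ball z0 e" for z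
  proof
    fix k assume "k \<in> ?Z z"
    then obtain w where "w \<in> ?Z z0" "k = \<phi> w z" using img[OF z] by blast
    then show "k \<in> (\<Union>w\<in>?Z z0. ball w r)" using \<phi>[OF _ z, of w] by (auto simp: zeros_def)
  qed
  have "sections_near P (ball c R) z0 e \<phi> (\<lambda>w. ball w r)"
    unfolding sections_near_def
    using e(1,2) r(1) hol single ord disj cover by (intro conjI ballI impI) simp_all
  then show ?thesis by (rule that)
qed

text \<open>
  The graphs of the local sections are the sheets over a small disc; they are open because the
  neighbourhoods that isolate the zeros are.
\<close>

lemma zeros_covering_space:
  assumes P: "open P" "P \<subseteq> \<Omega>" and R: "R > 0"
    and nz: "\<And>z k. z \<in> P \<Longrightarrow> k \<in> sphere c R \<Longrightarrow> G z k \<noteq> 0"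
    and card: "\<And>z. z \<in> P \<Longrightarrow> card (zeros z (ball c R)) = m" and m: "m > 0"
  shows "covering_space (SIGMA z:P. zeros z (ball c R)) fst P"
proof -
  let ?Z = "\<lambda>z. zeros z (ball c R)"
  let ?E = "SIGMA z:P. ?Z z"
  have "?Z z \<noteq> {}" if "z \<in> P" for z using card[OF that] m by auto
  then have "fst ` ?E = P" by (auto simp: fst_image_Sigma)
  moreover have "\<exists>T. z0 \<in> T \<and> openin (top_of_set P) T \<and> (\<exists>v. \<Union>v = ?E \<inter> fst -` T \<and>
         (\<forall>u\<in>v. openin (top_of_set ?E) u) \<and> pairwise disjnt v \<and> (\<forall>u\<in>v. \<exists>q. homeomorphism u T fst q))"
    if z0: "z0 \<in> P" for z0
  proof -
    obtain e \<phi> V where S: "sections_near P (ball c R) z0 e \<phi> V"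
      using local_sections[OF P R nz card z0] .
    note S = S[unfolded sections_near_def]
    have e: "e > 0" "ball z0 e \<subseteq> P" using S by blast+
    have V: "open (V w)" if "w \<in> ?Z z0" for w using S that by blast
    have disj: "V w \<inter> V w' = {}" if "w \<in> ?Z z0" "w' \<in> ?Z z0" "w \<noteq> w'" for w w'
      using S that by blast
    have \<phi>: "\<phi> w holomorphic_on ball z0 e" if "w \<in> ?Z z0" for w using S that by blast
    have single: "?Z z \<inter> V w = {\<phi> w z}" if "w \<in> ?Z z0" "z \<in> ball z0 e" for w z
      using S that by blast
    have cov: "?Z z \<subseteq> (\<Union>w\<in>?Z z0. V w)" if "z \<in> ball z0 e" for z using S that by blast
    define T where "T = ball z0 e"
    define slice where "slice w = (\<lambda>z. (z, \<phi> w z)) ` T" for w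
    have slice: "slice w = ?E \<inter> T \<times> V w" if "w \<in> ?Z z0" for w
    proof (intro equalityI subsetI)
      fix x assume "x \<in> slice w"
      then obtain z where z: "z \<in> T" "x = (z, \<phi> w z)" by (auto simp: slice_def)
      then show "x \<in> ?E \<inter> T \<times> V w" using single[OF that, of z] e(2) by (auto simp: T_def)
    next
      fix x assume "x \<in> ?E \<inter> T \<times> V w"
      then have "fst x \<in> T" "snd x \<in> ?Z (fst x) \<inter> V w" by auto
      then show "x \<in> slice w"
        using single[OF that, of "fst x"] by (auto simp: slice_def T_def image_iff prod_eq_iff)
    qed
    show ?thesis
    proof (intro exI[of _ T] exI[of _ "slice ` ?Z z0"] conjI ballI)
      show "z0 \<in> T" using e by (simp add: T_def)
      show "openin (top_of_set P) T" unfolding T_def by (rule open_subset[OF e(2) open_ball])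
      have "\<exists>w\<in>?Z z0. (z, k) \<in> slice w" if zk: "z \<in> T" "k \<in> ?Z z" for z k
      proof -
        from cov[of z] zk obtain w where w: "w \<in> ?Z z0" "k \<in> V w" by (auto simp: T_def)
        then have "(z, k) \<in> slice w" using zk e(2) by (auto simp: slice T_def)
        then show ?thesis using w by blast
      qed
      then show "\<Union> (slice ` ?Z z0) = ?E \<inter> fst -` T" using slice by fastforce
      show "pairwise disjnt (slice ` ?Z z0)"
      proof (rule pairwise_imageI)
        fix w w' assume "w \<in> ?Z z0" "w' \<in> ?Z z0" "w \<noteq> w'" 
        then show "disjnt (slice w) (slice w')" using disj[of w w'] by (auto simp: slice disjnt_def)
      qed
    next
      fix u assume "u \<in> slice ` ?Z z0"
      then obtain w where w: "w \<in> ?Z z0" "u = slice w" by blast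
      show "openin (top_of_set ?E) u"
        unfolding w(2) slice[OF w(1)] using V(1)[OF w(1)] by (intro openin_open_Int open_Times) (simp_all add: T_def)
      have "homeomorphism u T fst (\<lambda>z. (z, \<phi> w z))"
        unfolding w(2) homeomorphism_def slice_def T_def
        using holomorphic_on_imp_continuous_on[OF \<phi>[OF w(1)]]
        by (auto intro!: continuous_intros simp: image_image)
      then show "\<exists>q. homeomorphism u T fst q" by blast
    qed
  qed
  ultimately show ?thesis unfolding covering_space_def by (auto intro: continuous_intros)
qed

end

section \<open>Branches over a half-plane and Puiseux series\<close>

lemma periodic_int_multiple:
  fixes \<kappa> :: "complex \<Rightarrow> 'a"
  assumes per: "\<And>L. L \<in> H \<Longrightarrow> \<kappa> (L + w) = \<kappa> L"
    and H: "\<And>L q. L \<in> H \<Longrightarrow> L + of_int q * w \<in> H" and L: "L \<in> H"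
  shows "\<kappa> (L + of_int q * w) = \<kappa> L"
proof (induction q rule: int_induct[of _ 0])
  case (step1 i)
  show ?case using per[OF H[OF L, of i]] step1 by (simp add: algebra_simps)
next
  case (step2 i)
  show ?case using per[OF H[OF L, of "i - 1"]] step2 by (simp add: algebra_simps)
qed simp

text \<open>
  A function on a left half-plane with period \<open>2 \<pi> \<i> p\<close> is a function of \<open>e\<^sup>L\<^sup>/\<^sup>p\<close> on a punctured disc. It
  is holomorphic there since \<open>L\<close> can be recovered by a local branch of the logarithm, and the
  singularity at \<open>0\<close> is removable because the function has a limit.
\<close>

lemma descend_to_punctured_disc:
  fixes \<kappa> :: "complex \<Rightarrow> complex" and p :: nat and d :: real
  defines "H \<equiv> {L. Re L < ln d}"
  assumes d: "d > 0" and p: "p > 0"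
    and hol: "\<kappa> holomorphic_on H"
    and per: "\<And>L. L \<in> H \<Longrightarrow> \<kappa> (L + of_nat p * (2 * pi * \<i>)) = \<kappa> L"
    and lim: "\<And>\<eta>. \<eta> > 0 \<Longrightarrow> \<exists>\<rho>>0. \<forall>L\<in>H. Re L < ln \<rho> \<longrightarrow> dist (\<kappa> L) k0 < \<eta>"
  obtains h where "h analytic_on {0}" "h 0 = k0"
    "\<And>L. L \<in> H \<Longrightarrow> h (exp (of_real (1 / real p) * L)) = \<kappa> L"
proof -
  define \<rho> where "\<rho> = exp (ln d / p)"
  have \<rho>: "\<rho> > 0" by (simp add: \<rho>_def)
  have Re_less: "p * ln (norm x) < ln d' \<longleftrightarrow> norm x < exp (ln d' / p)" if "x \<noteq> 0" "d' > 0" for x :: complex and d'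
  proof -
    have "norm x < exp (ln d' / p) \<longleftrightarrow> exp (ln (norm x)) < exp (ln d' / p)"
      using that by simp
    then show ?thesis using p by (simp add: field_simps del: exp_ln)
  qed
  have per': "\<kappa> (L + of_int q * (of_nat p * (2 * pi * \<i>))) = \<kappa> L" if "L \<in> H" for L q
    by (rule periodic_int_multiple[of H \<kappa>, OF per _ that]) (auto simp: H_def)
  have indep: "\<kappa> L = \<kappa> L'" if LH: "L \<in> H" "L' \<in> H" "exp (L / p) = exp (L' / p)" for L L'
  proof -
    from LH(3) obtain q :: int where "L / p = L' / p + (of_int (2 * q) * pi) * \<i>"
      unfolding exp_eq by auto
    then have "L = L' + of_int q * (of_nat p * (2 * pi * \<i>))" using p by (simp add: field_simps)
    then show ?thesis using per'[OF LH(2), of q] by simp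
  qed
  \<comment> \<open>By \<open>indep\<close> the jump of \<open>Ln\<close> across its cut does not affect \<open>h\<close>.\<close>
  define h where "h x = (if x = 0 then k0 else \<kappa> (p * Ln x))" for x
  have Ln_H: "p * Ln x \<in> H" if "x \<noteq> 0" "norm x < \<rho>" for x
    using that Re_less[of x d] d by (simp add: H_def \<rho>_def)
  have h_exp: "h (exp (L / p)) = \<kappa> L" if "L \<in> H" for L
  proof -
    have "norm (exp (L / p)) < \<rho>" using that p by (simp add: H_def \<rho>_def divide_strict_right_mono)
    then have "p * Ln (exp (L / p)) \<in> H" by (intro Ln_H) auto
    then have "\<kappa> (p * Ln (exp (L / p))) = \<kappa> L"
      by (rule indep) (use that p in auto)
    then show ?thesis by (simp add: h_def)
  qed
  have "h holomorphic_on (ball (0::complex) \<rho> - {0})"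
    unfolding holomorphic_on_def
  proof
    fix x0 :: complex assume x0: "x0 \<in> ball 0 \<rho> - {0}"
    define N where "N = ball x0 (norm x0) \<inter> ball 0 \<rho>"
    \<comment> \<open>A branch of \<open>p log x\<close> near \<open>x0\<close>, also where \<open>x0\<close> lies on the cut of \<open>Ln\<close>.\<close>
    define M where "M x = p * (Ln (x / x0) + Ln x0)" for x
    have nonpos: "x / x0 \<notin> \<real>\<^sub>\<le>\<^sub>0" if "x \<in> N" for x
    proof -
      have "x / x0 - 1 = (x - x0) / x0" using x0 by (simp add: diff_divide_distrib)
      then have "norm (x / x0 - 1) = norm (x - x0) / norm x0" by (simp add: norm_divide)
      also have "\<dots> < 1" using that x0 by (simp add: N_def dist_norm norm_minus_commute)
      finally have "\<bar>Re (x / x0 - 1)\<bar> < 1" using abs_Re_le_cmod order_le_less_trans by blast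
      then have "Re (x / x0) > 0" by simp
      then show ?thesis using complex_nonpos_Reals_iff by auto
    qed
    have xN: "x \<noteq> 0" "norm x < \<rho>" if "x \<in> N" for x using that by (auto simp: N_def dist_norm)
    have expM: "exp (M x / p) = x" if "x \<in> N" for x
      using xN[OF that] x0 p by (simp add: M_def exp_add)
    have MH: "M x \<in> H" if "x \<in> N" for x
    proof -
      have "norm (exp (M x / p)) = norm x" using expM[OF that] by simp
      then have "exp (Re (M x) / p) < exp (ln d / p)" using xN[OF that] by (simp add: \<rho>_def)
      then show ?thesis using p by (simp add: H_def divide_less_cancel)
    qed
    have "M holomorphic_on N"
      unfolding M_def using nonpos x0 by (intro holomorphic_intros) auto
    then have "(\<lambda>x. \<kappa> (M x)) holomorphic_on N"
      using holomorphic_on_compose_gen[OF _ hol, of M N] MH by (auto simp: o_def)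
    moreover have "\<kappa> (M x) = h x" if "x \<in> N" for x
      using h_exp[OF MH[OF that]] expM[OF that] by simp
    ultimately have "h holomorphic_on N" by (rule holomorphic_transform)
    moreover have "open N" "x0 \<in> N" using x0 by (auto simp: N_def)
    ultimately show "h field_differentiable at x0 within ball 0 \<rho> - {0}"
      by (meson field_differentiable_at_within holomorphic_on_imp_differentiable_at)
  qed
  moreover have "(h \<longlongrightarrow> h 0) (at 0 within ball 0 \<rho>)"
  proof (rule tendstoI)
    fix \<eta> :: real assume "\<eta> > 0"
    from lim[OF this] obtain r where r: "r > 0" "\<And>L. L \<in> H \<Longrightarrow> Re L < ln r \<Longrightarrow> dist (\<kappa> L) k0 < \<eta>"
      by blast
    show "\<forall>\<^sub>F x in at 0 within ball 0 \<rho>. dist (h x) (h 0) < \<eta>"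
      unfolding eventually_at
    proof (intro exI[of _ "exp (ln r / p)"] conjI ballI impI)
      fix x :: complex assume x: "x \<in> ball 0 \<rho>" "x \<noteq> 0 \<and> dist x 0 < exp (ln r / p)"
      then have "p * Ln x \<in> H" by (intro Ln_H) auto
      moreover have "Re (p * Ln x) < ln r" using x Re_less[of x r] r by simp
      ultimately show "dist (h x) (h 0) < \<eta>" using r(2) x by (simp add: h_def)
    qed simp
  qed
  ultimately have "h holomorphic_on ball 0 \<rho>"
    using no_isolated_singularity'[of "{0}" h "ball 0 \<rho>"] by simp
  then have "h analytic_on {0}"
    using \<rho> by (meson analytic_at centre_in_ball open_ball)
  moreover have "h 0 = k0" by (simp add: h_def)
  moreover have "h (exp (of_real (1 / real p) * L)) = \<kappa> L" if "L \<in> H" for L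
    using h_exp[OF that] by simp
  ultimately show ?thesis by (rule that)
qed

context holomorphic_family begin

text \<open>
  The branches are indexed by the zeros \<open>w\<close> at the base parameter \<open>exp L1\<close>; the period of the branch of \<open>w\<close> is
  \<open>2 \<pi> \<i> p(w)\<close>.
\<close>

definition root_branches ::
  "complex set \<Rightarrow> complex set \<Rightarrow> complex \<Rightarrow> nat \<Rightarrow> (complex \<Rightarrow> complex \<Rightarrow> complex) \<Rightarrow> (complex \<Rightarrow> nat) \<Rightarrow> bool" where
  "root_branches H B L1 m \<kappa> p \<longleftrightarrow>
     (\<forall>L\<in>H. bij_betw (\<lambda>w. \<kappa> w L) (zeros (exp L1) B) (zeros (exp L) B)) \<and>
     (\<forall>w\<in>zeros (exp L1) B. \<kappa> w holomorphic_on H \<and> 0 < p w \<and> p w \<le> m \<and>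
       (\<forall>L\<in>H. zorder (G (exp L)) (\<kappa> w L) = zorder (G (exp L1)) w \<and>
          \<kappa> w (L + of_nat (p w) * (2 * pi * \<i>)) = \<kappa> w L))"

text \<open>
  Lift \<open>exp\<close> through the covering by the zeros, once for each zero over the base point. Two lifts that
  agree at one point agree everywhere, so the lifts have distinct values and exhaust each fibre. For
  the period, the \<open>m + 1\<close> translates of a branch by \<open>2 \<pi> \<i> a\<close>, \<open>a \<le> m\<close>, are again lifts of \<open>exp\<close> and
  take at most \<open>m\<close> values at the base point.
\<close>

lemma root_branches_exist:
  fixes d :: real
  defines "H \<equiv> {L. Re L < ln d}"
  assumes d: "d > 0" and P: "P = ball 0 d - {0}" "P \<subseteq> \<Omega>" and R: "R > 0"
    and nz: "\<And>z k. z \<in> P \<Longrightarrow> k \<in> sphere c R \<Longrightarrow> G z k \<noteq> 0"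
    and card: "\<And>z. z \<in> P \<Longrightarrow> card (zeros z (ball c R)) = m" and m: "m > 0"
    and L1: "L1 \<in> H"
  obtains \<kappa> p where "root_branches H (ball c R) L1 m \<kappa> p"
proof -
  let ?Z = "\<lambda>z. zeros z (ball c R)"
  define J where "J = ?Z (exp L1)"
  define E where "E = (SIGMA z:P. ?Z z)"
  have oP: "open P" unfolding P by (intro open_Diff) auto
  have fin: "finite (?Z z)" if "z \<in> P" for z
    using zeros_finite[where c = c, OF R nz[OF that]] by auto
  have cov: "covering_space E fst P"
    unfolding E_def by (rule zeros_covering_space[OF oP P(2) R nz card m])
  have H: "convex H" "open H" unfolding H_def by (auto simp: convex_halfspace_Re_lt open_halfspace_Re_lt)
  have expP: "exp L \<in> P" if "L \<in> H" for L
  proof -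
    have "exp (Re L) < exp (ln d)" using that by (simp add: H_def)
    then show ?thesis using d by (simp add: P(1))
  qed
  have cexp: "continuous_on H exp" "exp \<in> H \<rightarrow> P"
    using expP by (auto intro: continuous_intros)
  have "\<exists>g. continuous_on H g \<and> g \<in> H \<rightarrow> E \<and> g L1 = (exp L1, w) \<and> (\<forall>L\<in>H. fst (g L) = exp L)"
    if "w \<in> J" for w
  proof -
    have E1: "(exp L1, w) \<in> E" using that expP[OF L1] by (simp add: E_def J_def)
    obtain g where "continuous_on H g" "g \<in> H \<rightarrow> E" "g L1 = (exp L1, w)"
        "\<And>y. y \<in> H \<Longrightarrow> fst (g y) = exp y"
      by (rule covering_space_lift_strong[OF cov E1 L1 convex_imp_simply_connected[OF H(1)]
          convex_imp_locally_path_connected[OF H(1)] cexp]) auto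
    then show ?thesis by blast
  qed
  then obtain g where g: "\<And>w. w \<in> J \<Longrightarrow> continuous_on H (g w)" "\<And>w. w \<in> J \<Longrightarrow> g w \<in> H \<rightarrow> E"
    "\<And>w. w \<in> J \<Longrightarrow> g w L1 = (exp L1, w)" "\<And>w L. w \<in> J \<Longrightarrow> L \<in> H \<Longrightarrow> fst (g w L) = exp L"
    by metis
  have uniq: "g1 L = g2 L"
    if "continuous_on H g1" "g1 \<in> H \<rightarrow> E" "\<And>L. L \<in> H \<Longrightarrow> exp L = fst (g1 L)"
      "continuous_on H g2" "g2 \<in> H \<rightarrow> E" "\<And>L. L \<in> H \<Longrightarrow> exp L = fst (g2 L)"
      "L0 \<in> H" "g1 L0 = g2 L0" "L \<in> H" for g1 g2 L0 L
    by (rule covering_space_lift_unique[OF cov that(8) cexp that(1-6) convex_connected[OF H(1)] that(7,9)])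
  define \<kappa> where "\<kappa> w L = snd (g w L)" for w L
  have geq: "g w L = (exp L, \<kappa> w L)" if "w \<in> J" "L \<in> H" for w L
    using g(4)[OF that] by (simp add: \<kappa>_def prod_eq_iff)
  have \<kappa>Z: "\<kappa> w L \<in> ?Z (exp L)" if "w \<in> J" "L \<in> H" for w L
    using g(2)[OF that(1)] geq[OF that] that(2) by (auto simp: E_def Pi_iff)
  have inj: "inj_on (\<lambda>w. \<kappa> w L) J" if L: "L \<in> H" for L
  proof (rule inj_onI)
    fix w w' assume w: "w \<in> J" "w' \<in> J" and eq: "\<kappa> w L = \<kappa> w' L"
    have "g w L1 = g w' L1"
      by (rule uniq[of "g w" "g w'" L, OF g(1,2)[OF w(1)] _ g(1,2)[OF w(2)] _ L])
         (use g(4) w eq geq L1 L in auto)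
    then show "w = w'" using g(3) w by simp
  qed
  have bij: "bij_betw (\<lambda>w. \<kappa> w L) J (?Z (exp L))" if L: "L \<in> H" for L
  proof (rule bij_betw_imageI[OF inj[OF L]])
    show "(\<lambda>w. \<kappa> w L) ` J = ?Z (exp L)"
    proof (rule card_subset_eq[OF fin[OF expP[OF L]]])
      show "(\<lambda>w. \<kappa> w L) ` J \<subseteq> ?Z (exp L)" using \<kappa>Z L by blast
      show "card ((\<lambda>w. \<kappa> w L) ` J) = card (?Z (exp L))"
        using card_image[OF inj[OF L]] card[OF expP[OF L]] card[OF expP[OF L1]] by (simp add: J_def)
    qed
  qed
  have c\<kappa>: "continuous_on H (\<kappa> w)" if "w \<in> J" for w
    unfolding \<kappa>_def using g(1)[OF that] by (intro continuous_intros)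
  have loc: "\<exists>A \<psi>. open A \<and> L0 \<in> A \<and> A \<subseteq> H \<and> \<psi> holomorphic_on A \<and> (\<forall>L\<in>A. \<psi> L = \<kappa> w L) \<and>
       (\<forall>L\<in>A. zorder (G (exp L)) (\<kappa> w L) = zorder (G (exp L0)) (\<kappa> w L0))"
    if w: "w \<in> J" and L0: "L0 \<in> H" for w L0
  proof -
    define w0 where "w0 = \<kappa> w L0"
    have w0: "w0 \<in> ?Z (exp L0)" using \<kappa>Z[OF w L0] by (simp add: w0_def)
    obtain e \<phi> V where S: "sections_near P (ball c R) (exp L0) e \<phi> V"
      using local_sections[OF oP P(2) R nz card expP[OF L0]] .
    note S = S[unfolded sections_near_def]
    have e: "e > 0" "ball (exp L0) e \<subseteq> P" using S by blast+
    have V: "open (V w0)" "w0 \<in> V w0" using S w0 by blast+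
    have \<phi>: "\<phi> w0 holomorphic_on ball (exp L0) e" using S w0 by blast
    have single: "?Z z \<inter> V w0 = {\<phi> w0 z}" "zorder (G z) (\<phi> w0 z) = zorder (G (exp L0)) w0"
      if "z \<in> ball (exp L0) e" for z
      using S w0 that by blast+
    define A where "A = (H \<inter> \<kappa> w -` V w0) \<inter> (H \<inter> exp -` ball (exp L0) e)"
    have "open A" unfolding A_def
      using V(1) by (intro open_Int continuous_open_preimage c\<kappa> w cexp H(2)) auto
    moreover have "L0 \<in> A" using V(2) e L0 by (simp add: A_def w0_def)
    moreover have "A \<subseteq> H" by (auto simp: A_def)
    moreover have "(\<lambda>L. \<phi> w0 (exp L)) holomorphic_on A"
      using holomorphic_on_compose_gen[OF _ \<phi>, of exp A] 
      by (auto simp: o_def A_def intro!: holomorphic_intros)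
    moreover have eq: "\<phi> w0 (exp L) = \<kappa> w L" if "L \<in> A" for L
    proof -
      have "\<kappa> w L \<in> ?Z (exp L) \<inter> V w0" using \<kappa>Z[OF w, of L] that by (auto simp: A_def)
      moreover have "?Z (exp L) \<inter> V w0 = {\<phi> w0 (exp L)}"
        using that by (intro single(1)) (simp add: A_def)
      ultimately have "\<kappa> w L \<in> {\<phi> w0 (exp L)}" by (simp only:)
      then show ?thesis by simp
    qed
    moreover have "zorder (G (exp L)) (\<kappa> w L) = zorder (G (exp L0)) (\<kappa> w L0)" if "L \<in> A" for L
      using single(2)[of "exp L"] eq[OF that] that by (simp add: A_def w0_def)
    ultimately show ?thesis by blast
  qed
  have hol: "\<kappa> w holomorphic_on H" if w: "w \<in> J" for w
    unfolding holomorphic_on_def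
  proof
    fix L0 assume "L0 \<in> H"
    from loc[OF w this] obtain A \<psi> where A: "open A" "L0 \<in> A" "\<psi> holomorphic_on A" "\<And>L. L \<in> A \<Longrightarrow> \<psi> L = \<kappa> w L"
      by blast
    have "\<kappa> w holomorphic_on A" using A(3,4) by (rule holomorphic_transform)
    then show "\<kappa> w field_differentiable at L0 within H"
      using A by (meson field_differentiable_at_within holomorphic_on_imp_differentiable_at)
  qed
  have ord: "zorder (G (exp L)) (\<kappa> w L) = zorder (G (exp L1)) w" if w: "w \<in> J" and L: "L \<in> H" for w L
  proof -
    have "(\<lambda>L. zorder (G (exp L)) (\<kappa> w L)) constant_on H"
    proof (rule locally_constant_imp_constant[OF convex_connected[OF H(1)]])
      fix L0 assume "L0 \<in> H"
      from loc[OF w this] obtain A where A: "open A" "L0 \<in> A" "A \<subseteq> H"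
        "\<forall>L\<in>A. zorder (G (exp L)) (\<kappa> w L) = zorder (G (exp L0)) (\<kappa> w L0)"
        by (elim exE conjE)
      then show "\<exists>T. openin (top_of_set H) T \<and> L0 \<in> T \<and>
          (\<forall>L\<in>T. zorder (G (exp L)) (\<kappa> w L) = zorder (G (exp L0)) (\<kappa> w L0))"
        using open_subset[OF A(3,1)] by (intro exI[of _ A] conjI)
    qed
    then have "zorder (G (exp L)) (\<kappa> w L) = zorder (G (exp L1)) (\<kappa> w L1)"
      using L L1 unfolding constant_on_def by metis
    then show ?thesis using geq[OF w L1] g(3)[OF w] by simp
  qed
  have "\<exists>p. 0 < p \<and> p \<le> m \<and> (\<forall>L\<in>H. \<kappa> w (L + of_nat p * (2 * pi * \<i>)) = \<kappa> w L)"
    if w: "w \<in> J" for w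
  proof -
    define sh where "sh a L = L + of_nat a * (2 * pi * \<i>)" for a :: nat and L :: complex
    have exp_sh: "exp (sh a L) = exp L" for a L
    proof -
      have "exp (of_nat a * (2 * pi * \<i>)) = (exp (2 * pi * \<i>)) ^ a" by (simp only: exp_of_nat_mult)
      then show ?thesis by (simp add: sh_def exp_add)
    qed
    have shH: "sh a L \<in> H" if "L \<in> H" for a L using that by (simp add: H_def sh_def)
    \<comment> \<open>Pigeonhole: the m + 1 translates take values in a fibre of m points.\<close>
    have "\<not> inj_on (\<lambda>a. \<kappa> w (sh a L1)) {0..m}"
    proof
      assume i: "inj_on (\<lambda>a. \<kappa> w (sh a L1)) {0..m}"
      have "(\<lambda>a. \<kappa> w (sh a L1)) ` {0..m} \<subseteq> ?Z (exp L1)"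
        using \<kappa>Z[OF w shH[OF L1]] by (auto simp: exp_sh)
      then have "card {0..m} \<le> card (?Z (exp L1))"
        by (rule card_inj_on_le[OF i _ fin[OF expP[OF L1]]])
      then show False using card[OF expP[OF L1]] by simp
    qed
    then obtain a b where ab: "a < b" "b \<le> m" "\<kappa> w (sh a L1) = \<kappa> w (sh b L1)"
      unfolding inj_on_def by (metis atLeastAtMost_iff linorder_neqE_nat)
    have lift: "continuous_on H (\<lambda>L. g w (sh a L))" "(\<lambda>L. g w (sh a L)) \<in> H \<rightarrow> E"
      "\<And>L. L \<in> H \<Longrightarrow> exp L = fst (g w (sh a L))" for a
    proof -
      show "continuous_on H (\<lambda>L. g w (sh a L))"
        by (rule continuous_on_compose2[OF g(1)[OF w]]) (use shH in \<open>auto simp: sh_def intro!: continuous_intros\<close>)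
      show "(\<lambda>L. g w (sh a L)) \<in> H \<rightarrow> E" using g(2)[OF w] shH by auto
      show "exp L = fst (g w (sh a L))" if "L \<in> H" for L
        using g(4)[OF w shH[OF that]] by (simp add: exp_sh)
    qed
    have start: "g w (sh a L1) = g w (sh b L1)"
      unfolding geq[OF w shH[OF L1]] exp_sh ab(3) ..
    have same: "g w (sh a L) = g w (sh b L)" if "L \<in> H" for L
      by (rule uniq[OF lift lift L1 start that])
    have "\<kappa> w (L + of_nat (b - a) * (2 * pi * \<i>)) = \<kappa> w L" if L: "L \<in> H" for L
    proof -
      define L' where "L' = L - of_nat a * (2 * pi * \<i>)"
      have "L' \<in> H" using L by (simp add: L'_def H_def)
      from same[OF this] have "\<kappa> w (sh a L') = \<kappa> w (sh b L')" by (simp add: \<kappa>_def)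
      moreover have "sh a L' = L" "sh b L' = L + of_nat (b - a) * (2 * pi * \<i>)"
        using ab(1) by (auto simp: sh_def L'_def of_nat_diff algebra_simps)
      ultimately show ?thesis by simp
    qed
    then show ?thesis using ab by (intro exI[of _ "b - a"]) auto
  qed
  then obtain p where p: "\<And>w. w \<in> J \<Longrightarrow> 0 < p w \<and> p w \<le> m"
      "\<And>w L. w \<in> J \<Longrightarrow> L \<in> H \<Longrightarrow> \<kappa> w (L + of_nat (p w) * (2 * pi * \<i>)) = \<kappa> w L"
    by metis
  have "root_branches H (ball c R) L1 m \<kappa> p"
    unfolding root_branches_def using bij hol ord p unfolding J_def by blast
  then show ?thesis by (rule that)
qed

end

text \<open>
  This turns branches indexed by \<open>J\<close>, with multiplicities \<open>\<mu>\<close> adding up to \<open>n\<close>, into a list of \<open>n\<close> branches.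
\<close>

lemma ex_fun_with_fibre_cards:
  assumes "finite J" "(\<Sum>w\<in>J. \<mu> w) = n"
  obtains \<iota> :: "nat \<Rightarrow> 'a" where "\<And>i. i < n \<Longrightarrow> \<iota> i \<in> J"
    "\<And>w. w \<in> J \<Longrightarrow> card {i. i < n \<and> \<iota> i = w} = \<mu> w"
proof -
  define S where "S = (SIGMA w:J. {..<\<mu> w})"
  have "finite S" "card S = n" using assms by (auto simp: S_def)
  then obtain f where f: "bij_betw f {..<n} S"
    using ex_bij_betw_nat_finite[of S] by (auto simp: lessThan_atLeast0)
  show ?thesis
  proof (rule that[of "fst \<circ> f"])
    show "(fst \<circ> f) i \<in> J" if "i < n" for i
    proof -
      have "f i \<in> S" using bij_betwE[OF f] that by simp
      then show ?thesis by (cases "f i") (simp add: S_def)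
    qed
    show "card {i. i < n \<and> (fst \<circ> f) i = w} = \<mu> w" if "w \<in> J" for w
    proof -
      have "f ` {i. i < n \<and> (fst \<circ> f) i = w} = {w} \<times> {..<\<mu> w}"
      proof -
        have "f ` {i. i < n \<and> (fst \<circ> f) i = w} = {x \<in> f ` {..<n}. fst x = w}" by auto
        also have "f ` {..<n} = S" using f by (simp add: bij_betw_def)
        also have "{x \<in> S. fst x = w} = {w} \<times> {..<\<mu> w}" using that by (auto simp: S_def)
        finally show ?thesis .
      qed
      moreover have inj: "inj_on f {i. i < n \<and> (fst \<circ> f) i = w}"
        by (rule inj_on_subset[OF bij_betw_imp_inj_on[OF f]]) auto
      ultimately show ?thesis using card_image[OF inj] by simp
    qed
  qed
qed

text \<open>
  The zeros of \<open>F z\<close> near \<open>k0\<close>, listed with multiplicity, are the values \<open>h\<^sub>i(z^s\<^sub>i)\<close>, whichever logarithm \<open>L\<close>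
  of \<open>z\<close> is used for the powers. The set \<open>V\<close> may be any small neighbourhood, at the cost of shrinking \<open>z\<close>.
\<close>

definition puiseux_roots ::
  "(complex \<Rightarrow> complex \<Rightarrow> complex) \<Rightarrow> complex \<Rightarrow> nat \<Rightarrow> real \<Rightarrow>
   (nat \<Rightarrow> complex \<Rightarrow> complex) \<Rightarrow> (nat \<Rightarrow> real) \<Rightarrow> bool" where
  "puiseux_roots F k0 n R h s \<longleftrightarrow>
     R > 0 \<and> (\<forall>i<n. h i analytic_on {0} \<and> s i \<in> \<rat> \<and> s i \<ge> 1 / real n) \<and>
     (\<forall>V. open V \<and> k0 \<in> V \<and> V \<subseteq> ball k0 R \<longrightarrow>
       (\<forall>\<^sub>F z in at 0. \<forall>L. exp L = z \<longrightarrow>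
          (\<forall>i<n. h i (exp (of_real (s i) * L)) \<in> {k\<in>V. F z k = 0}) \<and>
          (\<forall>k\<in>{k\<in>V. F z k = 0}.
             zorder (F z) k = int (card {i. i < n \<and> h i (exp (of_real (s i) * L)) = k}))))"

context holomorphic_family begin

text \<open>
  Zeros cannot appear suddenly in the compact shell outside \<open>ball k0 \<eta>\<close>, where \<open>G z0\<close> does not
  vanish.
\<close>

lemma zeros_near_shrink:
  assumes z0: "z0 \<in> \<Omega>" and only: "\<And>k. k \<in> cball k0 R \<Longrightarrow> G z0 k = 0 \<Longrightarrow> k = k0" and \<eta>: "\<eta> > 0"
  obtains e where "e > 0" "\<And>z. z \<in> ball z0 e \<Longrightarrow> zeros z (ball k0 R) \<subseteq> ball k0 \<eta>"
proof -
  have "compact (cball k0 R - ball k0 \<eta>)" by (intro compact_diff) auto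
  moreover have "G z0 k \<noteq> 0" if "k \<in> cball k0 R - ball k0 \<eta>" for k
    using that only[of k] \<eta> by auto
  ultimately obtain e where "e > 0"
      "\<And>z k. z \<in> ball z0 e \<Longrightarrow> k \<in> cball k0 R - ball k0 \<eta> \<Longrightarrow> G z k \<noteq> 0"
    using nonvanishing_stable[OF z0, of "cball k0 R - ball k0 \<eta>"] by metis
  then show ?thesis by (intro that[of e]) (force simp: zeros_def)+
qed

text \<open>
  Choose a disc in which \<open>k0\<close> is the only zero at parameter \<open>0\<close>: it contains \<open>n\<close> zeros for all small
  parameters. Each branch over the half-plane descends to an analytic function of \<open>z\<^sup>1\<^sup>/\<^sup>p\<close>, and is
  repeated as often as its multiplicity, which is constant along the branch.
\<close>

theorem puiseux_zeros:
  assumes \<Omega>: "0 \<in> \<Omega>" and n: "zorder (G 0) k0 = int n" "n > 0" and nz: "G 0 w0 \<noteq> 0"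
  obtains R h s where "puiseux_roots G k0 n R h s"
proof -
  have "G 0 k0 = 0"
  proof -
    have "\<exists>\<^sub>F k in at k0. G 0 k \<noteq> 0"
      using eventually_nonzero_at[OF G_hol nz] by (intro eventually_frequently) auto
    then show ?thesis using zorder_pos_iff[OF G_hol open_UNIV, of k0 0] n by simp
  qed
  from eventually_nonzero_at[OF G_hol nz, of k0] obtain R0 where R0: "R0 > 0"
    "\<And>k. k \<noteq> k0 \<Longrightarrow> dist k k0 < R0 \<Longrightarrow> G 0 k \<noteq> 0" unfolding eventually_at by blast
  \<comment> \<open>Half the radius keeps the closed disc free of other zeros.\<close>
  define R where "R = R0 / 2"
  have R: "R > 0" using R0 by (simp add: R_def)
  have only: "k = k0" if "k \<in> cball k0 R" "G 0 k = 0" for k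
    using R0(2)[of k] that R0(1) by (fastforce simp: R_def dist_commute)
  let ?Z = "\<lambda>z. zeros z (ball k0 R)"
  have Z0: "?Z 0 = {k0}" using only R \<open>G 0 k0 = 0\<close> by (auto simp: zeros_def)
  have sph: "G 0 k \<noteq> 0" if "k \<in> sphere k0 R" for k using only[of k] that R by auto
  from nonvanishing_stable[OF \<Omega> compact_sphere sph]
  obtain e where e: "e > 0" "ball 0 e \<subseteq> \<Omega>" "\<And>z k. z \<in> ball 0 e \<Longrightarrow> k \<in> sphere k0 R \<Longrightarrow> G z k \<noteq> 0"
    by metis
  have cnt: "count k0 R z = n" if "z \<in> ball 0 e" for z
  proof -
    have "count k0 R z = count k0 R 0"
      using count_constant[OF convex_ball e(2) R e(3) that] e(1) by simp
    then show ?thesis unfolding count_def Z0 using n by simp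
  qed
  from card_zeros_generic[OF e(1,2) R e(3)]
  obtain d m where d: "d > 0" "d \<le> e" "\<And>z. z \<in> ball 0 d - {0} \<Longrightarrow> card (?Z z) = m" by metis
  define P where "P = ball (0::complex) d - {0}"
  have Pe: "P \<subseteq> ball 0 e" using d by (auto simp: P_def)
  then have P: "P \<subseteq> \<Omega>" using e by blast
  have nzP: "G z k \<noteq> 0" if "z \<in> P" "k \<in> sphere k0 R" for z k using that e(3) Pe by blast
  define H where "H = {L. Re L < ln d}"
  have expP: "exp L \<in> P \<longleftrightarrow> L \<in> H" for L
  proof -
    have "exp L \<in> P \<longleftrightarrow> exp (Re L) < exp (ln d)" using d(1) by (simp add: P_def)
    then show ?thesis by (simp add: H_def)
  qed
  \<comment> \<open>An arbitrary base point of the half-plane.\<close>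
  define L1 where "L1 = complex_of_real (ln d - 1)"
  have L1: "L1 \<in> H" by (simp add: L1_def H_def)
  define J where "J = ?Z (exp L1)"
  have fin: "finite J" unfolding J_def
    using zeros_finite[where c = k0, OF R nzP] L1 expP by auto
  have mJ: "card J = m" using d(3) expP[of L1] L1 by (simp add: J_def P_def)
  have cntJ: "(\<Sum>w\<in>J. zorder (G (exp L1)) w) = n"
    using cnt[of "exp L1"] expP[of L1] L1 Pe unfolding count_def J_def by blast
  have posJ: "zorder (G (exp L1)) w > 0" if "w \<in> J" for w
    using zorder_zeros_pos[where c = k0, OF R nzP] that expP L1 unfolding J_def by blast
  have m: "m > 0" using cntJ n fin mJ by (cases "J = {}") auto
  have mn: "m \<le> n"
    using card_zeros_le_count[where c = k0 and z = "exp L1", OF R nzP] expP[of L1] L1 mJ cnt[of "exp L1"] Pe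
    by (auto simp: J_def)
  from root_branches_exist[OF d(1) P_def P R nzP _ m] d(3) L1
  obtain \<kappa> p where B: "root_branches H (ball k0 R) L1 m \<kappa> p"
    unfolding H_def P_def by metis
  note B = B[unfolded root_branches_def, folded J_def]
  have bij: "bij_betw (\<lambda>w. \<kappa> w L) J (?Z (exp L))" if "L \<in> H" for L using B that by blast
  have lim: "\<exists>\<rho>>0. \<forall>L\<in>H. Re L < ln \<rho> \<longrightarrow> dist (\<kappa> w L) k0 < \<eta>" if "w \<in> J" "\<eta> > 0" for w \<eta>
  proof -
    from zeros_near_shrink[OF \<Omega> only that(2)] obtain \<rho> where \<rho>: "\<rho> > 0"
      "\<And>z. z \<in> ball 0 \<rho> \<Longrightarrow> ?Z z \<subseteq> ball k0 \<eta>" by metis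
    have "dist (\<kappa> w L) k0 < \<eta>" if L: "L \<in> H" "Re L < ln \<rho>" for L
    proof -
      have "exp (Re L) < exp (ln \<rho>)" using L(2) by simp
      then have "exp L \<in> ball 0 \<rho>" using \<rho>(1) by simp
      moreover have "\<kappa> w L \<in> ?Z (exp L)" using bij_betwE[OF bij[OF L(1)]] \<open>w \<in> J\<close> by blast
      ultimately have "\<kappa> w L \<in> ball k0 \<eta>" using \<rho>(2) by blast
      then show ?thesis by (simp add: dist_commute)
    qed
    then show ?thesis using \<rho>(1) by blast
  qed
  have "\<exists>h. h analytic_on {0} \<and> (\<forall>L\<in>H. h (exp (of_real (1 / real (p w)) * L)) = \<kappa> w L)"
    if w: "w \<in> J" for w
  proof -
    have "0 < p w" "\<kappa> w holomorphic_on H"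
      "\<And>L. L \<in> H \<Longrightarrow> \<kappa> w (L + of_nat (p w) * (2 * pi * \<i>)) = \<kappa> w L" using B w by blast+
    from descend_to_punctured_disc[OF d(1) this[unfolded H_def] lim[OF w, unfolded H_def]]
    show ?thesis unfolding H_def by metis
  qed
  then obtain h where h: "\<And>w. w \<in> J \<Longrightarrow> h w analytic_on {0}"
     "\<And>w L. w \<in> J \<Longrightarrow> L \<in> H \<Longrightarrow> h w (exp (of_real (1 / real (p w)) * L)) = \<kappa> w L" by metis
  have "(\<Sum>w\<in>J. nat (zorder (G (exp L1)) w)) = n"
  proof -
    have "int (\<Sum>w\<in>J. nat (zorder (G (exp L1)) w)) = (\<Sum>w\<in>J. zorder (G (exp L1)) w)"
      unfolding of_nat_sum using posJ by (intro sum.cong) (auto simp: less_imp_le)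
    then show ?thesis unfolding cntJ of_nat_eq_iff .
  qed
  from ex_fun_with_fibre_cards[OF fin this] obtain \<iota> where \<iota>: "\<And>i. i < n \<Longrightarrow> \<iota> i \<in> J"
    "\<And>w. w \<in> J \<Longrightarrow> card {i. i < n \<and> \<iota> i = w} = nat (zorder (G (exp L1)) w)" by metis
  have props: "h (\<iota> i) analytic_on {0} \<and> 1 / real (p (\<iota> i)) \<in> \<rat> \<and> 1 / real n \<le> 1 / real (p (\<iota> i))"
    if "i < n" for i
  proof -
    have "0 < p (\<iota> i)" "p (\<iota> i) \<le> m" using B \<iota>(1)[OF that] by blast+
    then show ?thesis using h(1)[OF \<iota>(1)[OF that]] mn by (auto intro!: divide_left_mono)
  qed
  have branches: "\<forall>\<^sub>F z in at 0. \<forall>L. exp L = z \<longrightarrow>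
          (\<forall>i<n. h (\<iota> i) (exp (of_real (1 / real (p (\<iota> i))) * L)) \<in> zeros z V) \<and>
          (\<forall>k\<in>zeros z V. zorder (G z) k
              = int (card {i. i < n \<and> h (\<iota> i) (exp (of_real (1 / real (p (\<iota> i))) * L)) = k}))"
    if V: "open V" "k0 \<in> V" "V \<subseteq> ball k0 R" for V
  proof -
    obtain \<eta> where \<eta>: "\<eta> > 0" "ball k0 \<eta> \<subseteq> V" using V by (meson openE)
    from zeros_near_shrink[OF \<Omega> only \<eta>(1)] obtain \<rho> where \<rho>: "\<rho> > 0"
      "\<And>z. z \<in> ball 0 \<rho> \<Longrightarrow> ?Z z \<subseteq> ball k0 \<eta>" by metis
    have ZV: "zeros z V = ?Z z" if "z \<in> ball 0 \<rho>" for z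
      using \<rho>(2)[OF that] \<eta>(2) V(3) by (auto simp: zeros_def)
    have main: "(\<forall>i<n. h (\<iota> i) (exp (of_real (1 / real (p (\<iota> i))) * L)) \<in> ?Z (exp L)) \<and>
          (\<forall>k\<in>?Z (exp L). zorder (G (exp L)) k
              = int (card {i. i < n \<and> h (\<iota> i) (exp (of_real (1 / real (p (\<iota> i))) * L)) = k}))"
      if L: "L \<in> H" for L
    proof -
      have hk: "h (\<iota> i) (exp (of_real (1 / real (p (\<iota> i))) * L)) = \<kappa> (\<iota> i) L" if "i < n" for i
        using h(2)[OF \<iota>(1)[OF that] L] .
      have "zorder (G (exp L)) k
              = int (card {i. i < n \<and> h (\<iota> i) (exp (of_real (1 / real (p (\<iota> i))) * L)) = k})"
        if k: "k \<in> ?Z (exp L)" for k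
      proof -
        obtain w where w: "w \<in> J" "k = \<kappa> w L" using bij[OF L] k unfolding bij_betw_def by blast
        have "\<kappa> (\<iota> i) L = \<kappa> w L \<longleftrightarrow> \<iota> i = w" if "i < n" for i
          using bij[OF L] w(1) \<iota>(1)[OF that] unfolding bij_betw_def inj_on_def by blast
        then have "{i. i < n \<and> h (\<iota> i) (exp (of_real (1 / real (p (\<iota> i))) * L)) = k}
           = {i. i < n \<and> \<iota> i = w}" using hk w(2) by auto
        moreover have "zorder (G (exp L)) k = zorder (G (exp L1)) w" using B w L by blast
        ultimately show ?thesis using \<iota>(2)[OF w(1)] posJ[OF w(1)] by simp
      qed
      moreover have "h (\<iota> i) (exp (of_real (1 / real (p (\<iota> i))) * L)) \<in> ?Z (exp L)" if "i < n" for i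
        using hk[OF that] bij_betwE[OF bij[OF L]] \<iota>(1)[OF that] by auto
      ultimately show ?thesis by blast
    qed
    have "\<forall>\<^sub>F z in at 0. z \<in> ball 0 \<rho> \<and> z \<in> P"
      unfolding eventually_at using \<rho>(1) d(1)
      by (intro exI[of _ "min \<rho> d"]) (auto simp: P_def)
    then show "\<forall>\<^sub>F z in at 0. \<forall>L. exp L = z \<longrightarrow>
          (\<forall>i<n. h (\<iota> i) (exp (of_real (1 / real (p (\<iota> i))) * L)) \<in> zeros z V) \<and>
          (\<forall>k\<in>zeros z V. zorder (G z) k
              = int (card {i. i < n \<and> h (\<iota> i) (exp (of_real (1 / real (p (\<iota> i))) * L)) = k}))"
    proof (rule eventually_mono)
      fix z assume z: "z \<in> ball 0 \<rho> \<and> z \<in> P"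
      show "\<forall>L. exp L = z \<longrightarrow>
          (\<forall>i<n. h (\<iota> i) (exp (of_real (1 / real (p (\<iota> i))) * L)) \<in> zeros z V) \<and>
          (\<forall>k\<in>zeros z V. zorder (G z) k
              = int (card {i. i < n \<and> h (\<iota> i) (exp (of_real (1 / real (p (\<iota> i))) * L)) = k}))"
      proof (intro allI impI)
        fix L assume "exp L = z"
        then show "(\<forall>i<n. h (\<iota> i) (exp (of_real (1 / real (p (\<iota> i))) * L)) \<in> zeros z V) \<and>
          (\<forall>k\<in>zeros z V. zorder (G z) k
              = int (card {i. i < n \<and> h (\<iota> i) (exp (of_real (1 / real (p (\<iota> i))) * L)) = k}))"
          using main[of L] z expP[of L] ZV[of z] by auto
      qed
    qed
  qed
  have "puiseux_roots G k0 n R (\<lambda>i. h (\<iota> i)) (\<lambda>i. 1 / real (p (\<iota> i)))"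
    unfolding puiseux_roots_def zeros_def[symmetric] using R props branches by simp
  then show ?thesis by (rule that)
qed

end

section \<open>The resonance function as a transfer recursion\<close>

text \<open>
  A transfer-matrix product: the entry \<open>path_amp w j \<beta>\<close> sums the weights of all sign paths of length
  \<open>j\<close> from \<open>-1\<close> to \<open>\<beta>\<close>.
\<close>

fun path_amp :: "(nat \<Rightarrow> int \<Rightarrow> int \<Rightarrow> complex) \<Rightarrow> nat \<Rightarrow> int \<Rightarrow> complex" where
  "path_amp w 0 \<beta> = (if \<beta> = -1 then 1 else 0)"
| "path_amp w (Suc j) \<beta> = (\<Sum>a\<in>{-1, 1}. path_amp w j a * w (Suc j) a \<beta>)"

text \<open>
  The initial sign \<open>\<alpha>\<^sub>0 = -1\<close> of a path; the final one \<open>\<alpha>\<^sub>2\<^sub>N = -1\<close> is left to the function \<open>g\<close> below.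
\<close>

definition from_minus :: "(nat \<Rightarrow> int) \<Rightarrow> nat \<Rightarrow> int" where
  "from_minus \<alpha> j = (if j = 0 then -1 else \<alpha> j)"

lemma sum_over_sign_paths:
  "(\<Sum>\<alpha>\<in>{1..M} \<rightarrow>\<^sub>E {-1, 1}.
      (\<Prod>j=1..M. w j (from_minus \<alpha> (j - 1)) (from_minus \<alpha> j)) * g (from_minus \<alpha> M))
   = (\<Sum>\<beta>\<in>{-1, 1}. path_amp w M \<beta> * g \<beta>)"
proof (induction M arbitrary: g)
  case 0
  show ?case by (simp add: from_minus_def)
next
  case (Suc M)
  have upd: "from_minus (\<alpha>(Suc M := y)) j = (if j = Suc M then y else from_minus \<alpha> j)" for \<alpha> y j
    by (auto simp: from_minus_def)
  have prod_eq: "(\<Prod>j=1..M. w j (from_minus (\<alpha>(Suc M := y)) (j - 1)) (from_minus (\<alpha>(Suc M := y)) j))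
     = (\<Prod>j=1..M. w j (from_minus \<alpha> (j - 1)) (from_minus \<alpha> j))" for \<alpha> y
    by (intro prod.cong refl) (auto simp: upd)
  define F where "F \<alpha> = (\<Prod>j=1..Suc M. w j (from_minus \<alpha> (j - 1)) (from_minus \<alpha> j)) *
      g (from_minus \<alpha> (Suc M))" for \<alpha>
  have ivl: "{1..Suc M} = insert (Suc M) {1..M}" by auto
  have "F (\<alpha>(Suc M := y)) = (\<Prod>j=1..M. w j (from_minus \<alpha> (j - 1)) (from_minus \<alpha> j)) *
      w (Suc M) (from_minus \<alpha> M) y * g y" for \<alpha> y
  proof -
    have "F (\<alpha>(Suc M := y)) =
        (\<Prod>j=1..M. w j (from_minus (\<alpha>(Suc M := y)) (j - 1)) (from_minus (\<alpha>(Suc M := y)) j)) *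
        w (Suc M) (from_minus (\<alpha>(Suc M := y)) (Suc M - 1)) (from_minus (\<alpha>(Suc M := y)) (Suc M)) *
        g (from_minus (\<alpha>(Suc M := y)) (Suc M))"
      by (simp add: F_def)
    then show ?thesis unfolding prod_eq by (simp add: upd)
  qed
  moreover have "(\<Sum>\<alpha>\<in>{1..Suc M} \<rightarrow>\<^sub>E {-1, 1}. F \<alpha>) =
      (\<Sum>y\<in>{-1, 1}. \<Sum>\<alpha>\<in>{1..M} \<rightarrow>\<^sub>E {-1, 1}. F (\<alpha>(Suc M := y)))"
    unfolding ivl by (rule sum_PiE_insert) simp
  ultimately have "(\<Sum>\<alpha>\<in>{1..Suc M} \<rightarrow>\<^sub>E {-1, 1}. F \<alpha>)
    = (\<Sum>y\<in>{-1, 1}. \<Sum>\<alpha>\<in>{1..M} \<rightarrow>\<^sub>E {-1, 1}.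
      (\<Prod>j=1..M. w j (from_minus \<alpha> (j - 1)) (from_minus \<alpha> j)) * w (Suc M) (from_minus \<alpha> M) y * g y)"
    by (simp only:)
also have "\<dots> = (\<Sum>y\<in>{-1, 1}. path_amp w (Suc M) y * g y)"
  proof (intro sum.cong refl)
    fix y
    have "(\<Sum>\<alpha>\<in>{1..M} \<rightarrow>\<^sub>E {-1, 1}.
      (\<Prod>j=1..M. w j (from_minus \<alpha> (j - 1)) (from_minus \<alpha> j)) * w (Suc M) (from_minus \<alpha> M) y * g y)
      = (\<Sum>\<alpha>\<in>{1..M} \<rightarrow>\<^sub>E {-1, 1}.
      (\<Prod>j=1..M. w j (from_minus \<alpha> (j - 1)) (from_minus \<alpha> j)) * w (Suc M) (from_minus \<alpha> M) y) * g y"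
      by (simp add: sum_distrib_right)
    also have "\<dots> = path_amp w (Suc M) y * g y"
      by (subst Suc.IH[of "\<lambda>a. w (Suc M) a y"]) simp
    finally show "(\<Sum>\<alpha>\<in>{1..M} \<rightarrow>\<^sub>E {-1, 1}.
      (\<Prod>j=1..M. w j (from_minus \<alpha> (j - 1)) (from_minus \<alpha> j)) * w (Suc M) (from_minus \<alpha> M) y * g y)
      = path_amp w (Suc M) y * g y" .
  qed
  finally show ?case unfolding F_def .
qed

text \<open>
  Up to a common factor, \<open>amp t \<rho> k j (-1)\<close> and \<open>- amp t \<rho> k j 1\<close> are the amplitudes of the left- and
  the right-going wave at the right end of chamber \<open>j\<close>, if only a left-going wave leaves the scatterer
  on the left.
\<close>

fun amp :: "(nat \<Rightarrow> real) \<Rightarrow> complex \<Rightarrow> complex \<Rightarrow> nat \<Rightarrow> int \<Rightarrow> complex" where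
  "amp t \<rho> k 0 \<beta> = (if \<beta> = -1 then 1 else 0)"
| "amp t \<rho> k (Suc j) \<beta> = exp (\<i> * of_int \<beta> * of_real (t (Suc j)) * k) *
     (amp t \<rho> k j \<beta> + (-1) ^ Suc j * \<rho> * amp t \<rho> k j (-\<beta>))"

lemma path_amp_eq_amp:
  assumes "\<And>j a \<beta>. w j a \<beta> = ((-1) ^ j * \<rho>) ^ (if \<beta> \<noteq> a then 1 else 0) * exp (\<i> * of_int \<beta> * of_real (t j) * k)"
    and "\<beta> \<in> {-1, 1}"
  shows "path_amp w j \<beta> = amp t \<rho> k j \<beta>"
  using assms(2)
  by (induction j arbitrary: \<beta>) (auto simp: assms(1) algebra_simps)

text \<open>
  The exponents of \<open>-1\<close> and of \<open>\<rho>\<close> in \<open>f\<close> are sums over \<open>j\<close>, so the summand of a path is a product of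
  weights of its steps. The last interface has even index, so it contributes \<open>\<rho>\<close> if the path has to change sign there.
\<close>

lemma res_fun_eq_amp:
  assumes N: "N \<ge> 1"
  shows "res_fun N t \<sigma> k = amp t ((1 - \<sigma>) / (1 + \<sigma>)) k (2*N-1) (-1)
           + (1 - \<sigma>) / (1 + \<sigma>) * amp t ((1 - \<sigma>) / (1 + \<sigma>)) k (2*N-1) 1"
proof -
  define \<rho> where "\<rho> = (1 - \<sigma>) / (1 + \<sigma>)"
  define M where "M = 2 * N - 1"
  have SM: "2 * N = Suc M" using N by (simp add: M_def)
  define w where "w j a \<beta> = ((-1) ^ j * \<rho>) ^ (if \<beta> \<noteq> a then 1 else 0) * exp (\<i> * of_int \<beta> * of_real (t j) * k)"
    for j :: nat and a \<beta> :: int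
  define g where "g a = \<rho> ^ (if -1 \<noteq> (a::int) then 1 else 0)" for a
  have "(-1) ^ (\<Sum>j=1..Suc M. j * sign_change N \<alpha> j) * \<rho> ^ (\<Sum>j=1..Suc M. sign_change N \<alpha> j)
        * exp (\<i> * of_real (\<Sum>j=1..M. of_int (\<alpha> j) * t j) * k)
     = (\<Prod>j=1..M. w j (from_minus \<alpha> (j - 1)) (from_minus \<alpha> j)) * g (from_minus \<alpha> M)" for \<alpha>
  proof -
    have ext: "extend_signs N \<alpha> j = from_minus \<alpha> j" if "j \<le> M" for j
      using that by (auto simp: extend_signs_def from_minus_def M_def)
    have sc: "sign_change N \<alpha> j = (if from_minus \<alpha> j \<noteq> from_minus \<alpha> (j - 1) then 1 else 0)" if "j \<in> {1..M}" for j
    proof -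
      have "extend_signs N \<alpha> j = from_minus \<alpha> j" "extend_signs N \<alpha> (j - 1) = from_minus \<alpha> (j - 1)"
        using that by (auto intro!: ext)
      then show ?thesis by (simp only: sign_change_def)
    qed
    have scS: "sign_change N \<alpha> (Suc M) = (if -1 \<noteq> from_minus \<alpha> M then 1 else 0)"
      using SM by (simp add: sign_change_def ext) (simp add: extend_signs_def)
    have "(-1) ^ (\<Sum>j=1..Suc M. j * sign_change N \<alpha> j) * \<rho> ^ (\<Sum>j=1..Suc M. sign_change N \<alpha> j)
        = (\<Prod>j=1..Suc M. ((-1) ^ j * \<rho>) ^ sign_change N \<alpha> j)"
      by (simp only: power_sum power_mult power_mult_distrib prod.distrib)
    also have "\<dots> = (\<Prod>j=1..M. ((-1) ^ j * \<rho>) ^ sign_change N \<alpha> j) * ((-1) ^ Suc M * \<rho>) ^ sign_change N \<alpha> (Suc M)"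
      by simp
    also have "((-1) ^ Suc M * \<rho>) ^ sign_change N \<alpha> (Suc M) = g (from_minus \<alpha> M)"
    proof -
      have ev: "(-1::complex) ^ Suc M = 1" unfolding SM[symmetric] by simp
      show ?thesis unfolding scS g_def ev by simp
    qed
    also have "(\<Prod>j=1..M. ((-1) ^ j * \<rho>) ^ sign_change N \<alpha> j)
        = (\<Prod>j=1..M. ((-1) ^ j * \<rho>) ^ (if from_minus \<alpha> j \<noteq> from_minus \<alpha> (j - 1) then 1 else 0))"
      by (intro prod.cong refl) (simp add: sc)
    finally have 1: "(-1) ^ (\<Sum>j=1..Suc M. j * sign_change N \<alpha> j) * \<rho> ^ (\<Sum>j=1..Suc M. sign_change N \<alpha> j)
       = (\<Prod>j=1..M. ((-1) ^ j * \<rho>) ^ (if from_minus \<alpha> j \<noteq> from_minus \<alpha> (j - 1) then 1 else 0)) * g (from_minus \<alpha> M)" .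
    have "exp (\<i> * of_real (\<Sum>j=1..M. of_int (\<alpha> j) * t j) * k)
        = exp (\<Sum>j=1..M. \<i> * of_int (from_minus \<alpha> j) * of_real (t j) * k)"
      by (simp add: sum_distrib_left sum_distrib_right from_minus_def mult_ac)
    also have "\<dots> = (\<Prod>j=1..M. exp (\<i> * of_int (from_minus \<alpha> j) * of_real (t j) * k))"
      by (simp add: exp_sum)
    finally show ?thesis unfolding 1 w_def prod.distrib by (simp add: mult_ac)
  qed
  then have "res_fun N t \<sigma> k = (\<Sum>\<alpha>\<in>{1..M} \<rightarrow>\<^sub>E {-1, 1}.
      (\<Prod>j=1..M. w j (from_minus \<alpha> (j - 1)) (from_minus \<alpha> j)) * g (from_minus \<alpha> M))"
    unfolding res_fun_def \<rho>_def[symmetric] M_def[symmetric] SM by simp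
  also have "\<dots> = (\<Sum>\<beta>\<in>{-1, 1}. path_amp w M \<beta> * g \<beta>)" by (rule sum_over_sign_paths)
  also have "\<dots> = amp t \<rho> k M (-1) + \<rho> * amp t \<rho> k M 1"
    by (simp add: path_amp_eq_amp[of w \<rho> t k] w_def g_def)
  finally show ?thesis by (simp add: \<rho>_def M_def)
qed

text \<open>
  Changing the sign of \<open>\<rho>\<close> conjugates every transfer matrix by \<open>diag(1, -1)\<close>.
\<close>

lemma amp_minus: "\<beta> \<in> {-1, 1} \<Longrightarrow> amp t (-\<rho>) k j \<beta> = - of_int \<beta> * amp t \<rho> k j \<beta>"
  by (induction j arbitrary: \<beta>) (auto simp: algebra_simps)

text \<open>
  Inverting \<open>\<sigma>\<close> changes the sign of \<open>\<rho>\<close>, and by \<open>amp_minus\<close> \<open>f\<close> is even in \<open>\<rho>\<close>. For \<open>\<sigma> = -1\<close> both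
  quotients are \<open>0\<close> by division by zero.
\<close>

lemma res_fun_inverse:
  assumes N: "N \<ge> 1" and \<sigma>: "\<sigma> \<noteq> 0"
  shows "res_fun N t (1 / \<sigma>) = res_fun N t \<sigma>"
proof -
  have "(1 - 1 / \<sigma>) / (1 + 1 / \<sigma>) = - ((1 - \<sigma>) / (1 + \<sigma>))"
  proof (cases "1 + \<sigma> = 0")
    case True
    then have "\<sigma> = -1" by (simp add: add_eq_0_iff)
    then show ?thesis by simp
  next
    case False
    have "1 - 1 / \<sigma> = (\<sigma> - 1) / \<sigma>" "1 + 1 / \<sigma> = (1 + \<sigma>) / \<sigma>"
      using \<sigma> by (simp_all add: field_simps)
    then show ?thesis using \<sigma> False by simp (metis minus_diff_eq minus_divide_left)
  qed
  then show ?thesis by (simp add: fun_eq_iff res_fun_eq_amp[OF N] amp_minus)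
qed

text \<open>
  Without phases two consecutive interfaces multiply by \<open>(1 - \<rho> X)(1 + \<rho> X) = 1 - \<rho>\<^sup>2\<close>, where \<open>X\<close>
  exchanges the two signs.
\<close>

lemma amp_at_0: "\<beta> \<in> {-1, 1} \<Longrightarrow> amp t \<rho> 0 (2 * n) \<beta> = (1 - \<rho>\<^sup>2) ^ n * (if \<beta> = -1 then 1 else 0)"
  by (induction n arbitrary: \<beta>) (auto simp: algebra_simps power2_eq_square)

lemma res_fun_at_0_nonzero:
  assumes N: "N \<ge> 1" and \<sigma>: "\<sigma> \<noteq> 0"
  shows "res_fun N t \<sigma> 0 \<noteq> 0"
proof -
  define \<rho> where "\<rho> = (1 - \<sigma>) / (1 + \<sigma>)"
  have SN: "2 * N = Suc (2 * N - 1)" and odd: "odd (2 * N - 1)" using N by simp_all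
  have "amp t \<rho> 0 (Suc M) (-1) = amp t \<rho> 0 M (-1) + \<rho> * amp t \<rho> 0 M 1" if "odd M" for M
    using that by simp
  from this[OF odd, folded SN] have "amp t \<rho> 0 (2 * N) (-1) = res_fun N t \<sigma> 0"
    unfolding res_fun_eq_amp[OF N] \<rho>_def .
  then have "res_fun N t \<sigma> 0 = (1 - \<rho>\<^sup>2) ^ N" by (simp add: amp_at_0)
  moreover have "\<rho>\<^sup>2 \<noteq> 1"
  proof
    assume "\<rho>\<^sup>2 = 1"
    then have "1 + \<sigma> \<noteq> 0" "(1 - \<sigma>)\<^sup>2 = (1 + \<sigma>)\<^sup>2"
      by (auto simp: \<rho>_def power_divide divide_eq_1_iff)
    then show False using \<sigma> by (simp add: power2_eq_square algebra_simps)
  qed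
  ultimately show ?thesis by simp
qed

text \<open>
  For \<open>\<rho> = 1\<close> the interface matrices have rank one, so a single combination of the two amplitudes passes
  each interface, and a chamber multiplies it by the difference of its two phases.
\<close>

lemma amp_at_1:
  "amp t 1 k j 1 + (-1) ^ Suc j * amp t 1 k j (-1) = - (\<Prod>i=1..j. 2 * \<i> * sin (of_real (t i) * k))"
proof (induction j)
  case (Suc j)
  define Q where "Q = amp t 1 k j 1 + (-1) ^ Suc j * amp t 1 k j (-1)"
  have sq: "(-1) ^ j * ((-1) ^ j * x) = (x::complex)" for x by (simp flip: mult.assoc power_mult_distrib)
  have "amp t 1 k (Suc j) 1 + (-1) ^ Suc (Suc j) * amp t 1 k (Suc j) (-1)
      = (exp (\<i> * (of_real (t (Suc j)) * k)) - exp (- (\<i> * (of_real (t (Suc j)) * k)))) * Q"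
    by (simp add: Q_def algebra_simps sq)
  also have "exp (\<i> * (of_real (t (Suc j)) * k)) - exp (- (\<i> * (of_real (t (Suc j)) * k)))
      = 2 * \<i> * sin (of_real (t (Suc j)) * k)"
    by (simp add: sin_exp_eq)
  finally show ?case using Suc by (simp add: Q_def)
qed simp

lemma res_fun_0:
  assumes N: "N \<ge> 1"
  shows "res_fun N t 0 k = - (\<Prod>j=1..2*N-1. 2 * \<i> * sin (of_real (t j) * k))"
proof -
  have SN: "Suc (2 * N - 1) = 2 * N" using N by simp
  show ?thesis using amp_at_1[of t k "2*N-1"] unfolding SN by (simp add: res_fun_eq_amp[OF N] add.commute)
qed

section \<open>The limiting zeros and the strip\<close>

lemma zorder_sin_factor:
  fixes \<tau> x :: real
  assumes "\<tau> \<noteq> 0"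
  shows "zorder (\<lambda>k. 2 * \<i> * sin (of_real \<tau> * k)) (of_real x) = (if \<exists>m::int. \<tau> * x = pi * of_int m then 1 else 0)"
proof -
  have zero: "sin (of_real \<tau> * of_real x :: complex) = 0 \<longleftrightarrow> (\<exists>m::int. \<tau> * x = pi * of_int m)"
  proof -
    have "sin (of_real \<tau> * of_real x :: complex) = of_real (sin (\<tau> * x))" by (simp flip: sin_of_real)
    then show ?thesis by (simp add: sin_zero_iff_int2 mult.commute)
  qed
  show ?thesis
  proof (cases "\<exists>m::int. \<tau> * x = pi * of_int m")
    case True
    have D: "deriv (\<lambda>k. 2 * \<i> * sin (of_real \<tau> * k)) (of_real x) = 2 * \<i> * (of_real \<tau> * cos (of_real \<tau> * of_real x))"
      by (rule DERIV_imp_deriv) (auto intro!: derivative_eq_intros)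
    have "cos (of_real \<tau> * of_real x :: complex) \<noteq> 0"
      using zero True sin_cos_squared_add[of "of_real \<tau> * of_real x :: complex"] by auto
    then have "zorder (\<lambda>k. 2 * \<i> * sin (of_real \<tau> * k)) (of_real x) = 1"
      using zero True assms D
      by (intro zorder_zero_eqI'[where n = 1]) (auto intro!: analytic_intros)
    then show ?thesis using True by simp
  next
    case False
    have "zorder (\<lambda>k. 2 * \<i> * sin (of_real \<tau> * k)) (of_real x) = 0"
      using zero False by (intro zorder_eq_0I) (auto intro!: analytic_intros)
    then show ?thesis using False by simp
  qed
qed

lemma
  fixes x :: real
  assumes N: "N \<ge> 1" and t: "\<And>j. j \<in> {1..2*N-1} \<Longrightarrow> t j \<noteq> 0"
  shows zorder_res_fun_0: "zorder (res_fun N t 0) (of_real x) = int (limit_count N t x)"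
    and res_fun_0_not_identically_0: "\<exists>w. res_fun N t 0 w \<noteq> 0"
proof -
  define f where "f j k = 2 * \<i> * sin (of_real (t j) * k)" for j k
  have eq: "res_fun N t 0 = (\<lambda>k. -1 * (\<Prod>j=1..2*N-1. f j k))"
    by (simp add: fun_eq_iff res_fun_0[OF N] f_def)
  have "\<forall>\<^sub>F k in at (of_real x). f j k \<noteq> 0" if j: "j \<in> {1..2*N-1}" for j
  proof (rule eventually_nonzero_at)
    show "f j holomorphic_on UNIV" unfolding f_def by (intro holomorphic_intros)
    have "f j (of_real (pi / 2 / t j)) = 2 * \<i> * of_real (sin (pi / 2))"
      unfolding f_def sin_of_real[symmetric] using t[OF j] by simp
    then show "f j (of_real (pi / 2 / t j)) \<noteq> 0" by simp
  qed
  then have ev: "\<forall>\<^sub>F k in at (of_real x). (\<Prod>j=1..2*N-1. f j k) \<noteq> 0"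
    by (simp add: eventually_ball_finite)
  then show "\<exists>w. res_fun N t 0 w \<noteq> 0"
    using eventually_happens'[OF _ ev] by (auto simp: eq)
  have "zorder (res_fun N t 0) (of_real x) = zorder (\<lambda>k. \<Prod>j=1..2*N-1. f j k) (of_real x)"
    unfolding eq by (rule zorder_cmult) simp
  also have "\<dots> = (\<Sum>j=1..2*N-1. zorder (f j) (of_real x))"
    by (rule zorder_prod_analytic[OF _ ev]) (auto simp: f_def intro!: analytic_intros)
  also have "\<dots> = (\<Sum>j=1..2*N-1. if \<exists>m::int. t j * x = pi * of_int m then 1 else 0)"
    using t unfolding f_def[abs_def] by (intro sum.cong refl) (simp add: zorder_sin_factor)
  also have "\<dots> = int (limit_count N t x)"
    unfolding limit_count_def by (simp add: sum.If_cases Int_def)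
  finally show "zorder (res_fun N t 0) (of_real x) = int (limit_count N t x)" .
qed

text \<open>
  For large \<open>Im k\<close> the exponential with the smallest frequency dominates all others together.
\<close>

lemma exponential_sum_zeros_bounded:
  fixes c :: "'a \<Rightarrow> complex" and b :: "'a \<Rightarrow> real"
  assumes A: "finite A" "a0 \<in> A" and c: "c a0 \<noteq> 0" and b: "\<And>a. a \<in> A - {a0} \<Longrightarrow> b a0 < b a"
  obtains C where "\<And>k. (\<Sum>a\<in>A. c a * exp (\<i> * of_real (b a) * k)) = 0 \<Longrightarrow> Im k < C"
proof -
  define g where "g y = (\<Sum>a\<in>A - {a0}. norm (c a) * exp (- ((b a - b a0) * y)))" for y
  have "(g \<longlongrightarrow> (\<Sum>a\<in>A - {a0}. 0)) at_top"
    unfolding g_def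
  proof (rule tendsto_sum)
    fix a assume "a \<in> A - {a0}"
    then have "filterlim (\<lambda>y. (b a - b a0) * y) at_top at_top"
      using b by (intro filterlim_tendsto_pos_mult_at_top[OF tendsto_const _ filterlim_ident]) simp
    then have "((\<lambda>y. exp (- ((b a - b a0) * y))) \<longlongrightarrow> 0) at_top"
      by (intro filterlim_compose[OF exp_at_bot] filterlim_compose[OF filterlim_uminus_at_bot_at_top])
    then show "((\<lambda>y. norm (c a) * exp (- ((b a - b a0) * y))) \<longlongrightarrow> 0) at_top"
      by (rule tendsto_mult_right_zero)
  qed
  then have "\<forall>\<^sub>F y in at_top. g y < norm (c a0)" using c by (intro order_tendstoD) auto
  then obtain C where C: "\<And>y. y \<ge> C \<Longrightarrow> g y < norm (c a0)" by (auto simp: eventually_at_top_linorder)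
  show ?thesis
  proof (rule that[of C], rule ccontr)
    fix k assume 0: "(\<Sum>a\<in>A. c a * exp (\<i> * of_real (b a) * k)) = 0" and "\<not> Im k < C"
    then have gC: "g (Im k) < norm (c a0)" using C by simp
    have "c a0 * exp (\<i> * of_real (b a0) * k) = - (\<Sum>a\<in>A - {a0}. c a * exp (\<i> * of_real (b a) * k))"
      using 0 by (simp add: sum.remove[OF A] eq_neg_iff_add_eq_0)
    then have "norm (c a0 * exp (\<i> * of_real (b a0) * k)) \<le> (\<Sum>a\<in>A - {a0}. norm (c a * exp (\<i> * of_real (b a) * k)))"
      by (simp add: norm_sum)
    then have "norm (c a0) * exp (- (b a0 * Im k)) \<le> (\<Sum>a\<in>A - {a0}. norm (c a) * exp (- (b a * Im k)))"
      by (simp add: norm_mult)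
    also have "\<dots> = g (Im k) * exp (- (b a0 * Im k))"
      unfolding g_def sum_distrib_right
      by (intro sum.cong refl) (simp add: algebra_simps flip: exp_add)
    finally show False using gC by simp
  qed
qed

text \<open>
  The extreme frequencies belong to the constant sign paths \<open>top (-1)\<close> and \<open>top 1\<close>, and their coefficients
  do not vanish as \<open>\<rho> \<noteq> 0\<close>. The first dominates in the upper half-plane, the second in the lower one.
\<close>

lemma zeros_in_strip_exist:
  assumes N: "N \<ge> 1" and t: "\<And>j. j \<in> {1..2*N-1} \<Longrightarrow> t j > 0" and \<sigma>: "\<sigma> \<noteq> 1" "\<sigma> \<noteq> -1"
  shows "\<exists>C1 C2. zeros_in_strip N t \<sigma> C1 C2"
proof -
  define \<rho> where "\<rho> = (1 - \<sigma>) / (1 + \<sigma>)"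
  have \<rho>: "\<rho> \<noteq> 0" using \<sigma> by (auto simp: \<rho>_def add_eq_0_iff)
  define A where "A = {1..2*N-1} \<rightarrow>\<^sub>E {-1, 1::int}"
  define c where "c \<alpha> = (-1) ^ (\<Sum>j=1..2*N. j * sign_change N \<alpha> j) * \<rho> ^ (\<Sum>j=1..2*N. sign_change N \<alpha> j)" for \<alpha>
  define b where "b \<alpha> = (\<Sum>j=1..2*N-1. of_int (\<alpha> j) * t j)" for \<alpha> :: "nat \<Rightarrow> int"
  have f: "res_fun N t \<sigma> k = (\<Sum>\<alpha>\<in>A. c \<alpha> * exp (\<i> * of_real (b \<alpha>) * k))" for k
    by (simp add: res_fun_def A_def c_def b_def \<rho>_def)
  have fin: "finite A" by (simp add: A_def finite_PiE)
  have c: "c \<alpha> \<noteq> 0" for \<alpha> using \<rho> by (simp add: c_def)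
  \<comment> \<open>With \<open>e = -1\<close> and \<open>e = 1\<close> both ends of the spectrum are treated at once.\<close>
  define top where "top e = (\<lambda>j\<in>{1..2*N-1}. e)" for e :: int
  have top_A: "top e \<in> A" if "e \<in> {-1, 1}" for e using that by (auto simp: A_def top_def)
  have sign: "\<alpha> j = -1 \<or> \<alpha> j = 1" if "\<alpha> \<in> A" "j \<in> {1..2*N-1}" for \<alpha> j
    using that unfolding A_def by (metis PiE_mem insertE singletonD)
  have extreme: "of_int e * b \<alpha> < of_int e * b (top e)" if "\<alpha> \<in> A - {top e}" "e \<in> {-1, 1}" for \<alpha> e
  proof -
    have "\<exists>j\<in>{1..2*N-1}. \<alpha> j \<noteq> top e j"
      using that top_A[OF that(2)] PiE_ext[of \<alpha> "{1..2*N-1}" "\<lambda>_. {-1, 1}" "top e"]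
      by (auto simp: A_def)
    then obtain j where j: "j \<in> {1..2*N-1}" "\<alpha> j \<noteq> e" by (auto simp: top_def)
    have le: "of_int e * (of_int (\<alpha> i) * t i) \<le> of_int e * (of_int (top e i) * t i)" if "i \<in> {1..2*N-1}" for i
      using sign[of \<alpha> i] t[OF that] that \<open>e \<in> {-1, 1}\<close> \<open>\<alpha> \<in> A - {top e}\<close> by (auto simp: top_def)
    have less: "of_int e * (of_int (\<alpha> j) * t j) < of_int e * (of_int (top e j) * t j)"
      using sign[of \<alpha> j] t[OF j(1)] j that by (auto simp: top_def)
    show ?thesis unfolding b_def sum_distrib_left
      using le less j(1) by (intro sum_strict_mono_ex1) auto
  qed
  have "b (top (-1)) < b \<alpha>" if "\<alpha> \<in> A - {top (-1)}" for \<alpha>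
    using extreme[OF that] by simp
  from exponential_sum_zeros_bounded[where c = c and b = b, OF fin top_A c this]
  obtain C where C: "\<And>k. (\<Sum>\<alpha>\<in>A. c \<alpha> * exp (\<i> * of_real (b \<alpha>) * k)) = 0 \<Longrightarrow> Im k < C" by auto
  have "- b (top 1) < - b \<alpha>" if "\<alpha> \<in> A - {top 1}" for \<alpha>
    using extreme[OF that] by simp
  from exponential_sum_zeros_bounded[where c = c and b = "\<lambda>\<alpha>. - b \<alpha>", OF fin top_A c this]
  obtain C' where C': "\<And>k. (\<Sum>\<alpha>\<in>A. c \<alpha> * exp (\<i> * of_real (- b \<alpha>) * k)) = 0 \<Longrightarrow> Im k < C'" by auto
  have "- C' < Im k \<and> Im k < C" if "res_fun N t \<sigma> k = 0" for k
    using C[of k] C'[of "-k"] that by (simp add: f)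
  then have "zeros_in_strip N t \<sigma> (min (- C') (C - 1)) C"
    unfolding zeros_in_strip_def by (auto simp: min_less_iff_disj)
  then show ?thesis by blast
qed

theorem res_fun_puiseux:
  fixes x c :: real
  assumes N: "N \<ge> 1" and t: "\<And>j. j \<in> {1..2*N-1} \<Longrightarrow> t j \<noteq> 0"
    and n: "limit_count N t x = n" "n > 0"
  obtains R h s where "puiseux_roots (\<lambda>z. res_fun N t (of_real c * z)) (of_real x) n R h s"
proof -
  define a where "a \<alpha> z = (-1) ^ (\<Sum>j=1..2*N. j * sign_change N \<alpha> j)
        * ((1 - of_real c * z) / (1 + of_real c * z)) ^ (\<Sum>j=1..2*N. sign_change N \<alpha> j)" for \<alpha> and z :: complex
  define b where "b \<alpha> k = exp (\<i> * of_real (\<Sum>j=1..2*N-1. of_int (\<alpha> j) * t j) * k)" for \<alpha> :: "nat \<Rightarrow> int" and k :: complex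
  define \<Omega> where "\<Omega> = {z::complex. 1 + of_real c * z \<noteq> 0}"
  interpret holomorphic_family "{1..2*N-1} \<rightarrow>\<^sub>E {-1, 1}" a b \<Omega>
  proof
    show "finite ({1..2*N-1} \<rightarrow>\<^sub>E {-1, 1::int})" by (simp add: finite_PiE)
    show "open \<Omega>" unfolding \<Omega>_def by (intro open_Collect_neq continuous_intros)
    show "a \<alpha> holomorphic_on \<Omega>" for \<alpha>
      unfolding a_def \<Omega>_def by (intro holomorphic_intros) auto
    show "b \<alpha> holomorphic_on UNIV" for \<alpha>
      unfolding b_def by (intro holomorphic_intros)
  qed
  have G: "G z = res_fun N t (of_real c * z)" for z
    unfolding G_def a_def b_def res_fun_def fun_eq_iff by simp
  have "0 \<in> \<Omega>" by (simp add: \<Omega>_def)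
  moreover have "zorder (G 0) (of_real x) = int n"
    unfolding G using zorder_res_fun_0[where t = t, OF N t] n by simp
  moreover have "\<exists>w. G 0 w \<noteq> 0" 
    unfolding G using res_fun_0_not_identically_0[where t = t, OF N t] by simp
  then obtain w where "G 0 w \<noteq> 0" ..
  ultimately obtain R h s where "puiseux_roots G (of_real x) n R h s"
    using puiseux_zeros[of "of_real x" n w] n(2) by blast
  moreover have "G = (\<lambda>z. res_fun N t (of_real c * z))" using G by (rule ext)
  ultimately show ?thesis using that by simp
qed

section \<open>Plane waves and transmission through an interface\<close>

definition wave :: "complex \<Rightarrow> real \<Rightarrow> complex \<Rightarrow> complex \<Rightarrow> real \<Rightarrow> complex" where
  "wave \<kappa> z P M x = P * exp (\<i> * \<kappa> * of_real (x - z)) + M * exp (- (\<i> * \<kappa> * of_real (x - z)))"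

lemma wave_deriv:
  "(wave \<kappa> z P M has_vector_derivative wave \<kappa> z (\<i> * \<kappa> * P) (- (\<i> * \<kappa> * M)) x) (at x within S)"
proof -
  have D: "((\<lambda>w. P * exp (\<i> * \<kappa> * (w - of_real z)) + M * exp (- (\<i> * \<kappa> * (w - of_real z)))) has_field_derivative
     wave \<kappa> z (\<i> * \<kappa> * P) (- (\<i> * \<kappa> * M)) x) (at (of_real x) within of_real ` S)"
    by (auto intro!: derivative_eq_intros simp: wave_def algebra_simps)
  have "(of_real has_vector_derivative (1::complex)) (at x within S)"
    by (auto intro!: derivative_eq_intros)
  from field_vector_diff_chain_within[OF this D] show ?thesis
    by (simp add: o_def wave_def[abs_def])
qed

lemma wave_continuous: "continuous_on S (wave \<kappa> z P M)"
  unfolding wave_def by (intro continuous_intros)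

lemma wave_tendsto: "(wave \<kappa> z P M \<longlongrightarrow> wave \<kappa> z P M x) (at x within S)"
  using wave_continuous[of UNIV \<kappa> z P M] by (auto simp: continuous_on_def intro: tendsto_within_subset)

text \<open>
  The functions \<open>(u' + \<i> \<kappa> u) e\<^sup>-\<^sup>\<i>\<^sup>\<kappa>\<^sup>x\<close> and \<open>(u' - \<i> \<kappa> u) e\<^sup>\<i>\<^sup>\<kappa>\<^sup>x\<close> have derivative \<open>0\<close>, hence are constant; \<open>u\<close>
  and \<open>u'\<close> are combinations of the two.
\<close>

lemma helmholtz_eq_wave:
  assumes C: "convex C" and \<kappa>: "\<kappa> \<noteq> 0" and u: "helmholtz_on C \<kappa> u"
  obtains P M where "\<And>x. x \<in> C \<Longrightarrow> u x = wave \<kappa> z P M x"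
    "\<And>x. x \<in> C \<Longrightarrow> dx u x = wave \<kappa> z (\<i> * \<kappa> * P) (- (\<i> * \<kappa> * M)) x"
proof -
  have u': "(u has_vector_derivative dx u x) (at x within C)"
    and u'': "(dx u has_vector_derivative - (\<kappa>\<^sup>2 * u x)) (at x within C)" if "x \<in> C" for x
  proof -
    have "u differentiable (at x)" "dx u differentiable (at x)" "dx (dx u) x + \<kappa>\<^sup>2 * u x = 0"
      using u that by (auto simp: helmholtz_on_def)
    then have "(u has_vector_derivative dx u x) (at x)" "(dx u has_vector_derivative dx (dx u) x) (at x)"
      "dx (dx u) x = - (\<kappa>\<^sup>2 * u x)"
      by (simp_all add: vector_derivative_works eq_neg_iff_add_eq_0)
    then show "(u has_vector_derivative dx u x) (at x within C)"
      "(dx u has_vector_derivative - (\<kappa>\<^sup>2 * u x)) (at x within C)"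
      by (auto intro: has_vector_derivative_at_within)
  qed
  have const: "\<exists>c. \<forall>x\<in>C. (dx u x + s * u x) * wave s' z 1 0 x = c"
    if s: "s\<^sup>2 = - \<kappa>\<^sup>2" "\<i> * s' = - s" for s s' :: complex
  proof -
    have "((\<lambda>x. (dx u x + s * u x) * wave s' z 1 0 x) has_vector_derivative 0) (at x within C)" if "x \<in> C" for x
    proof -
      have "((\<lambda>x. (dx u x + s * u x) * wave s' z 1 0 x) has_vector_derivative
         ((dx u x + s * u x) * wave s' z (\<i> * s' * 1) (- (\<i> * s' * 0)) x
           + (- (\<kappa>\<^sup>2 * u x) + s * dx u x) * wave s' z 1 0 x)) (at x within C)"
        by (intro has_vector_derivative_mult has_vector_derivative_add
             has_vector_derivative_mult_right u'[OF that] u''[OF that] wave_deriv)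
      moreover have "(dx u x + s * u x) * wave s' z (\<i> * s' * 1) (- (\<i> * s' * 0)) x
           + (- (\<kappa>\<^sup>2 * u x) + s * dx u x) * wave s' z 1 0 x = 0"
      proof -
        have ss: "s * (s * w) = - (\<kappa> * (\<kappa> * w))" for w
          using s(1) by (metis mult.assoc mult_minus_left power2_eq_square)
        show ?thesis using s(2) by (simp add: ss wave_def algebra_simps power2_eq_square)
      qed
      ultimately show ?thesis by simp
    qed
    from has_vector_derivative_zero_constant[OF C this] show ?thesis by metis
  qed
  obtain c where c: "\<And>x. x \<in> C \<Longrightarrow> (dx u x + \<i> * \<kappa> * u x) * wave (-\<kappa>) z 1 0 x = c"
    using const[of "\<i> * \<kappa>" "-\<kappa>"] by (auto simp: power_mult_distrib)
  obtain d where d: "\<And>x. x \<in> C \<Longrightarrow> (dx u x + - (\<i> * \<kappa>) * u x) * wave \<kappa> z 1 0 x = d"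
    using const[of "- (\<i> * \<kappa>)" "\<kappa>"] by (auto simp: power_mult_distrib)
  have inv: "wave \<kappa> z 1 0 x * wave (-\<kappa>) z 1 0 x = 1" for x
    by (simp add: wave_def flip: exp_add)
  have 1: "dx u x + \<i> * \<kappa> * u x = c * wave \<kappa> z 1 0 x" if "x \<in> C" for x
  proof -
    have "dx u x + \<i> * \<kappa> * u x = ((dx u x + \<i> * \<kappa> * u x) * wave (-\<kappa>) z 1 0 x) * wave \<kappa> z 1 0 x"
      using inv[of x] by (simp add: mult_ac)
    then show ?thesis unfolding c[OF that] .
  qed
  have 2: "dx u x - \<i> * \<kappa> * u x = d * wave (-\<kappa>) z 1 0 x" if "x \<in> C" for x
  proof -
    have "dx u x - \<i> * \<kappa> * u x = ((dx u x + - (\<i> * \<kappa>) * u x) * wave \<kappa> z 1 0 x) * wave (-\<kappa>) z 1 0 x"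
      using inv[of x] by (simp add: mult_ac)
    then show ?thesis unfolding d[OF that] .
  qed
  have w: "wave \<kappa> z P M x = P * wave \<kappa> z 1 0 x + M * wave (-\<kappa>) z 1 0 x" for P M x
    by (simp add: wave_def)
  show ?thesis
  proof (rule that[of "c / (2 * \<i> * \<kappa>)" "- d / (2 * \<i> * \<kappa>)"])
    fix x assume "x \<in> C"
    have "2 * \<i> * \<kappa> * u x = (dx u x + \<i> * \<kappa> * u x) - (dx u x - \<i> * \<kappa> * u x)" by simp
    also have "\<dots> = c * wave \<kappa> z 1 0 x - d * wave (-\<kappa>) z 1 0 x" unfolding 1[OF \<open>x \<in> C\<close>] 2[OF \<open>x \<in> C\<close>] ..
    finally show "u x = wave \<kappa> z (c / (2 * \<i> * \<kappa>)) (- d / (2 * \<i> * \<kappa>)) x"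
      using \<kappa> by (subst w) (simp add: field_simps)
    have "2 * dx u x = (dx u x + \<i> * \<kappa> * u x) + (dx u x - \<i> * \<kappa> * u x)" by simp
    also have "\<dots> = c * wave \<kappa> z 1 0 x + d * wave (-\<kappa>) z 1 0 x" unfolding 1[OF \<open>x \<in> C\<close>] 2[OF \<open>x \<in> C\<close>] ..
    finally show "dx u x = wave \<kappa> z (\<i> * \<kappa> * (c / (2 * \<i> * \<kappa>))) (- (\<i> * \<kappa> * (- d / (2 * \<i> * \<kappa>)))) x"
      using \<kappa> by (subst w) (simp add: field_simps)
  qed
qed

lemma
  assumes C: "open C" "x \<in> C" and u: "\<And>x. x \<in> C \<Longrightarrow> u x = wave \<kappa> z P M x"
  shows dx_of_wave: "dx u x = wave \<kappa> z (\<i> * \<kappa> * P) (- (\<i> * \<kappa> * M)) x"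
    and differentiable_of_wave: "u differentiable (at x)"
proof -
  have "(u has_vector_derivative wave \<kappa> z (\<i> * \<kappa> * P) (- (\<i> * \<kappa> * M)) x) (at x)"
    by (rule has_vector_derivative_transform_within_open[OF wave_deriv C]) (simp add: u)
  then show "dx u x = wave \<kappa> z (\<i> * \<kappa> * P) (- (\<i> * \<kappa> * M)) x" "u differentiable (at x)"
    by (auto simp: vector_derivative_at differentiableI_vector)
qed

lemma helmholtz_on_of_wave:
  assumes C: "open C" and u: "\<And>x. x \<in> C \<Longrightarrow> u x = wave \<kappa> z P M x"
  shows "helmholtz_on C \<kappa> u"
  unfolding helmholtz_on_def
proof
  fix x assume x: "x \<in> C"
  have d: "dx u x = wave \<kappa> z (\<i> * \<kappa> * P) (- (\<i> * \<kappa> * M)) x" if "x \<in> C" for x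
    using dx_of_wave[OF C that u] .
  have "dx (dx u) x = wave \<kappa> z (\<i> * \<kappa> * (\<i> * \<kappa> * P)) (- (\<i> * \<kappa> * (- (\<i> * \<kappa> * M)))) x"
    using dx_of_wave[OF C x d] .
  moreover have "wave \<kappa> z (\<i> * \<kappa> * (\<i> * \<kappa> * P)) (- (\<i> * \<kappa> * (- (\<i> * \<kappa> * M)))) x = - (\<kappa>\<^sup>2 * wave \<kappa> z P M x)"
    by (simp add: wave_def algebra_simps power2_eq_square)
  ultimately have "dx (dx u) x + \<kappa>\<^sup>2 * u x = 0" by (simp add: u[OF x])
  then show "u differentiable at x \<and> dx u differentiable at x \<and> dx (dx u) x + \<kappa>\<^sup>2 * u x = 0"
    using differentiable_of_wave[OF C x u] differentiable_of_wave[OF C x d] by blast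
qed

text \<open>
  Entering a resonator multiplies the difference of the two amplitudes by \<open>\<sigma>\<close>. The waves \<open>P\<close>, \<open>M\<close> before the interface go right and
  left, as do \<open>p\<close>, \<open>m\<close> behind it.
\<close>

lemma interface_in:
  fixes \<sigma> :: complex
  assumes "1 + \<sigma> \<noteq> 0"
  defines "\<rho> \<equiv> (1 - \<sigma>) / (1 + \<sigma>)"
  shows "p + m = P + M \<and> p - m = \<sigma> * (P - M) \<longleftrightarrow>
     m = (1 + \<sigma>) / 2 * (M + \<rho> * P) \<and> p = (1 + \<sigma>) / 2 * (P + \<rho> * M)"
proof -
  have \<rho>: "(1 + \<sigma>) / 2 * (x + \<rho> * y) = ((1 + \<sigma>) * x + (1 - \<sigma>) * y) / 2" for x y
  proof -
    have r: "(1 + \<sigma>) * \<rho> = 1 - \<sigma>" using assms by simp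
    have "(1 + \<sigma>) / 2 * (x + \<rho> * y) = ((1 + \<sigma>) * x + ((1 + \<sigma>) * \<rho>) * y) / 2"
      by (simp add: algebra_simps add_divide_distrib)
    then show ?thesis unfolding r .
  qed
  have "p + m = P + M \<and> p - m = \<sigma> * (P - M) \<longleftrightarrow>
     2 * m = (1 + \<sigma>) * M + (1 - \<sigma>) * P \<and> 2 * p = (1 + \<sigma>) * P + (1 - \<sigma>) * M"
    by algebra
  then show ?thesis unfolding \<rho> by (auto simp: field_simps)
qed

text \<open>
  Leaving a resonator is entering one with \<open>\<sigma>\<close> inverted, which changes the sign of \<open>\<rho>\<close>.
\<close>

lemma interface_out:
  fixes \<sigma> :: complex
  assumes "1 + \<sigma> \<noteq> 0" "\<sigma> \<noteq> 0"
  defines "\<rho> \<equiv> (1 - \<sigma>) / (1 + \<sigma>)"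
  shows "p + m = P + M \<and> P - M = \<sigma> * (p - m) \<longleftrightarrow>
     m = (1 + 1 / \<sigma>) / 2 * (M - \<rho> * P) \<and> p = (1 + 1 / \<sigma>) / 2 * (P - \<rho> * M)"
proof -
  have "1 + 1 / \<sigma> = (1 + \<sigma>) / \<sigma>" "1 - 1 / \<sigma> = - (1 - \<sigma>) / \<sigma>" using assms by (auto simp: field_simps)
  then have "1 + 1 / \<sigma> \<noteq> 0" and \<rho>: "(1 - 1 / \<sigma>) / (1 + 1 / \<sigma>) = - \<rho>"
    using assms(1,2) by (simp_all add: \<rho>_def) (metis minus_diff_eq minus_divide_left)
  have "P - M = \<sigma> * (p - m) \<longleftrightarrow> p - m = 1 / \<sigma> * (P - M)"
    using assms by (auto simp: field_simps)
  then show ?thesis using interface_in[OF \<open>1 + 1 / \<sigma> \<noteq> 0\<close>, of p m P M] unfolding \<rho> by simp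
qed

section \<open>The chambers of the scatterer\<close>

lemma closure_finite_UN: "finite I \<Longrightarrow> closure (\<Union>i\<in>I. f i) = (\<Union>i\<in>I. closure (f i))"
  by (induction I rule: finite_induct) (auto simp: closure_Un)

locale scatterer =
  fixes N :: nat and xm xp :: "nat \<Rightarrow> real" and v vb :: real
  assumes N: "N \<ge> 1"
    and intervals: "\<forall>j\<in>{1..N}. xm j < xp j"
    and gaps: "\<forall>j\<in>{1..<N}. xp j < xm (Suc j)"
    and speeds: "v > 0" "vb > 0"
begin

text \<open>
  The interfaces from left to right, \<open>y 1 < \<dots> < y (2N)\<close>.
\<close>

definition y :: "nat \<Rightarrow> real" where
  "y j = (if odd j then xm (Suc j div 2) else xp (j div 2))"

definition kap :: "complex \<Rightarrow> nat \<Rightarrow> complex" where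
  "kap k j = (if odd j then of_real (v / vb) * k else k)"

abbreviation t :: "nat \<Rightarrow> real" where "t \<equiv> tvec xm xp (v / vb)"

text \<open>
  Chamber \<open>j\<close> lies between \<open>y j\<close> and \<open>y (j + 1)\<close>; it is a resonator for odd \<open>j\<close> and unbounded for
  \<open>j = 0\<close> and \<open>j = 2N\<close>.
\<close>

definition chamber :: "nat \<Rightarrow> real set" where
  "chamber j = {x. (0 < j \<longrightarrow> y j < x) \<and> (j < 2 * N \<longrightarrow> x < y (Suc j))}"

text \<open>
  The optical length of a chamber. For \<open>j = 2N\<close> it involves the values of \<open>xm\<close> beyond the last resonator; they
  only fix the phase origin of the wave in the right exterior.
\<close>

lemma kap_t: "j > 0 \<Longrightarrow> kap k j * of_real (y (Suc j) - y j) = of_real (t j) * k"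
  by (auto simp: kap_def y_def tvec_def)

lemma y_Suc_less: "1 \<le> j \<Longrightarrow> j < 2 * N \<Longrightarrow> y j < y (Suc j)"
proof -
  assume j: "1 \<le> j" "j < 2 * N"
  show ?thesis
  proof (cases "odd j")
    case True
    then have "Suc j div 2 \<in> {1..N}" using j by (auto elim!: oddE)
    then show ?thesis using intervals True by (simp add: y_def)
  next
    case False
    then have "j div 2 \<in> {1..<N}" "Suc (Suc j) div 2 = Suc (j div 2)" using j by (auto elim!: evenE)
    then show ?thesis using gaps False by (simp add: y_def)
  qed
qed

lemma y_less: "1 \<le> i \<Longrightarrow> i < j \<Longrightarrow> j \<le> 2 * N \<Longrightarrow> y i < y j"
proof (induction j)
  case (Suc j)
  then show ?case
  proof (cases "i = j")
    case False
    then have "y i < y j" using Suc by simp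
    also have "y j < y (Suc j)" using Suc by (intro y_Suc_less) auto
    finally show ?thesis .
  qed (auto intro: y_Suc_less)
qed simp

lemma y_mono: "1 \<le> i \<Longrightarrow> i \<le> j \<Longrightarrow> j \<le> 2 * N \<Longrightarrow> y i \<le> y j"
  using y_less[of i j] by (cases "i = j") auto

lemma t_pos: "j \<in> {1..2*N-1} \<Longrightarrow> t j > 0"
proof -
  assume j: "j \<in> {1..2*N-1}"
  then have "y j < y (Suc j)" by (intro y_Suc_less) auto
  then show ?thesis using speeds by (auto simp: y_def tvec_def)
qed

text \<open>
  The number of the chamber that contains \<open>x\<close>, provided that \<open>x\<close> is not an interface.
\<close>

definition idx :: "real \<Rightarrow> nat" where
  "idx x = Max (insert 0 {i\<in>{1..2*N}. y i \<le> x})"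

lemma le_idx_iff: "i \<in> {1..2*N} \<Longrightarrow> i \<le> idx x \<longleftrightarrow> y i \<le> x"
proof -
  assume i: "i \<in> {1..2*N}"
  let ?S = "insert 0 {i\<in>{1..2*N}. y i \<le> x}"
  have fin: "finite ?S" by simp
  have "idx x \<in> ?S" unfolding idx_def by (rule Max_in) auto
  moreover have "i \<le> idx x" if "y i \<le> x" unfolding idx_def using that i by (intro Max_ge) auto
  ultimately show ?thesis using i y_mono[of i "idx x"] by force
qed

lemma idx_le: "idx x \<le> 2 * N"
proof -
  have "idx x \<in> insert 0 {i\<in>{1..2*N}. y i \<le> x}" unfolding idx_def by (rule Max_in) auto
  then show ?thesis by auto
qed

lemma in_chamber_idx: "x \<notin> y ` {1..2*N} \<Longrightarrow> x \<in> chamber (idx x)"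
proof -
  assume x: "x \<notin> y ` {1..2*N}"
  have "y (idx x) < x" if "0 < idx x"
  proof -
    have i: "idx x \<in> {1..2*N}" using that idx_le[of x] by simp
    then have "y (idx x) \<le> x" using le_idx_iff[OF i, of x] by simp
    moreover have "y (idx x) \<noteq> x" using x i by (metis imageI)
    ultimately show ?thesis by simp
  qed
  moreover have "x < y (Suc (idx x))" if "idx x < 2 * N"
    using le_idx_iff[of "Suc (idx x)" x] that by simp
  ultimately show ?thesis by (simp add: chamber_def)
qed

lemma idx_chamber: 
  assumes "x \<in> chamber j" "j \<le> 2 * N"
  shows "idx x = j" "x \<notin> y ` {1..2*N}"
proof -
  have *: "y i < x \<and> i \<le> j \<or> x < y i \<and> j < i" if i: "i \<in> {1..2*N}" for i
    using assms i y_mono[of i j] y_mono[of "Suc j" i] by (cases "i \<le> j") (auto simp: chamber_def)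
  then show "x \<notin> y ` {1..2*N}" by force
  have "i \<le> idx x \<longleftrightarrow> i \<le> j" if "i \<in> {1..2*N}" for i
    using le_idx_iff[OF that, of x] *[OF that] by auto
  from this[of j] this[of "idx x"] show "idx x = j"
    using assms(2) idx_le[of x] by (cases "j = 0"; cases "idx x = 0") auto
qed

lemma chamber_open: "open (chamber j)"
proof -
  have "open {x. y j < x}" "open {x. x < y (Suc j)}"
    by (auto intro: open_Collect_less continuous_intros)
  then show ?thesis unfolding chamber_def
    by (cases "0 < j"; cases "j < 2 * N") (auto simp: Collect_conj_eq)
qed

lemma chamber_convex: "convex (chamber j)"
proof -
  have "chamber j = (if 0 < j then {y j<..} else UNIV) \<inter> (if j < 2 * N then {..<y (Suc j)} else UNIV)"
    by (auto simp: chamber_def)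
  then show ?thesis by (simp add: convex_Int)
qed

lemma odd_chamber: "m \<in> {1..N} \<Longrightarrow> chamber (2 * m - 1) = {xm m<..<xp m}"
proof -
  assume m: "m \<in> {1..N}"
  then have "Suc (2 * m - 1) = 2 * m" "odd (2 * m - 1)" "2 * m - 1 < 2 * N" "0 < 2 * m - 1" by auto
  then show ?thesis by (auto simp: chamber_def y_def)
qed

lemma resonators_eq: "resonators N xm xp = (\<Union>j\<in>{j. j \<le> 2 * N \<and> odd j}. chamber j)"
proof -
  have "{j. j \<le> 2 * N \<and> odd j} = (\<lambda>m. 2 * m - 1) ` {1..N}"
  proof (intro equalityI subsetI)
    fix j assume "j \<in> {j. j \<le> 2 * N \<and> odd j}"
    then show "j \<in> (\<lambda>m. 2 * m - 1) ` {1..N}"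
      by (intro image_eqI[of _ _ "Suc j div 2"]) (auto elim!: oddE)
  qed auto
  then show ?thesis unfolding resonators_def using odd_chamber by simp
qed

lemma closure_resonators: "closure (resonators N xm xp) = (\<Union>m\<in>{1..N}. {xm m..xp m})"
proof -
  have "closure {xm m<..<xp m} = {xm m..xp m}" if "m \<in> {1..N}" for m
    using intervals that by simp
  then show ?thesis
    unfolding resonators_def closure_finite_UN[OF finite_atLeastAtMost] by (rule SUP_cong[OF refl])
qed

lemma outside_eq: "- closure (resonators N xm xp) = (\<Union>j\<in>{j. j \<le> 2 * N \<and> even j}. chamber j)"
proof (intro equalityI subsetI)
  fix x assume x: "x \<in> - closure (resonators N xm xp)"
  have "x \<noteq> y i" if "i \<in> {1..2*N}" for i
  proof
    assume "x = y i"
    moreover have "(i + 1) div 2 \<in> {1..N}" using that by auto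
    ultimately have "x \<in> {xm ((i + 1) div 2)..xp ((i + 1) div 2)}"
      using intervals by (auto simp: y_def elim!: evenE oddE intro!: less_imp_le)
    then show False using x \<open>(i + 1) div 2 \<in> {1..N}\<close> unfolding closure_resonators by blast
  qed
  then have "x \<in> chamber (idx x)" by (intro in_chamber_idx) blast
  moreover have "even (idx x)"
    using x closure_subset[of "resonators N xm xp"] \<open>x \<in> chamber (idx x)\<close> idx_le[of x]
    unfolding resonators_eq by blast
  ultimately show "x \<in> (\<Union>j\<in>{j. j \<le> 2 * N \<and> even j}. chamber j)" using idx_le by blast
next
  fix x assume "x \<in> (\<Union>j\<in>{j. j \<le> 2 * N \<and> even j}. chamber j)"
  then obtain j where j: "j \<le> 2 * N" "even j" "x \<in> chamber j" by blast
  note id = idx_chamber[OF j(3,1)]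
  have no: False if m: "m \<in> {1..N}" "xm m \<le> x" "x \<le> xp m" for m
  proof -
    have ym: "y (2 * m - 1) = xm m" "y (2 * m) = xp m" using m by (auto simp: y_def)
    have in1: "2 * m - 1 \<in> {1..2*N}" and in2: "2 * m \<in> {1..2*N}" using m by auto
    have "2 * m - 1 \<le> j" using le_idx_iff[OF in1, of x] m ym id(1) by simp
    moreover have "x \<noteq> y (2 * m)" using id(2) in2 by blast
    then have "\<not> 2 * m \<le> j" using le_idx_iff[OF in2, of x] m ym id(1) by simp
    ultimately have "j = 2 * m - 1" by simp
    then show False using j(2) m by simp
  qed
  have "x \<notin> (\<Union>m\<in>{1..N}. {xm m..xp m})"
  proof
    assume "x \<in> (\<Union>m\<in>{1..N}. {xm m..xp m})"
    then obtain m where "m \<in> {1..N}" "xm m \<le> x" "x \<le> xp m" by (elim UN_E) simp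
    then show False by (rule no)
  qed
  then show "x \<in> - closure (resonators N xm xp)" unfolding closure_resonators by simp
qed

end

section \<open>Resonances are the zeros of the resonance function\<close>

context scatterer begin

text \<open>
  The interface conditions at \<open>y (i + 1)\<close>, in the coefficients \<open>P\<close>, \<open>M\<close> of the right- and left-going waves.
  Chamber \<open>j\<close> has its phase origin at its right end \<open>y (j + 1)\<close>, hence the phase \<open>e\<close> at the left end of
  chamber \<open>i + 1\<close>. For even \<open>i\<close> the interface is crossed into a resonator.
\<close>

definition joint :: "complex \<Rightarrow> complex \<Rightarrow> (nat \<Rightarrow> complex) \<Rightarrow> (nat \<Rightarrow> complex) \<Rightarrow> nat \<Rightarrow> bool" where
  "joint k \<delta> P M i \<longleftrightarrow>
     (let e = exp (\<i> * of_real (t (Suc i)) * k); p = P (Suc i) / e; m = M (Suc i) * e in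
       p + m = P i + M i \<and>
       (if even i then kap k (Suc i) * (p - m) = \<delta> * (kap k i * (P i - M i))
        else kap k i * (P i - M i) = \<delta> * (kap k (Suc i) * (p - m))))"

lemma wave_right_end: "wave \<kappa> z P M z = P + M"
  by (simp add: wave_def)

lemma wave_left_end:
  assumes "j > 0"
  shows "wave (kap k j) (y (Suc j)) P M (y j) = P / exp (\<i> * of_real (t j) * k) + M * exp (\<i> * of_real (t j) * k)"
proof -
  have "\<i> * kap k j * of_real (y j - y (Suc j)) = - (\<i> * (kap k j * of_real (y (Suc j) - y j)))"
    by (simp add: algebra_simps)
  also have "\<dots> = - (\<i> * of_real (t j) * k)" unfolding kap_t[OF assms] by simp
  finally show ?thesis unfolding wave_def by (simp add: exp_minus divide_inverse)
qed

text \<open>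
  The common factor of the two amplitudes that is left after each interface matrix is normalised to have
  diagonal entries \<open>1\<close>.
\<close>

fun gain :: "complex \<Rightarrow> nat \<Rightarrow> complex" where
  "gain \<sigma> 0 = 1"
| "gain \<sigma> (Suc i) = gain \<sigma> i * (if even i then (1 + \<sigma>) / 2 else (1 + 1 / \<sigma>) / 2)"

lemma gain_nonzero: "1 + \<sigma> \<noteq> 0 \<Longrightarrow> \<sigma> \<noteq> 0 \<Longrightarrow> gain \<sigma> i \<noteq> 0"
proof (induction i)
  case (Suc i)
  have "1 + 1 / \<sigma> = (1 + \<sigma>) / \<sigma>" using Suc by (simp add: field_simps)
  then show ?case using Suc by auto
qed simp

lemma joint_iff:
  assumes k: "k \<noteq> 0" and \<sigma>: "1 + \<sigma> \<noteq> 0" "\<sigma> \<noteq> 0" and \<delta>: "\<delta> = \<sigma> * of_real (v / vb)"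
  defines "\<rho> \<equiv> (1 - \<sigma>) / (1 + \<sigma>)"
  defines "g \<equiv> (\<lambda>i::nat. if even i then (1 + \<sigma>) / 2 else (1 + 1 / \<sigma>) / 2)"
  shows "joint k \<delta> P M i \<longleftrightarrow>
     M (Suc i) = exp (- (\<i> * of_real (t (Suc i)) * k)) * (g i * (M i + (-1) ^ i * \<rho> * P i)) \<and>
     P (Suc i) = exp (\<i> * of_real (t (Suc i)) * k) * (g i * (P i + (-1) ^ i * \<rho> * M i))"
proof -
  define e where "e = exp (\<i> * of_real (t (Suc i)) * k)"
  have e: "e \<noteq> 0" "exp (- (\<i> * of_real (t (Suc i)) * k)) = 1 / e"
    by (simp_all add: e_def exp_minus divide_inverse)
  define p where "p = P (Suc i) / e"
  define m where "m = M (Suc i) * e"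
  have r: "of_real (v / vb) \<noteq> (0::complex)" using speeds by simp
  have "joint k \<delta> P M i \<longleftrightarrow> p + m = P i + M i \<and>
     (if even i then p - m = \<sigma> * (P i - M i) else P i - M i = \<sigma> * (p - m))"
    using k r unfolding joint_def Let_def e_def[symmetric] p_def[symmetric] m_def[symmetric] \<delta>
    by (auto simp: kap_def mult_ac)
  also have "\<dots> \<longleftrightarrow> m = g i * (M i + (-1) ^ i * \<rho> * P i) \<and> p = g i * (P i + (-1) ^ i * \<rho> * M i)"
    using interface_in[OF \<sigma>(1), of p m "P i" "M i", folded \<rho>_def]
      interface_out[OF \<sigma>, of p m "P i" "M i", folded \<rho>_def]
    by (cases "even i") (simp_all add: g_def)
  also have "\<dots> \<longleftrightarrow> M (Suc i) = 1 / e * (g i * (M i + (-1) ^ i * \<rho> * P i)) \<and>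
     P (Suc i) = e * (g i * (P i + (-1) ^ i * \<rho> * M i))"
    unfolding p_def m_def using e(1) by (auto simp: field_simps)
  finally show ?thesis unfolding e(2) e_def[symmetric] .
qed

text \<open>
  The interface conditions determine the coefficients of chamber \<open>i + 1\<close> from those of chamber \<open>i\<close>, by the
  recursion of \<open>amp\<close>; \<open>P 0 = 0\<close> is the radiation condition on the left.
\<close>

lemma joints_iff:
  assumes k: "k \<noteq> 0" and \<sigma>: "1 + \<sigma> \<noteq> 0" "\<sigma> \<noteq> 0" and \<delta>: "\<delta> = \<sigma> * of_real (v / vb)"
  defines "\<rho> \<equiv> (1 - \<sigma>) / (1 + \<sigma>)"
  shows "P 0 = 0 \<and> (\<forall>i<n. joint k \<delta> P M i) \<longleftrightarrow>
     (\<forall>i\<le>n. M i = M 0 * (gain \<sigma> i * amp t \<rho> k i (-1)) \<and> P i = - (M 0 * (gain \<sigma> i * amp t \<rho> k i 1)))"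
proof (induction n)
  case 0
  show ?case by auto
next
  case (Suc n)
  have less: "(\<forall>i<Suc n. Q i) \<longleftrightarrow> (\<forall>i<n. Q i) \<and> Q n" for Q :: "nat \<Rightarrow> bool" by (auto simp: less_Suc_eq)
  have le: "(\<forall>i\<le>Suc n. Q i) \<longleftrightarrow> (\<forall>i\<le>n. Q i) \<and> Q (Suc n)" for Q :: "nat \<Rightarrow> bool" by (auto simp: le_Suc_eq)
  have step: "joint k \<delta> P M n \<longleftrightarrow>
     M (Suc n) = M 0 * (gain \<sigma> (Suc n) * amp t \<rho> k (Suc n) (-1)) \<and>
     P (Suc n) = - (M 0 * (gain \<sigma> (Suc n) * amp t \<rho> k (Suc n) 1))"
    if "M n = M 0 * (gain \<sigma> n * amp t \<rho> k n (-1))" "P n = - (M 0 * (gain \<sigma> n * amp t \<rho> k n 1))"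
    unfolding joint_iff[OF k \<sigma> \<delta>] that \<rho>_def[symmetric] by (simp add: algebra_simps)
  show ?case unfolding less le using Suc.IH step by blast
qed

lemma near_right: "i < 2 * N \<Longrightarrow> \<forall>\<^sub>F x in at_right (y (Suc i)). x \<in> chamber (Suc i)"
  unfolding eventually_at_right_field using y_Suc_less[of "Suc i"]
  by (intro exI[of _ "if Suc i < 2 * N then y (Suc (Suc i)) else y (Suc i) + 1"]) (auto simp: chamber_def)

lemma near_left: "i < 2 * N \<Longrightarrow> \<forall>\<^sub>F x in at_left (y (Suc i)). x \<in> chamber i"
  unfolding eventually_at_left_field using y_Suc_less[of i]
  by (intro exI[of _ "if 0 < i then y i else y (Suc i) - 1"]) (auto simp: chamber_def)

lemma right_limit:
  assumes "i < 2 * N" "\<And>x. x \<in> chamber (Suc i) \<Longrightarrow> f x = wave \<kappa> z P M x"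
  shows "(f \<longlongrightarrow> wave \<kappa> z P M (y (Suc i))) (at_right (y (Suc i)))"
  by (rule Lim_transform_eventually[OF wave_tendsto])
     (use near_right[OF assms(1)] assms(2) in \<open>auto elim: eventually_mono\<close>)

lemma left_limit:
  assumes "i < 2 * N" "\<And>x. x \<in> chamber i \<Longrightarrow> f x = wave \<kappa> z P M x"
  shows "(f \<longlongrightarrow> wave \<kappa> z P M (y (Suc i))) (at_left (y (Suc i)))"
  by (rule Lim_transform_eventually[OF wave_tendsto])
     (use near_left[OF assms(1)] assms(2) in \<open>auto elim: eventually_mono\<close>)

lemma interface_cases:
  assumes "i < 2 * N"
  obtains m where "m \<in> {1..N}" "even i" "y (Suc i) = xm m" | m where "m \<in> {1..N}" "odd i" "y (Suc i) = xp m"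
proof (cases "even i")
  case True
  then have "Suc (Suc i) div 2 \<in> {1..N}" "y (Suc i) = xm (Suc (Suc i) div 2)"
    using assms by (auto simp: y_def elim!: evenE)
  then show ?thesis using True that(1) by blast
next
  case False
  then have "Suc i div 2 \<in> {1..N}" "y (Suc i) = xp (Suc i div 2)"
    using assms by (auto simp: y_def elim!: oddE)
  then show ?thesis using False that(2) by blast
qed

lemma interface_index:
  assumes "m \<in> {1..N}"
  obtains i i' where "i < 2 * N" "even i" "y (Suc i) = xm m" "i' < 2 * N" "odd i'" "y (Suc i') = xp m"
proof -
  from assms obtain m' where m: "m = Suc m'" by (cases m) auto
  have "2 * m' < 2 * N" "even (2 * m')" "y (Suc (2 * m')) = xm m"
    "Suc (2 * m') < 2 * N" "odd (Suc (2 * m'))" "y (Suc (Suc (2 * m'))) = xp m"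
    using assms by (auto simp: y_def m)
  then show ?thesis by (rule that)
qed

lemma kap_chamber_0: "kap k 0 = k" and kap_chamber_last: "kap k (2 * N) = k"
  by (simp_all add: kap_def)

lemma chamber_0: "chamber 0 = {..<xm 1}" and chamber_last: "chamber (2 * N) = {xp N<..}"
  using N by (auto simp: chamber_def y_def)

lemma joint_iff_wave:
  assumes "i < 2 * N"
  shows "joint k \<delta> P M i \<longleftrightarrow>
     wave (kap k (Suc i)) (y (Suc (Suc i))) (P (Suc i)) (M (Suc i)) (y (Suc i))
       = wave (kap k i) (y (Suc i)) (P i) (M i) (y (Suc i)) \<and>
     (let a = wave (kap k (Suc i)) (y (Suc (Suc i))) (\<i> * kap k (Suc i) * P (Suc i)) (- (\<i> * kap k (Suc i) * M (Suc i))) (y (Suc i));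
          b = wave (kap k i) (y (Suc i)) (\<i> * kap k i * P i) (- (\<i> * kap k i * M i)) (y (Suc i)) in
      if even i then a = \<delta> * b else b = \<delta> * a)"
proof -
  have pull: "\<i> * c * x / e + - (\<i> * c * z) * e = \<i> * (c * (x / e - z * e))"
    "\<i> * c * x + - (\<i> * c * z) = \<i> * (c * (x - z))" for c x z e :: complex
    by (simp_all add: algebra_simps)
  have canc: "\<i> * x = \<delta> * (\<i> * z) \<longleftrightarrow> x = \<delta> * z" for x z by (simp add: mult.left_commute)
  show ?thesis
    unfolding joint_def Let_def wave_right_end wave_left_end[OF zero_less_Suc] pull canc ..
qed

text \<open>
  A solution is a wave in each chamber. Its one-sided limits at an interface are the boundary values of the
  two adjacent waves, because limits are unique.
\<close>

lemma coefficients_of_solution: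
  assumes \<omega>: "\<omega> \<noteq> 0" and u: "scattering_solution N xm xp v vb \<delta> \<omega> u"
  defines "k \<equiv> \<omega> / of_real v"
  obtains P M where
    "\<And>j x. j \<le> 2 * N \<Longrightarrow> x \<in> chamber j \<Longrightarrow> u x = wave (kap k j) (y (Suc j)) (P j) (M j) x"
    "\<And>i. i < 2 * N \<Longrightarrow> joint k \<delta> P M i" "P 0 = 0" "M (2 * N) = 0"
proof -
  have k: "k \<noteq> 0" using \<omega> speeds by (simp add: k_def)
  have kb: "\<omega> / of_real vb = of_real (v / vb) * k" using speeds by (simp add: k_def)
  note U = u[unfolded scattering_solution_def Let_def kb, folded k_def]
  have helm: "helmholtz_on (chamber j) (kap k j) u" if "j \<le> 2 * N" for j
  proof (cases "even j")
    case True
    then have "chamber j \<subseteq> - closure (resonators N xm xp)" unfolding outside_eq using that by blast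
    then show ?thesis using U True by (auto simp: helmholtz_on_def kap_def)
  next
    case False
    then have "chamber j \<subseteq> resonators N xm xp" unfolding resonators_eq using that by blast
    then show ?thesis using U False by (auto simp: helmholtz_on_def kap_def)
  qed
  have kap0: "kap k j \<noteq> 0" for j using k speeds by (simp add: kap_def)
  have "\<exists>P M. (\<forall>x\<in>chamber j. u x = wave (kap k j) (y (Suc j)) P M x) \<and>
     (\<forall>x\<in>chamber j. dx u x = wave (kap k j) (y (Suc j)) (\<i> * kap k j * P) (- (\<i> * kap k j * M)) x)"
    if "j \<le> 2 * N" for j
    by (rule helmholtz_eq_wave[OF chamber_convex kap0 helm[OF that], of "y (Suc j)"]) blast
  then obtain P M where
    u0: "\<And>j x. j \<le> 2 * N \<Longrightarrow> x \<in> chamber j \<Longrightarrow> u x = wave (kap k j) (y (Suc j)) (P j) (M j) x" and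
    u1: "\<And>j x. j \<le> 2 * N \<Longrightarrow> x \<in> chamber j \<Longrightarrow>
       dx u x = wave (kap k j) (y (Suc j)) (\<i> * kap k j * P j) (- (\<i> * kap k j * M j)) x"
    by metis
  have joint: "joint k \<delta> P M i" if i: "i < 2 * N" for i
  proof -
    have i': "Suc i \<le> 2 * N" "i \<le> 2 * N" using i by auto
    note lims = right_limit[OF i u0[OF i'(1)]] left_limit[OF i u0[OF i'(2)]]
      right_limit[OF i u1[OF i'(1)]] left_limit[OF i u1[OF i'(2)]]
    have nt: "at_right (y (Suc i)) \<noteq> bot" "at_left (y (Suc i)) \<noteq> bot"
      by (simp_all add: trivial_limit_at_right_real trivial_limit_at_left_real)
    note uniq = tendsto_unique[OF nt(1)] tendsto_unique[OF nt(2)]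
    have cont: "\<exists>c. (u \<longlongrightarrow> c) (at_right (y (Suc i))) \<and> (u \<longlongrightarrow> c) (at_left (y (Suc i)))"
      and flux: "\<exists>a b. (dx u \<longlongrightarrow> a) (at_right (y (Suc i))) \<and> (dx u \<longlongrightarrow> b) (at_left (y (Suc i))) \<and>
           (if even i then a = \<delta> * b else b = \<delta> * a)"
      using U by (cases rule: interface_cases[OF i]; force)+
    show ?thesis
      unfolding joint_iff_wave[OF i] Let_def
      using cont flux uniq(1)[OF _ lims(1)] uniq(2)[OF _ lims(2)] uniq(1)[OF _ lims(3)] uniq(2)[OF _ lims(4)]
      by metis
  qed
  have "P 0 = 0"
  proof -
    have x: "xm 1 - 1 \<in> chamber 0" by (simp add: chamber_0)
    have "- dx u (xm 1 - 1) - \<i> * k * u (xm 1 - 1) = 0" using U by simp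
    then have "2 * \<i> * k * P 0 * exp (\<i> * k * of_real (xm 1 - 1 - y 1)) = 0"
      unfolding u0[OF le0 x] u1[OF le0 x] by (simp add: wave_def kap_chamber_0 algebra_simps)
    then show ?thesis using k by simp
  qed
  moreover have "M (2 * N) = 0"
  proof -
    have x: "xp N + 1 \<in> chamber (2 * N)" by (simp add: chamber_last)
    have "dx u (xp N + 1) - \<i> * k * u (xp N + 1) = 0" using U by simp
    then have "2 * \<i> * k * M (2 * N) * exp (- (\<i> * k * of_real (xp N + 1 - y (Suc (2 * N))))) = 0"
      unfolding u0[OF order_refl x] u1[OF order_refl x] kap_chamber_last
      by (simp add: wave_def algebra_simps)
    then show ?thesis using k by simp
  qed
  ultimately show ?thesis using that[OF u0 joint] by blast
qed

text \<open>
  The solution is glued from the waves by \<open>idx\<close>. It is non-zero since there is only a left-going wave, of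
  amplitude \<open>M 0\<close>, in the left exterior.
\<close>

lemma solution_of_coefficients:
  fixes \<omega> :: complex
  defines "k \<equiv> \<omega> / of_real v"
  assumes joint: "\<And>i. i < 2 * N \<Longrightarrow> joint k \<delta> P M i" and P0: "P 0 = 0" and M: "M (2 * N) = 0" "M 0 \<noteq> 0"
  shows "resonant_frequency N xm xp v vb \<delta> \<omega>"
proof -
  have kb: "\<omega> / of_real vb = of_real (v / vb) * k" using speeds by (simp add: k_def)
  define u where "u x = wave (kap k (idx x)) (y (Suc (idx x))) (P (idx x)) (M (idx x)) x" for x
  have u0: "u x = wave (kap k j) (y (Suc j)) (P j) (M j) x" if "j \<le> 2 * N" "x \<in> chamber j" for j x
    unfolding u_def idx_chamber(1)[OF that(2,1)] ..
  have u1: "dx u x = wave (kap k j) (y (Suc j)) (\<i> * kap k j * P j) (- (\<i> * kap k j * M j)) x"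
    if "j \<le> 2 * N" "x \<in> chamber j" for j x
    by (rule dx_of_wave[OF chamber_open that(2) u0[OF that(1)]])
  have helm: "helmholtz_on (chamber j) (kap k j) u" if "j \<le> 2 * N" for j
    by (rule helmholtz_on_of_wave[OF chamber_open u0[OF that]])
  have helm_out: "helmholtz_on (- closure (resonators N xm xp)) k u"
    unfolding outside_eq helmholtz_on_def using helm by (fastforce simp: helmholtz_on_def kap_def)
  have helm_in: "helmholtz_on (resonators N xm xp) (of_real (v / vb) * k) u"
    unfolding resonators_eq helmholtz_on_def using helm by (fastforce simp: helmholtz_on_def kap_def)
  have cont: "\<exists>c. (u \<longlongrightarrow> c) (at_right (y (Suc i))) \<and> (u \<longlongrightarrow> c) (at_left (y (Suc i)))"
    and flux: "\<exists>a b. (dx u \<longlongrightarrow> a) (at_right (y (Suc i))) \<and> (dx u \<longlongrightarrow> b) (at_left (y (Suc i))) \<and>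
           (if even i then a = \<delta> * b else b = \<delta> * a)" if i: "i < 2 * N" for i
  proof -
    have i': "Suc i \<le> 2 * N" "i \<le> 2 * N" using i by auto
    note lims = right_limit[OF i u0[OF i'(1)]] left_limit[OF i u0[OF i'(2)]]
      right_limit[OF i u1[OF i'(1)]] left_limit[OF i u1[OF i'(2)]]
    note J = joint[OF i, unfolded joint_iff_wave[OF i] Let_def]
    show "\<exists>c. (u \<longlongrightarrow> c) (at_right (y (Suc i))) \<and> (u \<longlongrightarrow> c) (at_left (y (Suc i)))"
      using lims(1,2) J by metis
    show "\<exists>a b. (dx u \<longlongrightarrow> a) (at_right (y (Suc i))) \<and> (dx u \<longlongrightarrow> b) (at_left (y (Suc i))) \<and>
           (if even i then a = \<delta> * b else b = \<delta> * a)"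
      using lims(3,4) J by blast
  qed
  have "scattering_solution N xm xp v vb \<delta> \<omega> u"
    unfolding scattering_solution_def Let_def kb k_def[symmetric]
  proof (intro conjI ballI allI impI helm_out helm_in)
    fix m x assume m: "m \<in> {1..N}" and x: "x \<in> {xm m, xp m}"
    show "\<exists>c. (u \<longlongrightarrow> c) (at_right x) \<and> (u \<longlongrightarrow> c) (at_left x)"
      using interface_index[OF m] cont x by (metis insertE singletonD)
  next
    fix m assume m: "m \<in> {1..N}"
    obtain i i' where i: "i < 2 * N" "even i" "y (Suc i) = xm m" "i' < 2 * N" "odd i'" "y (Suc i') = xp m"
      by (rule interface_index[OF m])
    show "\<exists>a b. (dx u \<longlongrightarrow> a) (at_right (xm m)) \<and> (dx u \<longlongrightarrow> b) (at_left (xm m)) \<and> a = \<delta> * b"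
      using flux[OF i(1)] i(2,3) by simp
    show "\<exists>a b. (dx u \<longlongrightarrow> a) (at_right (xp m)) \<and> (dx u \<longlongrightarrow> b) (at_left (xp m)) \<and> b = \<delta> * a"
      using flux[OF i(4)] i(5,6) by simp
  next
    fix x assume "x < xm 1"
    then have x: "x \<in> chamber 0" by (simp add: chamber_0)
    show "- dx u x - \<i> * k * u x = 0"
      unfolding u0[OF le0 x] u1[OF le0 x] by (simp add: wave_def kap_chamber_0 P0)
  next
    fix x assume "x > xp N"
    then have x: "x \<in> chamber (2 * N)" by (simp add: chamber_last)
    show "dx u x - \<i> * k * u x = 0"
      unfolding u0[OF order_refl x] u1[OF order_refl x] by (simp add: wave_def kap_chamber_last M(1))
  qed
  moreover have "xm 1 - 1 \<in> chamber 0" by (simp add: chamber_0)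
  then have "u (xm 1 - 1) \<noteq> 0" "xm 1 - 1 \<in> - closure (resonators N xm xp)"
    using u0[of 0 "xm 1 - 1"] P0 M(2) unfolding outside_eq by (auto simp: wave_def)
  ultimately show ?thesis unfolding resonant_frequency_def by blast
qed

text \<open>
  The radiation condition on the right says \<open>M (2N) = 0\<close>, and \<open>amp t \<rho> k (2N) (-1)\<close> is \<open>f\<close> times a phase.
  A non-zero solution has \<open>M 0 \<noteq> 0\<close>, as all coefficients are multiples of \<open>M 0\<close>.
\<close>

theorem resonant_frequency_iff_zero:
  assumes \<omega>: "\<omega> \<noteq> 0" and \<sigma>: "1 + \<sigma> \<noteq> 0" "\<sigma> \<noteq> 0" and \<delta>: "\<delta> = \<sigma> * of_real (v / vb)"
  shows "resonant_frequency N xm xp v vb \<delta> \<omega> \<longleftrightarrow> res_fun N t \<sigma> (\<omega> / of_real v) = 0"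
proof -
  define k where "k = \<omega> / of_real v"
  define \<rho> where "\<rho> = (1 - \<sigma>) / (1 + \<sigma>)"
  have k: "k \<noteq> 0" using \<omega> speeds by (simp add: k_def)
  have SN: "2 * N = Suc (2 * N - 1)" using N by simp
  have "amp t \<rho> k (Suc j) (-1) = exp (- (\<i> * of_real (t (Suc j)) * k)) * (amp t \<rho> k j (-1) + \<rho> * amp t \<rho> k j 1)"
    if "odd j" for j using that by simp
  from this[of "2 * N - 1", folded SN] N
  have amp_zero: "amp t \<rho> k (2 * N) (-1) = 0 \<longleftrightarrow> res_fun N t \<sigma> k = 0"
    unfolding res_fun_eq_amp[OF N] \<rho>_def by simp
  note iff = joints_iff[OF k \<sigma> \<delta>, folded \<rho>_def]
  show ?thesis unfolding k_def[symmetric]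
  proof
    assume "resonant_frequency N xm xp v vb \<delta> \<omega>"
    then obtain u where u: "scattering_solution N xm xp v vb \<delta> \<omega> u"
      "\<exists>x\<in>resonators N xm xp \<union> - closure (resonators N xm xp). u x \<noteq> 0"
      unfolding resonant_frequency_def by blast
    obtain P M where PM:
      "\<And>j x. j \<le> 2 * N \<Longrightarrow> x \<in> chamber j \<Longrightarrow> u x = wave (kap k j) (y (Suc j)) (P j) (M j) x"
      "\<And>i. i < 2 * N \<Longrightarrow> joint k \<delta> P M i" "P 0 = 0" "M (2 * N) = 0"
      using coefficients_of_solution[OF \<omega> u(1), folded k_def] by metis
    have coeff: "M i = M 0 * (gain \<sigma> i * amp t \<rho> k i (-1))" "P i = - (M 0 * (gain \<sigma> i * amp t \<rho> k i 1))"
      if "i \<le> 2 * N" for i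
      using iff[of P "2 * N" M] PM(2,3) that by blast+
    from u(2) obtain j x where j: "j \<le> 2 * N" "x \<in> chamber j" "u x \<noteq> 0"
      unfolding outside_eq unfolding resonators_eq by blast
    have "M 0 \<noteq> 0"
    proof
      assume "M 0 = 0"
      then have "M j = 0" "P j = 0" using coeff[OF j(1)] by auto
      then show False using PM(1)[OF j(1,2)] j(3) by (simp add: wave_def)
    qed
    then have "amp t \<rho> k (2 * N) (-1) = 0"
      using coeff(1)[of "2 * N"] PM(4) gain_nonzero[OF \<sigma>] by auto
    then show "res_fun N t \<sigma> k = 0" unfolding amp_zero .
  next
    assume f: "res_fun N t \<sigma> k = 0"
    define M where "M i = gain \<sigma> i * amp t \<rho> k i (-1)" for i
    define P where "P i = - (gain \<sigma> i * amp t \<rho> k i 1)" for i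
    have M0: "M 0 = 1" by (simp add: M_def)
    have "P 0 = 0 \<and> (\<forall>i<2 * N. joint k \<delta> P M i)"
      unfolding iff M0 by (simp add: M_def P_def)
    moreover have "M (2 * N) = 0" using f amp_zero by (simp add: M_def)
    ultimately show "resonant_frequency N xm xp v vb \<delta> \<omega>"
      using M0 by (intro solution_of_coefficients[of \<omega> \<delta> P M, folded k_def]) auto
  qed
qed

end

section \<open>Resonances as Puiseux series\<close>

lemma sum_card_fibres:
  assumes "finite W" "\<And>i. i < n \<Longrightarrow> g i \<in> W"
  shows "(\<Sum>\<omega>\<in>W. card {i. i < n \<and> g i = \<omega>}) = n"
proof -
  have "(\<Sum>\<omega>\<in>W. \<Sum>i\<in>{i\<in>{..<n}. g i = \<omega>}. 1) = (\<Sum>i\<in>{..<n}. 1::nat)"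
    by (rule sum.group) (use assms in auto)
  then show ?thesis by simp
qed

lemma res_fun_holomorphic: "res_fun N t \<sigma> holomorphic_on UNIV"
  unfolding res_fun_def[abs_def] by (intro holomorphic_intros)

context scatterer begin

text \<open>
  Transports a listing of the zeros \<open>k\<close> of \<open>f\<close> to the resonances \<open>\<omega> = v k\<close>. The total multiplicity is \<open>n\<close>
  because each of the \<open>n\<close> listed values lies in \<open>W\<close>.
\<close>

lemma resonances_from_roots:
  fixes U :: "complex set"
  assumes F: "F = res_fun N t (\<delta> / of_real (v / vb))" and \<delta>: "\<delta> \<noteq> 0" "1 + \<delta> / of_real (v / vb) \<noteq> 0" and z: "z \<noteq> 0"
    and roots: "\<And>L. exp L = z \<Longrightarrow>
      (\<forall>i<n. h i (exp (of_real (s i) * L)) \<in> {k. of_real v * k \<in> U \<and> F k = 0}) \<and>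
      (\<forall>k\<in>{k. of_real v * k \<in> U \<and> F k = 0}. zorder F k = int (card {i. i < n \<and> h i (exp (of_real (s i) * L)) = k}))"
  defines "W \<equiv> nontrivial_resonances N xm xp v vb \<delta> \<inter> U"
    and "mu \<equiv> resonance_multiplicity N xm xp v vb \<delta>"
  shows "finite W \<and> (\<Sum>\<omega>\<in>W. mu \<omega>) = n \<and>
      (\<forall>C1 C2. zeros_in_strip N t (\<delta> / of_real (v / vb)) C1 C2 \<longrightarrow>
          (\<forall>\<omega>\<in>W. C1 < Im (\<omega> / of_real v) \<and> Im (\<omega> / of_real v) < C2)) \<and>
      branches_at n (\<lambda>i w. of_real v * h i w) s z W mu"
proof -
  have v: "of_real v \<noteq> (0::complex)" and r: "of_real (v / vb) \<noteq> (0::complex)" using speeds by auto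
  have F0: "F 0 \<noteq> 0" unfolding F using res_fun_at_0_nonzero[OF N] \<delta>(1) r by simp
  have W: "\<omega> \<in> W \<longleftrightarrow> \<omega> \<in> U \<and> F (\<omega> / of_real v) = 0" for \<omega>
  proof (cases "\<omega> = 0")
    case True
    then show ?thesis using F0 by (simp add: W_def nontrivial_resonances_def)
  next
    case False
    have "resonant_frequency N xm xp v vb \<delta> \<omega> \<longleftrightarrow> F (\<omega> / of_real v) = 0"
      unfolding F by (rule resonant_frequency_iff_zero[OF False \<delta>(2)]) (use \<delta>(1) r in auto)
    then show ?thesis using False by (auto simp: W_def nontrivial_resonances_def)
  qed
  have inW: "of_real v * h i (exp (of_real (s i) * L)) \<in> W" if "exp L = z" "i < n" for i L
    using roots[OF that(1)] that(2) v by (simp add: W)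
  have mu: "mu \<omega> = card {i. i < n \<and> of_real v * h i (exp (of_real (s i) * L)) = \<omega>}"
    if L: "exp L = z" and \<omega>: "\<omega> \<in> W" for L \<omega>
  proof -
    have "zorder F (\<omega> / of_real v) = int (card {i. i < n \<and> h i (exp (of_real (s i) * L)) = \<omega> / of_real v})"
      using roots[OF L] \<omega> v by (simp add: W)
    moreover have "mu \<omega> = nat (zorder F (\<omega> / of_real v))"
      by (simp add: mu_def resonance_multiplicity_def F)
    moreover have "h i x = \<omega> / of_real v \<longleftrightarrow> of_real v * h i x = \<omega>" for i x
      using v by (auto simp: field_simps)
    ultimately show ?thesis by simp
  qed
  have pos: "mu \<omega> > 0" if "\<omega> \<in> W" for \<omega>
    using zorder_pos_of_zero[OF res_fun_holomorphic F0[unfolded F]] that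
    by (simp add: W F mu_def resonance_multiplicity_def)
  \<comment> \<open>Cardinalities are computed along one fixed logarithm.\<close>
  have L: "exp (Ln z) = z" using z by simp
  have "W \<subseteq> (\<lambda>i. of_real v * h i (exp (of_real (s i) * Ln z))) ` {..<n}"
  proof
    fix \<omega> assume "\<omega> \<in> W"
    then have "card {i. i < n \<and> of_real v * h i (exp (of_real (s i) * Ln z)) = \<omega>} > 0"
      using mu[OF L] pos by simp
    then show "\<omega> \<in> (\<lambda>i. of_real v * h i (exp (of_real (s i) * Ln z))) ` {..<n}"
      by (auto simp: card_gt_0_iff)
  qed
  then have fin: "finite W" by (rule finite_subset) simp
  have sum: "(\<Sum>\<omega>\<in>W. mu \<omega>) = n"
    using sum_card_fibres[OF fin inW[OF L], of n] mu[OF L] by simp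
  have strip: "C1 < Im (\<omega> / of_real v) \<and> Im (\<omega> / of_real v) < C2"
    if "zeros_in_strip N t (\<delta> / of_real (v / vb)) C1 C2" "\<omega> \<in> W" for C1 C2 \<omega>
    using that unfolding zeros_in_strip_def W F by blast
  have "branches_at n (\<lambda>i w. of_real v * h i w) s z W mu"
    unfolding branches_at_def using inW mu by blast
  then show ?thesis using fin sum strip by blast
qed

text \<open>
  Small and large contrast are both covered: \<open>\<zeta> \<delta>\<close> is \<open>\<delta>\<close> or \<open>1 / \<delta>\<close>, the filter \<open>A\<close> says where \<open>\<delta>\<close> goes, and \<open>c\<close>
  absorbs the constant between \<open>\<zeta> \<delta>\<close> and \<open>\<sigma>\<close> or \<open>1 / \<sigma>\<close>.
\<close>

lemma resonance_puiseux_series: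
  fixes kstar c :: real and A :: "complex filter" and \<zeta> :: "complex \<Rightarrow> complex"
  assumes n: "limit_count N t kstar = n" "n > 0"
    and \<zeta>: "filterlim \<zeta> (at 0) A"
    and F: "\<forall>\<^sub>F \<delta> in A. \<delta> \<noteq> 0 \<and> 1 + \<delta> / of_real (v / vb) \<noteq> 0 \<and>
              res_fun N t (\<delta> / of_real (v / vb)) = res_fun N t (of_real c * \<zeta> \<delta>)"
  shows "\<exists>\<epsilon>>0. \<exists>h s.
        (\<forall>i<n. h i analytic_on {0} \<and> s i \<in> \<rat> \<and> s i \<ge> 1 / real n) \<and>
        (\<forall>U. open U \<and> of_real (kstar * v) \<in> U \<and> U \<subseteq> ball (of_real (kstar * v)) \<epsilon> \<longrightarrow>
          (\<forall>\<^sub>F \<delta> in A.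
             let W = nontrivial_resonances N xm xp v vb \<delta> \<inter> U;
                 mu = resonance_multiplicity N xm xp v vb \<delta> in
               finite W \<and> (\<Sum>\<omega>\<in>W. mu \<omega>) = n \<and>
               (\<forall>C1 C2. zeros_in_strip N t (\<delta> / of_real (v / vb)) C1 C2 \<longrightarrow>
                  (\<forall>\<omega>\<in>W. C1 < Im (\<omega> / of_real v) \<and> Im (\<omega> / of_real v) < C2)) \<and>
               branches_at n h s (\<zeta> \<delta>) W mu))"
proof -
  have tn: "t j \<noteq> 0" if "j \<in> {1..2*N-1}" for j using t_pos[OF that] by simp
  obtain R h s where "puiseux_roots (\<lambda>z. res_fun N t (of_real c * z)) (of_real kstar) n R h s"
    using res_fun_puiseux[where t = t, OF N tn n] by blast
  note PR = this[unfolded puiseux_roots_def]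
  have R: "R > 0" and hs: "\<forall>i<n. h i analytic_on {0} \<and> s i \<in> \<rat> \<and> s i \<ge> 1 / real n" using PR by blast+
  have v: "v > 0" using speeds by simp
  show ?thesis
  proof (intro exI[of _ "R * v"] exI[of _ "\<lambda>i w. of_real v * h i w"] exI[of _ s] conjI allI impI)
    show "R * v > 0" using R v by simp
  next
    fix i assume "i < n"
    then show "(\<lambda>w. of_real v * h i w) analytic_on {0}" "s i \<in> \<rat>" "1 / real n \<le> s i"
      using hs by (auto intro!: analytic_intros)
  next
    fix U :: "complex set"
    assume U: "open U \<and> of_real (kstar * v) \<in> U \<and> U \<subseteq> ball (of_real (kstar * v)) (R * v)"
    define V where "V = {k. of_real v * k \<in> U}"
    have "open V"
      unfolding V_def using open_vimage[of U "\<lambda>k. of_real v * k"] U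
      by (auto simp: vimage_def intro!: continuous_intros)
    moreover have "of_real kstar \<in> V" using U by (simp add: V_def mult.commute)
    moreover have "V \<subseteq> ball (of_real kstar) R"
    proof
      fix k assume "k \<in> V"
      then have "of_real v * k \<in> ball (of_real (kstar * v)) (R * v)" using U by (auto simp: V_def)
      then have "norm (of_real v * (of_real kstar - k)) < R * v" by (simp add: dist_norm algebra_simps)
      then show "k \<in> ball (of_real kstar) R" using v by (simp add: norm_mult dist_norm mult.commute)
    qed
    ultimately have "\<forall>\<^sub>F z in at 0. \<forall>L. exp L = z \<longrightarrow>
        (\<forall>i<n. h i (exp (of_real (s i) * L)) \<in> {k\<in>V. res_fun N t (of_real c * z) k = 0}) \<and>
        (\<forall>k\<in>{k\<in>V. res_fun N t (of_real c * z) k = 0}.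
           zorder (res_fun N t (of_real c * z)) k = int (card {i. i < n \<and> h i (exp (of_real (s i) * L)) = k}))"
      using PR by blast
    moreover have "\<forall>\<^sub>F z in at (0::complex). z \<noteq> 0" by (simp add: eventually_at_filter)
    ultimately have ev: "\<forall>\<^sub>F \<delta> in A. \<zeta> \<delta> \<noteq> 0 \<and> (\<forall>L. exp L = \<zeta> \<delta> \<longrightarrow>
        (\<forall>i<n. h i (exp (of_real (s i) * L)) \<in> {k\<in>V. res_fun N t (of_real c * \<zeta> \<delta>) k = 0}) \<and>
        (\<forall>k\<in>{k\<in>V. res_fun N t (of_real c * \<zeta> \<delta>) k = 0}.
           zorder (res_fun N t (of_real c * \<zeta> \<delta>)) k = int (card {i. i < n \<and> h i (exp (of_real (s i) * L)) = k})))"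
      using eventually_compose_filterlim[OF eventually_conj \<zeta>] by simp
    show "\<forall>\<^sub>F \<delta> in A.
             let W = nontrivial_resonances N xm xp v vb \<delta> \<inter> U;
                 mu = resonance_multiplicity N xm xp v vb \<delta> in
               finite W \<and> (\<Sum>\<omega>\<in>W. mu \<omega>) = n \<and>
               (\<forall>C1 C2. zeros_in_strip N t (\<delta> / of_real (v / vb)) C1 C2 \<longrightarrow>
                  (\<forall>\<omega>\<in>W. C1 < Im (\<omega> / of_real v) \<and> Im (\<omega> / of_real v) < C2)) \<and>
               branches_at n (\<lambda>i w. of_real v * h i w) s (\<zeta> \<delta>) W mu"
      using ev F
    proof (rule eventually_elim2, goal_cases)
      case (1 \<delta>)
      then have F\<delta>: "res_fun N t (of_real c * \<zeta> \<delta>) = res_fun N t (\<delta> / of_real (v / vb))" by simp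
      show ?case unfolding Let_def
        by (rule resonances_from_roots[OF refl]) (use 1 in \<open>simp_all add: F\<delta> V_def\<close>)
    qed
  qed
qed

end

theorem theorem3p6:
  fixes N :: nat and xm xp :: "nat \<Rightarrow> real" and v vb r kstar :: real
    and t :: "nat \<Rightarrow> real" and n :: nat
  assumes N: "N \<ge> 1"
    and intervals: "\<forall>j\<in>{1..N}. xm j < xp j"
    and gaps: "\<forall>j\<in>{1..<N}. xp j < xm (Suc j)"
    and speeds: "v > 0" "vb > 0"
    and r: "r = v / vb"
    and t: "t = tvec xm xp r"
    and kstar: "kstar \<in> limit_set N t"
    and n: "n = limit_count N t kstar"
  shows
    "(\<forall>\<sigma>. \<sigma> \<noteq> 1 \<and> \<sigma> \<noteq> -1 \<longrightarrow> (\<exists>C1 C2. zeros_in_strip N t \<sigma> C1 C2))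
     \<and>
     (\<exists>\<epsilon>>0. \<exists>h s.
        (\<forall>i<n. h i analytic_on {0} \<and> s i \<in> \<rat> \<and> s i \<ge> 1 / real n) \<and>
        (\<forall>U. open U \<and> of_real (kstar * v) \<in> U \<and> U \<subseteq> ball (of_real (kstar * v)) \<epsilon> \<longrightarrow>
          (\<forall>\<^sub>F \<delta> in at 0.
             let W = nontrivial_resonances N xm xp v vb \<delta> \<inter> U;
                 mu = resonance_multiplicity N xm xp v vb \<delta> in
               finite W \<and> (\<Sum>\<omega>\<in>W. mu \<omega>) = n \<and>
               (\<forall>C1 C2. zeros_in_strip N t (\<delta> / of_real r) C1 C2 \<longrightarrow>
                  (\<forall>\<omega>\<in>W. C1 < Im (\<omega> / of_real v) \<and> Im (\<omega> / of_real v) < C2)) \<and>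
               branches_at n h s \<delta> W mu)))
     \<and>
     (\<exists>\<epsilon>>0. \<exists>h s.
        (\<forall>i<n. h i analytic_on {0} \<and> s i \<in> \<rat> \<and> s i \<ge> 1 / real n) \<and>
        (\<forall>U. open U \<and> of_real (kstar * v) \<in> U \<and> U \<subseteq> ball (of_real (kstar * v)) \<epsilon> \<longrightarrow>
          (\<forall>\<^sub>F \<delta> in at_infinity.
             let W = nontrivial_resonances N xm xp v vb \<delta> \<inter> U;
                 mu = resonance_multiplicity N xm xp v vb \<delta> in
               finite W \<and> (\<Sum>\<omega>\<in>W. mu \<omega>) = n \<and>
               (\<forall>C1 C2. zeros_in_strip N t (\<delta> / of_real r) C1 C2 \<longrightarrow>
                  (\<forall>\<omega>\<in>W. C1 < Im (\<omega> / of_real v) \<and> Im (\<omega> / of_real v) < C2)) \<and>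
               branches_at n h s (1 / \<delta>) W mu)))"
proof -
  interpret scatterer N xm xp v vb by unfold_locales (fact N intervals gaps speeds)+
  have rpos: "r > 0" using speeds r by simp
  have tv: "t = tvec xm xp (v / vb)" using t r by simp
  have tpos: "t j > 0" if "j \<in> {1..2*N-1}" for j using t_pos[OF that] by (simp add: tv)
  have "n > 0"
  proof -
    from kstar obtain j m where j: "j \<in> {1..2*N-1}" "kstar = pi * of_int m / t j"
      unfolding limit_set_def by blast
    then have "t j * kstar = pi * of_int m" using tpos[OF j(1)] by simp
    then have "{j \<in> {1..2*N-1}. \<exists>m::int. t j * kstar = pi * of_int m} \<noteq> {}" using j(1) by blast
    then show ?thesis unfolding n limit_count_def by (simp add: card_gt_0_iff)
  qed
  note series = resonance_puiseux_series[OF n[symmetric, unfolded tv] this, folded tv r]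
  have strip: "\<forall>\<sigma>. \<sigma> \<noteq> 1 \<and> \<sigma> \<noteq> -1 \<longrightarrow> (\<exists>C1 C2. zeros_in_strip N t \<sigma> C1 C2)"
    using zeros_in_strip_exist[where t = t, OF N tpos] by blast
  have ne: "1 + \<delta> / of_real r \<noteq> 0" if "norm \<delta> \<noteq> r" for \<delta> :: complex
  proof
    assume "1 + \<delta> / of_real r = 0"
    then have "\<delta> / of_real r = -1" by (simp add: eq_neg_iff_add_eq_0 add.commute)
    then have "norm (\<delta> / of_real r) = 1" by simp
    then show False using that rpos by (simp add: norm_divide field_simps)
  qed
  have small: "\<forall>\<^sub>F \<delta> in at 0. \<delta> \<noteq> 0 \<and> 1 + \<delta> / of_real r \<noteq> 0 \<and>
      res_fun N t (\<delta> / of_real r) = res_fun N t (of_real (1 / r) * \<delta>)"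
    unfolding eventually_at using rpos ne by (intro exI[of _ r]) (auto simp: mult.commute)
  have large: "\<forall>\<^sub>F \<delta> in at_infinity. \<delta> \<noteq> 0 \<and> 1 + \<delta> / of_real r \<noteq> 0 \<and>
      res_fun N t (\<delta> / of_real r) = res_fun N t (of_real r * (1 / \<delta>))"
    unfolding eventually_at_infinity
  proof (intro exI[of _ "r + 1"] allI impI)
    fix \<delta> :: complex assume "norm \<delta> \<ge> r + 1"
    then have "\<delta> \<noteq> 0" "norm \<delta> \<noteq> r" using rpos by auto
    then show "\<delta> \<noteq> 0 \<and> 1 + \<delta> / of_real r \<noteq> 0 \<and>
      res_fun N t (\<delta> / of_real r) = res_fun N t (of_real r * (1 / \<delta>))"
      using ne res_fun_inverse[OF N, of "\<delta> / of_real r" t] rpos by simp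
  qed
  have "filterlim (\<lambda>\<delta>::complex. 1 / \<delta>) (at 0) at_infinity"
    unfolding filterlim_at
    using tendsto_divide_0[OF tendsto_const filterlim_ident] eventually_not_equal_at_infinity[of "0::complex"]
    by (auto elim: eventually_mono)
  from strip series[OF filterlim_ident small] series[OF this large] show ?thesis by blast
qed

end
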